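(* Let $\boldsymbol{F}$ be a bilinear-like $G^2$ two-patch parameterization with geometry mappings in $\mathcal{S}(\mathcal{T}_k^{p,r},[0,1]^2)\times\mathcal{S}(\mathcal{T}_k^{p,r},[0,1]^2)$ and functions $\alpha^{(L)},\alpha^{(R)},\beta^{(L)},\beta^{(R)}\in\mathcal{P}^1([0,1])$. Let $n_0=\dim\mathcal{S}(\mathcal{T}_k^{p,r+2},[0,1])$, $\bar n_1=\dim\mathcal{S}(\mathcal{T}_k^{p-d_\alpha,r+1},[0,1])$, $\bar n_2=\dim\mathcal{S}(\mathcal{T}_k^{p-2d_\alpha,r},[0,1])$. Then the isogeometric functions $\bar\phi_{0,j}$ ($0\le j\le n_0-1$), $\bar\phi_{1,j}$ ($0\le j\le\bar n_1-1$), $\bar\phi_{2,j}$ ($0\le j\le\bar n_2-1$), determined by $\bar\phi_{i,j}\circ\boldsymbol{F}^{(S)}=g_{i,j}^{(S)}$, $S\in\{L,R\}$, with $$g_{0,j}^{(S)}(u,v)=N_j^{p,r+2}(v)M_0(u)+\beta^{(S)}(v)(N_j^{p,r+2})'(v)M_1(u)+\big(\beta^{(S)}(v)\big)^2(N_j^{p,r+2})''(v)M_2(u),$$ $$g_{1,j}^{(S)}(u,v)=\alpha^{(S)}(v)N_j^{p-d_\alpha,r+1}(v)M_1(u)+2\alpha^{(S)}(v)\beta^{(S)}(v)(N_j^{p-d_\alpha,r+1})'(v)M_2(u),$$ $$g_{2,j}^{(S)}(u,v)=\big(\alpha^{(S)}(v)\big)^2N_j^{p-2d_\alpha,r}(v)M_2(u),$$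 form a basis of the space $\mathcal{W}_2^2$.
   Context: Splines. Fix integers $p\ge 5$, $2\le r\le p-3$, $k\ge 0$ and reals $0<\tau_1<\dots<\tau_k<1$ (with $\tau_1:=1$ if $k=0$ wherever $\tau_1$ is used). For integers $r'<p'$, $\mathcal{T}_k^{p',r'}$ is the open knot vector in which $0$ and $1$ appear $p'+1$ times and each $\tau_i$ appears $p'-r'$ times. $\mathcal{S}(\mathcal{T}_k^{p',r'},[0,1])$ is the univariate spline space of degree $p'$ on $[0,1]$ over this knot vector ($C^{r'}$ at each $\tau_i$), with B-splines $N_i^{p',r'}$, $i=0,\dots,p'+k(p'-r')$. $\mathcal{S}(\mathcal{T}_k^{p,r},[0,1]^2)$ is the tensor product space with B-splines $N_{i,j}^{p,r}(u,v)=N_i^{p,r}(u)N_j^{p,r}(v)$. $\mathcal{P}^m([0,1])$ denotes polynomials of degree at most $m$. Two-patch parameterization. $\boldsymbol{F}$ consists of two regular (nonvanishing Jacobian determinant on $[0,1]^2$) injective mappings $\boldsymbol{F}^{(S)}:[0,1]^2\to\mathbb{R}^2$, $S\in\{L,R\}$, with components in $\mathcal{S}(\mathcal{T}_k^{p,r},[0,1]^2)$. Put $\Omega^{(S)}=\boldsymbol{F}^{(S)}([0,1]^2)$, $\Omega=\Omega^{(L)}\cup\Omega^{(R)}$. The two patches share exactly one whole edge $\Gamma=\Omega^{(L)}\cap\Omega^{(R)}$, parameterized by $\boldsymbol{F}_0(v)=\boldsymbol{F}^{(L)}(0,v)=\boldsymbol{F}^{(R)}(0,v)$, $v\in[0,1]$.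 Bilinear-like $G^2$. $\boldsymbol{F}$ is called bilinear-like $G^2$ if there are $\alpha^{(L)},\alpha^{(R)},\beta^{(L)},\beta^{(R)}\in\mathcal{P}^1([0,1])$ with $\alpha^{(L)}(v)\alpha^{(R)}(v)<0$ on $[0,1]$ such that, with $\beta=\alpha^{(L)}\beta^{(R)}-\alpha^{(R)}\beta^{(L)}$, $\eta=2(\alpha^{(L)})'\alpha^{(R)}\beta$, $\theta=2\big(\alpha^{(L)}(\beta^{(L)})'-(\alpha^{(L)})'\beta^{(L)}\big)\alpha^{(R)}\beta$, $\boldsymbol{Z}(v)=(\alpha^{(L)})^2D_{uu}\boldsymbol{F}^{(R)}(0,v)-\big((\alpha^{(R)})^2D_{uu}\boldsymbol{F}^{(L)}(0,v)+2\alpha^{(R)}\beta D_{uv}\boldsymbol{F}^{(L)}(0,v)+\beta^2\boldsymbol{F}_0''(v)\big)$, one has for all $v\in[0,1]$: $\boldsymbol{F}^{(L)}(0,v)=\boldsymbol{F}^{(R)}(0,v)$; $\alpha^{(R)}D_u\boldsymbol{F}^{(L)}(0,v)-\alpha^{(L)}D_u\boldsymbol{F}^{(R)}(0,v)+\beta D_v\boldsymbol{F}^{(L)}(0,v)=\boldsymbol{0}$; and $\alpha^{(L)}\boldsymbol{Z}(v)+\eta D_u\boldsymbol{F}^{(L)}(0,v)+\theta D_v\boldsymbol{F}^{(L)}(0,v)=\boldsymbol{0}$. Such functions are fixed, and $d_\alpha=\max(\deg\alpha^{(L)},\deg\alpha^{(R)})$. Isogeometric spaces. $\mathcal{V}=\{\phi:\Omega\to\mathbb{R}\mid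 g^{(S)}:=\phi\circ\boldsymbol{F}^{(S)}\in\mathcal{S}(\mathcal{T}_k^{p,r},[0,1]^2),\ S\in\{L,R\}\}$, $\mathcal{V}^2=\mathcal{V}\cap C^2(\Omega)$ ($C^2$ up to the boundary). Write $g^{(S)}=\sum_{i,j}d_{i,j}^{(S)}N_{i,j}^{p,r}$. $\mathcal{V}_2^2$ is the subspace of $\phi\in\mathcal{V}^2$ with $d^{(S)}_{i,j}=0$ for all $S$, all $j$ and all $i\ge3$. Let $M_0=N_0^{p,r}+N_1^{p,r}+N_2^{p,r}$, $M_1=\frac{\tau_1}{p}(N_1^{p,r}+2N_2^{p,r})$, $M_2=\frac{\tau_1^2}{p(p-1)}N_2^{p,r}$. $\mathcal{W}_2^2$ is the space of all $\phi\in\mathcal{V}_2^2$ for which there is a triplet $(g_0,g_1,g_2)\in\mathcal{S}(\mathcal{T}_k^{p,r+2},[0,1])\times\mathcal{S}(\mathcal{T}_k^{p-d_\alpha,r+1},[0,1])\times\mathcal{S}(\mathcal{T}_k^{p-2d_\alpha,r},[0,1])$ such that for both $S\in\{L,R\}$ $$g^{(S)}(u,v)=g_0(v)M_0(u)+\big(\alpha^{(S)}g_1+\beta^{(S)}g_0'\big)(v)M_1(u)+\big((\beta^{(S)})^2g_0''+2\alpha^{(S)}\beta^{(S)}g_1'+(\alpha^{(S)})^2g_2\big)(v)M_2(u).$$ *)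

theory Defs
  imports "HOL-Analysis.Analysis" "HOL-Library.Function_Algebras"
begin

subsection \<open>Real-valued functions as a vector space\<close>

instantiation "fun" :: (type, real_vector) real_vector
begin

definition scaleR_fun_def: "scaleR c f = (\<lambda>x. c *\<^sub>R f x)"

instance
  by standard (simp_all add: scaleR_fun_def plus_fun_def fun_eq_iff algebra_simps)

end

text \<open>A function on a set \<open>A\<close> is represented by its extension by zero to the whole type, so that
  equality and linear independence of the extensions are those of the functions on \<open>A\<close>.\<close>

definition zero_ext :: "'a set \<Rightarrow> ('a \<Rightarrow> real) \<Rightarrow> 'a \<Rightarrow> real" where
  "zero_ext A f = (\<lambda>x. if x \<in> A then f x else 0)"

definition is_basis_family :: "('i \<Rightarrow> 'a::real_vector) \<Rightarrow> 'i set \<Rightarrow> 'a set \<Rightarrow> bool" where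
  "is_basis_family b I W \<longleftrightarrow> inj_on b I \<and> independent (b ` I) \<and> span (b ` I) = W"

subsection \<open>Derivatives on the unit interval and the unit square\<close>

abbreviation unit_sq :: "(real \<times> real) set" where
  "unit_sq \<equiv> {0..1} \<times> {0..1}"

text \<open>Derivatives are taken within \<open>{0..1}\<close>, hence they are one-sided at \<open>0\<close> and \<open>1\<close>.\<close>

definition D1 :: "(real \<Rightarrow> 'a::real_normed_vector) \<Rightarrow> real \<Rightarrow> 'a" where
  "D1 f x = vector_derivative f (at x within {0..1})"

definition Du :: "(real \<times> real \<Rightarrow> 'a::real_normed_vector) \<Rightarrow> real \<times> real \<Rightarrow> 'a" where
  "Du f = (\<lambda>(u, v). D1 (\<lambda>s. f (s, v)) u)"

definition Dv :: "(real \<times> real \<Rightarrow> 'a::real_normed_vector) \<Rightarrow> real \<times> real \<Rightarrow> 'a" where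
  "Dv f = (\<lambda>(u, v). D1 (\<lambda>t. f (u, t)) v)"

subsection \<open>B-splines and spline spaces\<close>

text \<open>Cox--de Boor recursion; the convention \<open>0 / 0 = 0\<close> for repeated knots is Isabelle's
  \<open>x / 0 = 0\<close>. The last nonempty knot interval is closed on the right, so that
  the B-splines are continuous from the left at the right end point. For an open knot vector from
  \<open>0\<close> to \<open>1\<close> they vanish outside \<open>[0, 1]\<close>.\<close>

fun bspline :: "real list \<Rightarrow> nat \<Rightarrow> nat \<Rightarrow> real \<Rightarrow> real" where
  "bspline t 0 i x =
    (if t ! i \<le> x \<and> x < t ! (i + 1) \<or> t ! i < t ! (i + 1) \<and> t ! (i + 1) = last t \<and> x = last t
     then 1 else 0)"
| "bspline t (Suc q) i x =
    (x - t ! i) / (t ! (i + q + 1) - t ! i) * bspline t q i x +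
    (t ! (i + q + 2) - x) / (t ! (i + q + 2) - t ! (i + 1)) * bspline t q (i + 1) x"

text \<open>The \<open>k\<close> inner knots are \<open>\<tau> 1, \<dots>, \<tau> k\<close>; other values of \<open>\<tau>\<close> are irrelevant.\<close>

context
  fixes k :: nat and \<tau> :: "nat \<Rightarrow> real"
begin

definition knots :: "nat \<Rightarrow> nat \<Rightarrow> real list" where
  "knots p r = replicate (p + 1) 0 @ concat (map (\<lambda>i. replicate (p - r) (\<tau> i)) [1..<k + 1])
     @ replicate (p + 1) 1"

definition N :: "nat \<Rightarrow> nat \<Rightarrow> nat \<Rightarrow> real \<Rightarrow> real" where
  "N p r i = bspline (knots p r) p i"

definition N2 :: "nat \<Rightarrow> nat \<Rightarrow> nat \<Rightarrow> nat \<Rightarrow> real \<times> real \<Rightarrow> real" where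
  "N2 p r i j = (\<lambda>(u, v). N p r i u * N p r j v)"

definition spline_space :: "nat \<Rightarrow> nat \<Rightarrow> (real \<Rightarrow> real) set" where
  "spline_space p r = span (N p r ` {..p + k * (p - r)})"

definition spline_space2 :: "nat \<Rightarrow> nat \<Rightarrow> (real \<times> real \<Rightarrow> real) set" where
  "spline_space2 p r =
     span ((\<lambda>(i, j). N2 p r i j) ` ({..p + k * (p - r)} \<times> {..p + k * (p - r)}))"

definition tau1 :: real where
  "tau1 = (if k = 0 then 1 else \<tau> 1)"

definition M0 :: "nat \<Rightarrow> nat \<Rightarrow> real \<Rightarrow> real" where
  "M0 p r u = N p r 0 u + N p r 1 u + N p r 2 u"

definition M1 :: "nat \<Rightarrow> nat \<Rightarrow> real \<Rightarrow> real" where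
  "M1 p r u = tau1 / real p * (N p r 1 u + 2 * N p r 2 u)"

definition M2 :: "nat \<Rightarrow> nat \<Rightarrow> real \<Rightarrow> real" where
  "M2 p r u = tau1\<^sup>2 / (real p * (real p - 1)) * N p r 2 u"

end

subsection \<open>Two-patch parameterizations\<close>

datatype patch = Lft | Rgt

definition Omega :: "(patch \<Rightarrow> real \<times> real \<Rightarrow> real \<times> real) \<Rightarrow> (real \<times> real) set" where
  "Omega F = F Lft ` unit_sq \<union> F Rgt ` unit_sq"

definition jacobian_det :: "(real \<times> real \<Rightarrow> real \<times> real) \<Rightarrow> real \<times> real \<Rightarrow> real" where
  "jacobian_det G z = fst (Du G z) * snd (Dv G z) - fst (Dv G z) * snd (Du G z)"

definition two_patch_parameterization ::
  "nat \<Rightarrow> (nat \<Rightarrow> real) \<Rightarrow> nat \<Rightarrow> nat \<Rightarrow> (patch \<Rightarrow> real \<times> real \<Rightarrow> real \<times> real) \<Rightarrow> bool" where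
  "two_patch_parameterization k \<tau> p r F \<longleftrightarrow>
     (\<forall>S. zero_ext unit_sq (\<lambda>z. fst (F S z)) \<in> spline_space2 k \<tau> p r \<and>
          zero_ext unit_sq (\<lambda>z. snd (F S z)) \<in> spline_space2 k \<tau> p r \<and>
          (\<forall>z\<in>unit_sq. jacobian_det (F S) z \<noteq> 0) \<and>
          inj_on (F S) unit_sq) \<and>
     (\<forall>v\<in>{0..1}. F Lft (0, v) = F Rgt (0, v)) \<and>
     F Lft ` unit_sq \<inter> F Rgt ` unit_sq = (\<lambda>v. F Lft (0, v)) ` {0..1}"

definition beta_poly :: "(patch \<Rightarrow> real poly) \<Rightarrow> (patch \<Rightarrow> real poly) \<Rightarrow> real poly" where
  "beta_poly \<alpha> \<beta> = \<alpha> Lft * \<beta> Rgt - \<alpha> Rgt * \<beta> Lft"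

definition eta_poly :: "(patch \<Rightarrow> real poly) \<Rightarrow> (patch \<Rightarrow> real poly) \<Rightarrow> real poly" where
  "eta_poly \<alpha> \<beta> = 2 * pderiv (\<alpha> Lft) * \<alpha> Rgt * beta_poly \<alpha> \<beta>"

definition theta_poly :: "(patch \<Rightarrow> real poly) \<Rightarrow> (patch \<Rightarrow> real poly) \<Rightarrow> real poly" where
  "theta_poly \<alpha> \<beta> =
     2 * (\<alpha> Lft * pderiv (\<beta> Lft) - pderiv (\<alpha> Lft) * \<beta> Lft) * \<alpha> Rgt * beta_poly \<alpha> \<beta>"

definition Z_fun :: "(patch \<Rightarrow> real \<times> real \<Rightarrow> real \<times> real) \<Rightarrow> (patch \<Rightarrow> real poly) \<Rightarrow>
    (patch \<Rightarrow> real poly) \<Rightarrow> real \<Rightarrow> real \<times> real" where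
  "Z_fun F \<alpha> \<beta> v =
     (poly (\<alpha> Lft) v)\<^sup>2 *\<^sub>R Du (Du (F Rgt)) (0, v) -
     ((poly (\<alpha> Rgt) v)\<^sup>2 *\<^sub>R Du (Du (F Lft)) (0, v) +
      (2 * poly (\<alpha> Rgt) v * poly (beta_poly \<alpha> \<beta>) v) *\<^sub>R Dv (Du (F Lft)) (0, v) +
      (poly (beta_poly \<alpha> \<beta>) v)\<^sup>2 *\<^sub>R D1 (D1 (\<lambda>v. F Lft (0, v))) v)"

definition bilinear_like_G2 :: "(patch \<Rightarrow> real \<times> real \<Rightarrow> real \<times> real) \<Rightarrow> (patch \<Rightarrow> real poly) \<Rightarrow>
    (patch \<Rightarrow> real poly) \<Rightarrow> bool" where
  "bilinear_like_G2 F \<alpha> \<beta> \<longleftrightarrow>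
     (\<forall>S. degree (\<alpha> S) \<le> 1 \<and> degree (\<beta> S) \<le> 1) \<and>
     (\<forall>v\<in>{0..1}.
        poly (\<alpha> Lft) v * poly (\<alpha> Rgt) v < 0 \<and>
        F Lft (0, v) = F Rgt (0, v) \<and>
        poly (\<alpha> Rgt) v *\<^sub>R Du (F Lft) (0, v) - poly (\<alpha> Lft) v *\<^sub>R Du (F Rgt) (0, v)
          + poly (beta_poly \<alpha> \<beta>) v *\<^sub>R Dv (F Lft) (0, v) = 0 \<and>
        poly (\<alpha> Lft) v *\<^sub>R Z_fun F \<alpha> \<beta> v + poly (eta_poly \<alpha> \<beta>) v *\<^sub>R Du (F Lft) (0, v)
          + poly (theta_poly \<alpha> \<beta>) v *\<^sub>R Dv (F Lft) (0, v) = 0)"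

definition d_alpha :: "(patch \<Rightarrow> real poly) \<Rightarrow> nat" where
  "d_alpha \<alpha> = max (degree (\<alpha> Lft)) (degree (\<alpha> Rgt))"

subsection \<open>Isogeometric spaces\<close>

text \<open>\<open>C\<^sup>2\<close> up to the boundary: twice continuously differentiable in the interior, with the function
  and its derivatives of order one and two extending continuously to \<open>A\<close>.\<close>

definition C2_up_to_boundary :: "'a::real_normed_vector set \<Rightarrow> ('a \<Rightarrow> real) \<Rightarrow> bool" where
  "C2_up_to_boundary A \<phi> \<longleftrightarrow> continuous_on A \<phi> \<and>
     (\<exists>(D :: 'a \<Rightarrow> 'a \<Rightarrow>\<^sub>L real) (DD :: 'a \<Rightarrow> 'a \<Rightarrow>\<^sub>L ('a \<Rightarrow>\<^sub>L real)).
        continuous_on A D \<and> continuous_on A DD \<and>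
        (\<forall>x\<in>interior A. (\<phi> has_derivative blinfun_apply (D x)) (at x) \<and>
                        (D has_derivative blinfun_apply (DD x)) (at x)))"

context
  fixes k :: nat and \<tau> :: "nat \<Rightarrow> real" and p r :: nat
    and F :: "patch \<Rightarrow> real \<times> real \<Rightarrow> real \<times> real"
begin

definition pullback :: "(real \<times> real \<Rightarrow> real) \<Rightarrow> patch \<Rightarrow> real \<times> real \<Rightarrow> real" where
  "pullback \<phi> S = zero_ext unit_sq (\<phi> \<circ> F S)"

definition V :: "(real \<times> real \<Rightarrow> real) set" where
  "V = {\<phi>. zero_ext (Omega F) \<phi> = \<phi> \<and> (\<forall>S. pullback \<phi> S \<in> spline_space2 k \<tau> p r)}"

definition V2 :: "(real \<times> real \<Rightarrow> real) set" where
  "V2 = {\<phi> \<in> V. C2_up_to_boundary (Omega F) \<phi>}"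

definition V22 :: "(real \<times> real \<Rightarrow> real) set" where
  "V22 = {\<phi> \<in> V2. \<exists>d :: patch \<Rightarrow> nat \<Rightarrow> nat \<Rightarrow> real.
     (\<forall>S. pullback \<phi> S =
        (\<Sum>i\<le>p + k * (p - r). \<Sum>j\<le>p + k * (p - r). d S i j *\<^sub>R N2 k \<tau> p r i j)) \<and>
     (\<forall>S. \<forall>i\<ge>3. \<forall>j. d S i j = 0)}"

definition W22 :: "(patch \<Rightarrow> real poly) \<Rightarrow> (patch \<Rightarrow> real poly) \<Rightarrow> (real \<times> real \<Rightarrow> real) set" where
  "W22 \<alpha> \<beta> = {\<phi> \<in> V22.
     \<exists>g0 \<in> spline_space k \<tau> p (r + 2).
     \<exists>g1 \<in> spline_space k \<tau> (p - d_alpha \<alpha>) (r + 1).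
     \<exists>g2 \<in> spline_space k \<tau> (p - 2 * d_alpha \<alpha>) r.
       \<forall>S. \<forall>u\<in>{0..1}. \<forall>v\<in>{0..1}.
         pullback \<phi> S (u, v) =
           g0 v * M0 k \<tau> p r u
           + (poly (\<alpha> S) v * g1 v + poly (\<beta> S) v * D1 g0 v) * M1 k \<tau> p r u
           + ((poly (\<beta> S) v)\<^sup>2 * D1 (D1 g0) v + 2 * poly (\<alpha> S) v * poly (\<beta> S) v * D1 g1 v
              + (poly (\<alpha> S) v)\<^sup>2 * g2 v) * M2 k \<tau> p r u}"

text \<open>Only the indices \<open>i = 0, 1, 2\<close> and the values on the unit square are relevant.\<close>

definition gbar :: "(patch \<Rightarrow> real poly) \<Rightarrow> (patch \<Rightarrow> real poly) \<Rightarrow> nat \<Rightarrow> nat \<Rightarrow>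
    patch \<Rightarrow> real \<times> real \<Rightarrow> real" where
  "gbar \<alpha> \<beta> i j S = (\<lambda>(u, v).
     if i = 0 then
       N k \<tau> p (r + 2) j v * M0 k \<tau> p r u
       + poly (\<beta> S) v * D1 (N k \<tau> p (r + 2) j) v * M1 k \<tau> p r u
       + (poly (\<beta> S) v)\<^sup>2 * D1 (D1 (N k \<tau> p (r + 2) j)) v * M2 k \<tau> p r u
     else if i = 1 then
       poly (\<alpha> S) v * N k \<tau> (p - d_alpha \<alpha>) (r + 1) j v * M1 k \<tau> p r u
       + 2 * poly (\<alpha> S) v * poly (\<beta> S) v * D1 (N k \<tau> (p - d_alpha \<alpha>) (r + 1) j) v * M2 k \<tau> p r u
     else
       (poly (\<alpha> S) v)\<^sup>2 * N k \<tau> (p - 2 * d_alpha \<alpha>) r j v * M2 k \<tau> p r u)"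

end

text \<open>\<open>\<phi>\<close> is the function on \<open>\<Omega>\<close> with \<open>\<phi> \<circ> F S = g S\<close> on the unit square for both patches.\<close>

definition determined_by :: "(patch \<Rightarrow> real \<times> real \<Rightarrow> real \<times> real) \<Rightarrow>
    (patch \<Rightarrow> real \<times> real \<Rightarrow> real) \<Rightarrow> (real \<times> real \<Rightarrow> real) \<Rightarrow> bool" where
  "determined_by F g \<phi> \<longleftrightarrow>
     zero_ext (Omega F) \<phi> = \<phi> \<and> (\<forall>S. \<forall>z\<in>unit_sq. \<phi> (F S z) = g S z)"

definition phibar :: "nat \<Rightarrow> (nat \<Rightarrow> real) \<Rightarrow> nat \<Rightarrow> nat \<Rightarrow>
    (patch \<Rightarrow> real \<times> real \<Rightarrow> real \<times> real) \<Rightarrow> (patch \<Rightarrow> real poly) \<Rightarrow> (patch \<Rightarrow> real poly) \<Rightarrow>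
    nat \<Rightarrow> nat \<Rightarrow> real \<times> real \<Rightarrow> real" where
  "phibar k \<tau> p r F \<alpha> \<beta> i j = (THE \<phi>. determined_by F (gbar k \<tau> p r \<alpha> \<beta> i j) \<phi>)"

end

(*
  Idea. The spline space of degree d and smoothness r is the span of the truncated powers
  (x - t)_+^j; the Marsden identity puts these into the span of the B-splines, and counting shows
  that the B-splines form a basis. In the truncated power basis, spline spaces are visibly closed
  under differentiation and multiplication by polynomials, so every function phi determined by a
  triplet (g0, g1, g2) is a spline on each patch.

  Such a phi is C^2: the functions M_i are dual to the derivatives of order i at u = 0, so on the
  edge the triplet prescribes the value g0 of phi, its derivative g1 along a transversal vector xi
  shared by the two patches (d_u F^S = alpha^S xi + beta^S t with t the edge tangent), and hence the
  gradient. The two Hessians agree on t, and the second order condition on F makes them agree on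
  (xi, xi). Derivatives relative to the patch images glue to derivatives relative to Omega, which
  avoids any discussion of which points are interior to Omega.

  Therefore W_2^2 is the image of the product of the three univariate spline spaces under the linear
  map (g0, g1, g2) -> phi, which is injective since alpha^S has no zeros, and the functions
  phibar are the images of the B-spline bases.
*)
theory Submission
  imports Defs
begin

subsection \<open>Finite families in vector spaces\<close>

text \<open>The B-splines are given only by their recursion, as functions on the whole line, and
  nothing is known at the outset about their independence or their derivatives. Truncated powers
  carry both, provided that they too are extended by zero outside [0, 1]. The operator
  \<open>D1\<close> is meaningful only on [0, 1], so derivatives of splines are replaced by genuine
  splines that agree with them there. The second order condition enters as follows. Expanding the
  second u-derivative of the pullback of phi by the chain rule gives the Hessian at (xi, xi), known
  terms, and the gradient of phi applied to d_uu F^S. The last term depends on the patch and is not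
  controlled by the first order data. The condition on \<open>Z_fun\<close>, paired with the
  gradient, relates these terms for the two patches; \<open>eta_poly\<close> and
  \<open>theta_poly\<close> absorb the derivatives of alpha^L and beta^L that arise because the
  known mixed derivative is that of alpha^L xi + beta^L t and not that of xi.\<close>

lemma span_family:
  fixes b :: "'i \<Rightarrow> 'a::real_vector"
  assumes "finite I"
  shows "span (b ` I) = range (\<lambda>c. \<Sum>i\<in>I. c i *\<^sub>R b i)" (is "_ = ?R")
proof
  have "subspace ?R"
    unfolding subspace_def
  proof (intro conjI ballI allI)
    show "0 \<in> ?R" by (rule range_eqI[of _ _ "\<lambda>i. 0"]) simp
  next
    fix x y assume "x \<in> ?R" "y \<in> ?R"
    then obtain c d where "x = (\<Sum>i\<in>I. c i *\<^sub>R b i)" "y = (\<Sum>i\<in>I. d i *\<^sub>R b i)" by blast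
    then show "x + y \<in> ?R"
      by (intro range_eqI[of _ _ "\<lambda>i. c i + d i"]) (simp add: sum.distrib scaleR_left_distrib)
  next
    fix a :: real and x assume "x \<in> ?R"
    then obtain c where "x = (\<Sum>i\<in>I. c i *\<^sub>R b i)" by blast
    then show "a *\<^sub>R x \<in> ?R"
      by (intro range_eqI[of _ _ "\<lambda>i. a * c i"]) (simp add: scaleR_sum_right)
  qed
  moreover have "b ` I \<subseteq> ?R"
  proof
    fix x assume "x \<in> b ` I"
    then obtain j where "j \<in> I" "x = b j" by blast
    have "(\<Sum>i\<in>I. (if i = j then 1 else 0) *\<^sub>R b i) = (\<Sum>i\<in>I. if i = j then b i else 0)"
      by (rule sum.cong) auto
    then show "x \<in> ?R" using assms \<open>j \<in> I\<close> \<open>x = b j\<close>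
      by (intro range_eqI[of _ _ "\<lambda>i. if i = j then 1 else 0"]) simp
  qed
  ultimately show "span (b ` I) \<subseteq> ?R" by (rule span_minimal[rotated])
  show "?R \<subseteq> span (b ` I)" by (auto intro!: span_sum span_scale intro: span_base)
qed

text \<open>A coincidence of \<open>b i\<close> and \<open>b j\<close> for different indices is the
  relation with coefficients 1 and -1, so the coefficient form of independence yields injectivity as
  well.\<close>

lemma is_basis_familyI:
  fixes b :: "'i \<Rightarrow> 'a::real_vector"
  assumes "finite I"
    and indep: "\<And>c i. (\<Sum>i\<in>I. c i *\<^sub>R b i) = 0 \<Longrightarrow> i \<in> I \<Longrightarrow> c i = 0"
    and W: "W = range (\<lambda>c. \<Sum>i\<in>I. c i *\<^sub>R b i)"
  shows "is_basis_family b I W"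
proof -
  have inj: "inj_on b I"
  proof (rule inj_onI, rule ccontr)
    fix i j assume ij: "i \<in> I" "j \<in> I" "b i = b j" "i \<noteq> j"
    define c where "c = (\<lambda>l. if l = i then 1 else if l = j then -1 else (0::real))"
    have "(\<Sum>l\<in>I. c l *\<^sub>R b l) = (\<Sum>l\<in>{i, j}. c l *\<^sub>R b l)"
      using assms(1) ij by (intro sum.mono_neutral_right) (auto simp: c_def)
    also have "\<dots> = 0" using ij by (simp add: c_def)
    finally have "c i = 0" using indep ij by blast
    then show False by (simp add: c_def)
  qed
  have "independent (b ` I)"
  proof (rule independent_if_scalars_zero)
    show "finite (b ` I)" using assms by simp
    fix f x assume f: "(\<Sum>x\<in>b ` I. f x *\<^sub>R x) = 0" and x: "x \<in> b ` I"
    have "(\<Sum>i\<in>I. f (b i) *\<^sub>R b i) = 0" using f by (simp add: sum.reindex[OF inj])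
    then show "f x = 0" using indep[of "\<lambda>i. f (b i)"] x by auto
  qed
  then show ?thesis using inj span_family[OF assms(1)] W by (simp add: is_basis_family_def)
qed

lemma is_basis_family_zero:
  fixes b :: "'i \<Rightarrow> 'a::real_vector"
  assumes "is_basis_family b I W" "finite I" "(\<Sum>i\<in>I. c i *\<^sub>R b i) = 0" "i \<in> I"
  shows "c i = 0"
proof -
  have inj: "inj_on b I" and ind: "independent (b ` I)"
    using assms(1) by (auto simp: is_basis_family_def)
  have "(\<Sum>x\<in>b ` I. c (inv_into I b x) *\<^sub>R x) = 0"
    using assms(3) by (simp add: sum.reindex[OF inj] inj)
  then have "c (inv_into I b (b i)) = 0"
    using independentD[OF ind, of "b ` I" "\<lambda>x. c (inv_into I b x)" "b i"] assms(2,4) by simp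
  then show ?thesis using inj assms(4) by simp
qed

text \<open>A spanning family that is at most as long as an independent family in its span is itself
  a basis; this replaces a direct proof of the independence of the B-splines.\<close>

lemma is_basis_family_exchange:
  fixes a :: "'j \<Rightarrow> 'a::real_vector" and b :: "'i \<Rightarrow> 'a"
  assumes a: "is_basis_family a J W" and fin: "finite I" "finite J" and card: "card I \<le> card J"
    and sub: "a ` J \<subseteq> span (b ` I)"
  shows "is_basis_family b I W"
proof -
  have inja: "inj_on a J" and inda: "independent (a ` J)" and W: "W = span (a ` J)"
    using a by (auto simp: is_basis_family_def)
  have ca: "card (a ` J) = card J" using inja by (rule card_image)
  have le: "card (b ` I) \<le> card J" using card_image_le[OF fin(1), of b] card by linarith
  \<comment> \<open>Since \<open>B\<close> still spans the family \<open>a\<close>, the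
    cardinalities of \<open>J\<close>, \<open>B\<close>, the image of \<open>b\<close>, and
    \<open>I\<close> form a closed chain of inequalities and therefore coincide.\<close>
  obtain B where B: "B \<subseteq> b ` I" "independent B" "b ` I \<subseteq> span B"
    using maximal_independent_subset by blast
  have finB: "finite B" using B(1) fin finite_subset by blast
  have "a ` J \<subseteq> span B" using sub B(3) by (metis order_trans span_minimal subspace_span)
  then have "card J \<le> card B" using independent_span_bound[OF finB inda] ca by simp
  moreover have "card B \<le> card (b ` I)" using B(1) fin by (simp add: card_mono)
  ultimately have eq: "card B = card (b ` I)" "card (b ` I) = card J" using le by linarith+
  have "B = b ` I" using B(1) eq(1) fin by (simp add: card_subset_eq)
  then have indb: "independent (b ` I)" using B(2) by simp
  have "card (b ` I) = card I" using eq(2) card card_image_le[OF fin(1), of b] by linarith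
  then have injb: "inj_on b I" using fin eq_card_imp_inj_on by blast
  \<comment> \<open>A member of \<open>b\<close> outside the span of \<open>a\<close> could be
    adjoined to \<open>a\<close>, giving more independent vectors in the span of \<open>b\<close>
    than \<open>b\<close> has members.\<close>
  have "x \<in> span (a ` J)" if x: "x \<in> b ` I" for x
  proof (rule ccontr)
    assume nx: "x \<notin> span (a ` J)"
    then have "independent (insert x (a ` J))" using inda by (simp add: independent_insert span_base)
    moreover have "insert x (a ` J) \<subseteq> span (b ` I)" using sub x by (auto intro: span_base)
    ultimately have "card (insert x (a ` J)) \<le> card (b ` I)"
      using independent_span_bound[of "b ` I"] fin by blast
    moreover have "x \<notin> a ` J" using nx span_base[of x "a ` J"] by argo
    ultimately show False using fin eq(2) ca by simp
  qed
  then have "span (b ` I) = span (a ` J)"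
    using span_minimal[OF _ subspace_span, of "b ` I" "a ` J"] span_minimal[OF sub subspace_span] by blast
  then show ?thesis using injb indb W by (simp add: is_basis_family_def)
qed

lemma is_basis_family_mem: "is_basis_family b J W \<Longrightarrow> j \<in> J \<Longrightarrow> b j \<in> W"
  by (auto simp: is_basis_family_def intro: span_base)

lemma is_basis_family_dim:
  assumes "is_basis_family b I W"
  shows "dim W = card I"
  using assms dim_span_eq_card_independent[of "b ` I"] card_image[of b I]
  by (auto simp: is_basis_family_def simp del: dim_span)

lemma is_basis_family_obtain:
  assumes "is_basis_family b I W" "finite I" "w \<in> W"
  obtains c where "w = (\<Sum>i\<in>I. c i *\<^sub>R b i)"
  using assms span_family[of I b] by (auto simp: is_basis_family_def)

lemma fun_sum_apply: "(\<Sum>i\<in>I. f i :: 'a \<Rightarrow> real) x = (\<Sum>i\<in>I. f i x)"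
  by (induction I rule: infinite_finite_induct) auto

lemma fun_sum_scaleR_apply: "(\<Sum>i\<in>I. c i *\<^sub>R (f i :: 'a \<Rightarrow> real)) x = (\<Sum>i\<in>I. c i * f i x)"
  by (induction I rule: infinite_finite_induct) (auto simp: scaleR_fun_def)

subsection \<open>B-splines and the Marsden identity\<close>

declare bspline.simps [simp del]

text \<open>The strict inequality between the outer knots shows that wherever a denominator of the
  recursion vanishes, so does the B-spline that the quotient multiplies. The alternative with
  \<open>last t\<close> comes from closing the last nonempty knot interval in degree 0.\<close>

lemma bspline_support:
  assumes "sorted t" "i + q + 1 < length t" "bspline t q i x \<noteq> 0"
  shows "t ! i \<le> x \<and> t ! i < t ! (i + q + 1) \<and>
    (x < t ! (i + q + 1) \<or> x = last t \<and> t ! (i + q + 1) = last t)"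
  using assms(2,3)
proof (induction q arbitrary: i)
  case 0
  then show ?case by (auto simp: bspline.simps split: if_splits)
next
  case (Suc q)
  have mono: "t ! a \<le> t ! b" if "a \<le> b" "b < length t" for a b
    using sorted_nth_mono[OF assms(1)] that by blast
  have lst: "t ! a \<le> last t" if "a < length t" for a
    using mono[of a "length t - 1"] that last_conv_nth[of t] by (cases "t = []") auto
  from Suc.prems have "bspline t q i x \<noteq> 0 \<or> bspline t q (i + 1) x \<noteq> 0"
    by (auto simp: bspline.simps)
  then show ?case
  proof
    assume "bspline t q i x \<noteq> 0"
    from Suc.IH[OF _ this] Suc.prems mono[of "i + q + 1" "i + Suc q + 1"] lst[of "i + Suc q + 1"]
    show ?thesis by auto
  next
    assume "bspline t q (i + 1) x \<noteq> 0"
    from Suc.IH[OF _ this] Suc.prems mono[of i "i + 1"]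
    show ?thesis by auto
  qed
qed

text \<open>The dual polynomials of the B-splines in the Marsden identity. They are formal
  polynomials in the second variable of that identity, so that Taylor coefficients can be
  compared.\<close>

definition marsden :: "real list \<Rightarrow> nat \<Rightarrow> nat \<Rightarrow> real poly" where
  "marsden t q i = (\<Prod>j<q. [:- t ! (i + 1 + j), 1:])"

text \<open>Splitting off the last knot, and in the next lemma the first one, exhibits
  \<open>marsden t q i\<close> as a common factor of the polynomials of degree \<open>q + 1\<close>
  with indices \<open>i\<close> and \<open>i - 1\<close>.\<close>

lemma marsden_Suc: "marsden t (Suc q) i = marsden t q i * [:- t ! (i + q + 1), 1:]"
  by (simp add: marsden_def ac_simps)

lemma marsden_Suc': "marsden t (Suc q) i = [:- t ! (i + 1), 1:] * marsden t q (i + 1)"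
  unfolding marsden_def by (subst prod.lessThan_Suc_shift) (simp add: ac_simps)

lemma bspline_0_partition:
  assumes "sorted t" "t \<noteq> []" "t ! 0 < last t" "t ! 0 \<le> x" "x \<le> last t"
  shows "(\<Sum>i<length t - 1. bspline t 0 i x) = 1"
proof -
  have mono: "t ! a \<le> t ! b" if "a \<le> b" "b < length t" for a b
    using sorted_nth_mono[OF assms(1)] that by blast
  have lst: "last t = t ! (length t - 1)" using assms(2) by (simp add: last_conv_nth)
  have lstle: "t ! a \<le> last t" if "a < length t" for a
    using mono[of a "length t - 1"] that lst by auto
  let ?P = "\<lambda>i. t ! i \<le> x \<and> x < t ! (i + 1) \<or> t ! i < t ! (i + 1) \<and> t ! (i + 1) = last t \<and> x = last t"
  have uniq: "i = j" if "?P i" "?P j" "i + 1 < length t" "j + 1 < length t" for i j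
  proof (rule ccontr)
    assume "i \<noteq> j"
    have *: False if "?P i" "?P j" "i + 1 < length t" "j + 1 < length t" "i < j" for i j
      using that mono[of "i + 1" j] lstle[of "j + 1"] lstle[of j] by auto
    from \<open>i \<noteq> j\<close> *[of i j] *[of j i] that show False by (meson linorder_neqE_nat)
  qed
  have "\<exists>i<length t - 1. ?P i"
  proof (cases "x = last t")
    case True
    \<comment> \<open>At the right end point the interval that counts is the last nonempty one; it
      ends at the first occurrence of the last knot.\<close>
    define n where "n = (LEAST n. t ! n = last t)"
    have n: "t ! n = last t" unfolding n_def by (rule LeastI[of _ "length t - 1"]) (simp add: lst)
    have nle: "n \<le> length t - 1" unfolding n_def by (rule Least_le) (simp add: lst)
    from n assms(3) have "n \<noteq> 0" by (metis less_irrefl)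
    then have "t ! (n - 1) \<noteq> last t"
      using not_less_Least[of "n - 1" "\<lambda>n. t ! n = last t"] by (simp add: n_def[symmetric])
    moreover have "t ! (n - 1) \<le> last t" using mono[of "n - 1" "length t - 1"] nle lst assms(2) by simp
    ultimately show ?thesis using n \<open>n \<noteq> 0\<close> nle True by (intro exI[of _ "n - 1"]) auto
  next
    case False
    define n where "n = (LEAST n. x < t ! n)"
    have ex: "x < t ! (length t - 1)" using False assms(5) lst by simp
    have n: "x < t ! n" unfolding n_def by (rule LeastI[of "\<lambda>n. x < t ! n", OF ex])
    have nle: "n \<le> length t - 1" unfolding n_def by (rule Least_le[of "\<lambda>n. x < t ! n", OF ex])
    from n assms(4) have "n \<noteq> 0" by (metis not_less)
    then have "\<not> x < t ! (n - 1)"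
      using not_less_Least[of "n - 1" "\<lambda>n. x < t ! n"] by (simp add: n_def[symmetric])
    then show ?thesis using n \<open>n \<noteq> 0\<close> nle by (intro exI[of _ "n - 1"]) auto
  qed
  then obtain i where i: "i < length t - 1" "?P i" by blast
  have "(\<Sum>i<length t - 1. bspline t 0 i x) = (\<Sum>j<length t - 1. if j = i then 1 else 0)"
  proof (rule sum.cong[OF refl])
    fix j assume "j \<in> {..<length t - 1}"
    then have "i + 1 < length t" "j + 1 < length t" using i by auto
    then have "?P j \<longleftrightarrow> j = i" using i(2) uniq by blast
    then show "bspline t 0 j x = (if j = i then 1 else 0)" by (simp only: bspline.simps)
  qed
  also have "\<dots> = 1" using i by simp
  finally show ?thesis .
qed

text \<open>The recursion rewrites the sum for degree \<open>q + 1\<close> over the B-splines of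
  degree \<open>q\<close>. Each of them is then multiplied by \<open>marsden t q i\<close> and by an
  affine combination of two linear factors, which equals the linear factor with root
  \<open>x\<close>. The end knots have multiplicity at least \<open>d + 1\<close>, so one knot
  vector serves all degrees \<open>q <= d\<close> and the induction never leaves the interval from
  \<open>a\<close> to \<open>b\<close>.\<close>

theorem marsden_identity:
  assumes "sorted t" "\<And>i. i \<le> d \<Longrightarrow> t ! i = a" "\<And>i. i \<le> d \<Longrightarrow> t ! (length t - 1 - i) = b"
    and "a < b" "2 * d + 2 \<le> length t" "a \<le> x" "x \<le> b" "q \<le> d"
  shows "(\<Sum>i<length t - q - 1. smult (bspline t q i x) (marsden t q i)) = [:- x, 1:] ^ q"
  using \<open>q \<le> d\<close>
proof (induction q)
  case 0
  have ne: "t \<noteq> []" using assms(5) by auto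
  then have "last t = b" using assms(3)[of 0] by (simp add: last_conv_nth)
  then have "(\<Sum>i<length t - 1. bspline t 0 i x) = 1"
    using bspline_0_partition[OF assms(1) ne] assms by auto
  then have "(\<Sum>i<length t - 1. [:bspline t 0 i x:]) = 1"
    unfolding sum_to_poly by (simp add: one_pCons)
  then show ?case by (simp add: marsden_def one_pCons)
next
  case (Suc q)
  define K where "K = length t - q - 2"
  have K: "length t - q - 1 = Suc K" "length t - Suc q - 1 = K" "K + q + 2 = length t" "K > 0"
    using Suc.prems assms(5) by (auto simp: K_def)
  define w where "w i = (x - t ! i) / (t ! (i + q + 1) - t ! i)" for i
  define w' where "w' i = (t ! (i + q + 1) - x) / (t ! (i + q + 1) - t ! i)" for i
  let ?B = "\<lambda>i. bspline t q i x"
  \<comment> \<open>There is one more B-spline of degree \<open>q\<close> than of degree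
    \<open>q + 1\<close>. The first and the last one of degree \<open>q\<close> live on a single
    repeated end knot and vanish, which allows both sums to be extended to \<open>Suc K\<close>
    terms.\<close>
  have B0: "?B 0 = 0"
  proof (rule ccontr)
    assume "?B 0 \<noteq> 0"
    from bspline_support[OF assms(1) _ this] K assms(2)[of 0] assms(2)[of "q + 1"] Suc.prems show False by simp
  qed
  have BK: "?B K = 0"
  proof (rule ccontr)
    assume "?B K \<noteq> 0"
    moreover have e: "length t - 1 - (q + 1) = K" "length t - 1 - 0 = K + q + 1" using K by auto
    have "t ! K = b" "t ! (K + q + 1) = b"
      using assms(3)[of "q + 1", unfolded e] assms(3)[of 0, unfolded e] Suc.prems by auto
    ultimately show False using bspline_support[OF assms(1), of K q x] K by simp
  qed
  have "(\<Sum>i<K. smult (bspline t (Suc q) i x) (marsden t (Suc q) i)) =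
     (\<Sum>i<K. smult (w i * ?B i) (marsden t (Suc q) i)) +
     (\<Sum>i<K. smult (w' (Suc i) * ?B (Suc i)) (marsden t (Suc q) i))"
    by (simp add: sum.distrib[symmetric] smult_add_left[symmetric] bspline.simps w_def w'_def ac_simps)
  also have "(\<Sum>i<K. smult (w i * ?B i) (marsden t (Suc q) i)) =
      (\<Sum>i<Suc K. smult (w i * ?B i) (marsden t (Suc q) i))"
    by (simp add: BK)
  \<comment> \<open>After the shift, \<open>i - 1\<close> is truncated at \<open>i = 0\<close>; that
    term is zero by \<open>B0\<close>.\<close>
  also have "(\<Sum>i<K. smult (w' (Suc i) * ?B (Suc i)) (marsden t (Suc q) i)) =
      (\<Sum>i<Suc K. smult (w' i * ?B i) (marsden t (Suc q) (i - 1)))"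
    by (subst sum.lessThan_Suc_shift) (simp add: B0)
  also have "(\<Sum>i<Suc K. smult (w i * ?B i) (marsden t (Suc q) i)) +
      (\<Sum>i<Suc K. smult (w' i * ?B i) (marsden t (Suc q) (i - 1))) =
      (\<Sum>i<Suc K. smult (?B i) (marsden t q i) * [:- x, 1:])"
    unfolding sum.distrib[symmetric]
  proof (rule sum.cong[OF refl])
    fix i assume "i \<in> {..<Suc K}"
    then have i: "i + q + 1 < length t" using K by auto
    show "smult (w i * ?B i) (marsden t (Suc q) i) + smult (w' i * ?B i) (marsden t (Suc q) (i - 1))
        = smult (?B i) (marsden t q i) * [:- x, 1:]"
    proof (cases "?B i = 0")
      case False
      then have i0: "i \<noteq> 0" using B0 by metis
      have lt: "t ! i < t ! (i + q + 1)" using bspline_support[OF assms(1) i False] by simp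
      have m1: "marsden t (Suc q) (i - 1) = marsden t q i * [:- t ! i, 1:]"
        using i0 marsden_Suc'[of t q "i - 1"] by (simp add: ac_simps)
      \<comment> \<open>The weights \<open>w i\<close> and \<open>w' i\<close> are the barycentric
        coordinates of \<open>x\<close> with respect to the outer knots, so they reproduce both 1
        and \<open>x\<close>.\<close>
      have s: "w i + w' i = 1" using lt
        by (simp add: w_def w'_def add_divide_distrib[symmetric])
      have "w i * (t ! (i + q + 1)) + w' i * (t ! i) = x * ((t ! (i + q + 1) - t ! i) / (t ! (i + q + 1) - t ! i))"
        unfolding w_def w'_def times_divide_eq_left times_divide_eq_right add_divide_distrib[symmetric]
        by (simp add: algebra_simps)
      then have s2: "w i * (t ! (i + q + 1)) + w' i * (t ! i) = x" using lt by simp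
      have "smult (w i) [:- t ! (i + q + 1), 1:] + smult (w' i) [:- t ! i, 1:] = [:- x, 1:]"
        using s s2 by simp
      moreover have "smult (c * B) (M * P) + smult (c' * B) (M * P') = smult B M * (smult c P + smult c' P')"
        for c c' B :: real and M P P'
        by (simp add: distrib_left mult.commute)
      ultimately show ?thesis unfolding m1 unfolding marsden_Suc by metis
    qed simp
  qed
  also have "\<dots> = [:- x, 1:] ^ q * [:- x, 1:]"
    using Suc.IH Suc.prems unfolding sum_distrib_right[symmetric] K(1) by simp
  finally show ?case unfolding K(2) by (simp only: power_Suc2)
qed

subsection \<open>Truncated powers\<close>

text \<open>The cut at 1 matches the B-splines, which vanish outside [0, 1]: spans are compared as
  sets of functions on the whole line. The point \<open>c\<close> belongs to the support, so
  \<open>tpow 0 0\<close> is the indicator function of [0, 1].\<close>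

definition tpow :: "nat \<Rightarrow> real \<Rightarrow> real \<Rightarrow> real" where
  "tpow j c x = (if c \<le> x \<and> x \<le> 1 then (x - c) ^ j else 0)"

text \<open>Composition with \<open>[:c, 1:]\<close> turns coefficients into Taylor coefficients at
  \<open>c\<close>; this is the right-hand side of the Marsden identity expanded there.\<close>

lemma coeff_shifted_linear_power:
  "e \<le> d \<Longrightarrow> coeff (pcompose ([:- x, 1:] ^ d) [:c, 1:]) e = of_nat (d choose e) * (c - x) ^ (d - e)"
  for x c :: real
proof -
  have "pcompose [:- x, 1:] [:c, 1:] = [:c - x, 1:]" by (simp add: pcompose_pCons)
  then have "pcompose ([:- x, 1:] ^ d) [:c, 1:] = [:c - x, 1:] ^ d"
    by (induction d) (simp_all add: pcompose_mult pcompose_1 del: mult_pCons_left mult_pCons_right)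
  then show "coeff (pcompose ([:- x, 1:] ^ d) [:c, 1:]) e = of_nat (d choose e) * (c - x) ^ (d - e)"
    if "e \<le> d" using that by (simp add: coeff_linear_poly_power)
qed

lemma pcompose_marsden:
  "pcompose (marsden t d i) [:c, 1:] = (\<Prod>j<d. [:c - t ! (i + 1 + j), 1:])"
  by (simp add: marsden_def pcompose_prod pcompose_pCons)

text \<open>The index conditions place all \<open>\<mu>\<close> copies of \<open>c\<close> among the
  knots \<open>i + 1\<close> to \<open>i + d\<close>, so the dual polynomial has a zero of order at
  least \<open>\<mu>\<close> at \<open>c\<close>.\<close>

lemma coeff_marsden_eq_0:
  assumes "\<And>j. s \<le> j \<Longrightarrow> j < s + \<mu> \<Longrightarrow> t ! j = c" "i < s" "s + \<mu> \<le> i + d + 1" "e < \<mu>"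
  shows "coeff (pcompose (marsden t d i) [:c, 1:]) e = 0"
proof -
  let ?f = "\<lambda>j. [:c - t ! (i + 1 + j), 1:]"
  let ?J = "{s - i - 1..<s - i - 1 + \<mu>}"
  have J: "?J \<subseteq> {..<d}" using assms(2,3) by auto
  have "(\<Prod>j\<in>?J. ?f j) = (\<Prod>j\<in>?J. [:0, 1:])"
    using assms(1,2) by (intro prod.cong) auto
  also have "\<dots> = monom 1 \<mu>" by (simp add: monom_altdef)
  finally have "pcompose (marsden t d i) [:c, 1:] = monom 1 \<mu> * (\<Prod>j\<in>{..<d} - ?J. ?f j)"
    unfolding pcompose_marsden using prod.subset_diff[OF J, of ?f] by (simp add: mult.commute)
  then show ?thesis using assms(4) by (simp add: coeff_monom_mult)
qed

text \<open>Taylor coefficients of the Marsden identity at a knot \<open>c\<close> of multiplicity \<open>\<mu>\<close>: of order less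
  than \<open>\<mu>\<close>, they involve no B-spline whose support contains \<open>c\<close> in its interior, so
  cutting the sum at \<open>c\<close> truncates the power.\<close>

lemma tpow_bspline_sum:
  assumes t: "sorted t" "\<And>i. i \<le> d \<Longrightarrow> t ! i = 0" "\<And>i. i \<le> d \<Longrightarrow> t ! (length t - 1 - i) = 1"
      "2 * d + 2 \<le> length t"
    and c: "\<And>j. s \<le> j \<Longrightarrow> j < s + \<mu> \<Longrightarrow> t ! j = c" "s + \<mu> \<le> length t" "0 \<le> c" "c < 1"
    and e: "e < \<mu>" "e \<le> d"
  shows "real (d choose e) * (-1) ^ (d - e) * tpow (d - e) c x =
    (\<Sum>i<length t - d - 1. (if s \<le> i then coeff (pcompose (marsden t d i) [:c, 1:]) e else 0) * bspline t d i x)"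
    (is "?l = (\<Sum>i<?n. ?a i * _)")
proof -
  have mono: "t ! a \<le> t ! b" if "a \<le> b" "b < length t" for a b
    using sorted_nth_mono[OF t(1)] that by blast
  have last: "last t = 1" using t(3)[of 0] t(4) last_conv_nth[of t] by (cases "t = []") auto
  have first: "t ! 0 = 0" using t(2)[of 0] by simp
  have supp: "t ! i \<le> x \<and> (x < t ! (i + d + 1) \<or> x = 1 \<and> t ! (i + d + 1) = 1)"
    if "bspline t d i x \<noteq> 0" "i < ?n" for i
    using bspline_support[OF t(1), of i d x] that last by auto
  consider "x < c" | "1 < x" | "c \<le> x" "x \<le> 1" by linarith
  then show ?thesis
  proof cases
    case 1
    \<comment> \<open>The indices \<open>i >= s\<close> that survive the cut belong to B-splines
      whose supports start at \<open>c\<close> or later.\<close>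
    have "?a i * bspline t d i x = 0" if "i < ?n" for i
      using supp[OF _ that] mono[of s i] c(1)[of s] e that 1 by force
    then have "(\<Sum>i<?n. ?a i * bspline t d i x) = 0" by (intro sum.neutral) auto
    then show ?thesis using 1 by (simp add: tpow_def)
  next
    case 2
    have "bspline t d i x = 0" if "i < ?n" for i
    proof (rule ccontr)
      assume "bspline t d i x \<noteq> 0"
      moreover have "t ! (i + d + 1) \<le> t ! (length t - 1)" by (rule mono) (use that in auto)
      moreover have "t ! (length t - 1) = 1" using t(3)[of 0] by simp
      ultimately show False using supp[OF _ that] 2 by simp
    qed
    then have "(\<Sum>i<?n. ?a i * bspline t d i x) = 0" by (intro sum.neutral) auto
    then show ?thesis using 2 by (simp add: tpow_def)
  next
    case 3
    let ?g = "\<lambda>i. coeff (pcompose (marsden t d i) [:c, 1:]) e"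
    have "(\<Sum>i<?n. smult (bspline t d i x) (marsden t d i)) = [:- x, 1:] ^ d"
      using marsden_identity[OF t(1-3) _ t(4), of x d] 3 c by simp
    then have "coeff (pcompose (\<Sum>i<?n. smult (bspline t d i x) (marsden t d i)) [:c, 1:]) e
        = real (d choose e) * (c - x) ^ (d - e)"
      using e(2) by (simp add: coeff_shifted_linear_power)
    moreover have "(c - x) ^ (d - e) = (-1) ^ (d - e) * (x - c) ^ (d - e)"
      by (metis minus_diff_eq power_minus)
    ultimately have "?l = coeff (pcompose (\<Sum>i<?n. smult (bspline t d i x) (marsden t d i)) [:c, 1:]) e"
      using 3 by (simp add: tpow_def)
    also have "\<dots> = (\<Sum>i<?n. ?g i * bspline t d i x)"
      by (simp add: pcompose_sum coeff_sum pcompose_smult mult.commute)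
    also have "\<dots> = (\<Sum>i<?n. ?a i * bspline t d i x)"
    proof (rule sum.cong[OF refl])
      fix i assume "i \<in> {..<?n}"
      then have i: "i < ?n" by simp
      show "?g i * bspline t d i x = ?a i * bspline t d i x"
      \<comment> \<open>For \<open>i >= s\<close> nothing was cut. For \<open>i < s\<close> either
        all copies of \<open>c\<close> are inner knots of the B-spline and the Taylor coefficient is
        zero, or its support ends at or before \<open>c\<close> and the B-spline is zero at
        \<open>x\<close>; \<open>c < 1\<close> excludes the closed right end.\<close>
      proof (cases "s \<le> i \<or> s + \<mu> \<le> i + d + 1")
        case True
        then show ?thesis using coeff_marsden_eq_0[of s \<mu> t c i d e] c(1) e by auto
      next
        case False
        then have "t ! (i + d + 1) \<le> c" using mono[of "i + d + 1" "s + \<mu> - 1"] c(1)[of "s + \<mu> - 1"] c(2) e by auto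
        then show ?thesis using supp[OF _ i] 3 c(4) by force
      qed
    qed
    finally show ?thesis .
  qed
qed

lemma polynomial_zero_on_interval:
  fixes c :: "nat \<Rightarrow> real"
  assumes "0 < \<delta>" "\<And>y. 0 < y \<Longrightarrow> y < \<delta> \<Longrightarrow> (\<Sum>j\<le>d. c j * y ^ j) = 0" "j \<le> d"
  shows "c j = 0"
proof (rule ccontr)
  assume "c j \<noteq> 0"
  then have "finite {y. (\<Sum>j\<le>d. c j * y ^ j) = 0}" using polyfun_finite_roots[of c d] assms(3) by blast
  moreover have "{0<..<\<delta>} \<subseteq> {y. (\<Sum>j\<le>d. c j * y ^ j) = 0}" using assms(2) by auto
  ultimately have "finite {0<..<\<delta>}" by (rule rev_finite_subset)
  then show False using assms(1) infinite_Ioo by blast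
qed

subsection \<open>The spline spaces as spans of truncated powers\<close>

lemma nth_concat_replicate:
  "j < length xs * m \<Longrightarrow> concat (map (\<lambda>x. replicate m (f x)) xs) ! j = f (xs ! (j div m))"
proof (induction xs arbitrary: j)
  case (Cons a xs)
  show ?case
  proof (cases "j < m")
    case False
    then have "j - m < length xs * m" using Cons.prems by auto
    moreover have "m > 0" using Cons.prems by (cases m) auto
    then have "j div m = Suc ((j - m) div m)" using False by (simp add: le_div_geq)
    ultimately show ?thesis using Cons.IH[of "j - m"] False by (simp add: nth_append)
  qed (simp add: nth_append)
qed simp

locale breakpoints =
  fixes k :: nat and \<tau> :: "nat \<Rightarrow> real"
  assumes tau_bounds: "\<forall>i\<in>{1..k}. 0 < \<tau> i \<and> \<tau> i < 1"
    and tau_mono: "strict_mono_on {1..k} \<tau>"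
begin

lemma tau_less: "1 \<le> i \<Longrightarrow> i < j \<Longrightarrow> j \<le> k \<Longrightarrow> \<tau> i < \<tau> j"
  using tau_mono by (auto simp: strict_mono_on_def)

lemma tau_le: "1 \<le> i \<Longrightarrow> i \<le> j \<Longrightarrow> j \<le> k \<Longrightarrow> \<tau> i \<le> \<tau> j"
  using tau_less[of i j] by (cases "i = j") auto

section \<open>The entries of the knot vector\<close>

lemma length_concat_inner:
  "length (concat (map (\<lambda>i. replicate m (\<tau> i)) [1..<k + 1])) = k * m"
  by (simp add: length_concat comp_def sum_list_triv)

lemma length_knots: "length (knots k \<tau> d r) = 2 * d + 2 + k * (d - r)"
  unfolding knots_def length_append length_concat_inner by simp

lemma knots_nth_left: "j \<le> d \<Longrightarrow> knots k \<tau> d r ! j = 0"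
  by (simp add: knots_def nth_append del: replicate_Suc)

lemma knots_nth_inner:
  assumes "d + 1 \<le> j" "j < d + 1 + k * (d - r)"
  shows "knots k \<tau> d r ! j = \<tau> ((j - d - 1) div (d - r) + 1)"
proof -
  let ?c = "concat (map (\<lambda>i. replicate (d - r) (\<tau> i)) [1..<k + 1])"
  let ?j = "j - (d + 1)"
  have j: "?j < k * (d - r)" using assms by auto
  have "knots k \<tau> d r ! j = ?c ! ?j"
    unfolding knots_def nth_append length_replicate length_concat_inner using assms j by simp
  also have "\<dots> = \<tau> ([1..<k + 1] ! (?j div (d - r)))"
    by (rule nth_concat_replicate) (use j in \<open>simp del: upt_Suc\<close>)
  also have "[1..<k + 1] ! (?j div (d - r)) = ?j div (d - r) + 1"
    using nth_upt[of 1 "?j div (d - r)" "k + 1"] less_mult_imp_div_less[OF j] by (simp del: upt_Suc)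
  finally show ?thesis by simp
qed

lemma knots_nth_right:
  assumes "d + 1 + k * (d - r) \<le> j" "j < 2 * d + 2 + k * (d - r)"
  shows "knots k \<tau> d r ! j = 1"
proof -
  have "j - (d + 1) - k * (d - r) < d + 1" using assms by linarith
  then show ?thesis
    unfolding knots_def nth_append length_replicate length_concat_inner using assms
    by (simp del: replicate_Suc)
qed

lemma sorted_knots: "sorted (knots k \<tau> d r)"
proof (rule sorted_iff_nth_mono_less[THEN iffD2], intro allI impI)
  fix i j assume ij: "i < j" "j < length (knots k \<tau> d r)"
  have inner: "(l - d - 1) div (d - r) + 1 \<in> {1..k}" if "l < d + 1 + k * (d - r)" "d + 1 \<le> l" for l
  proof -
    have "l - d - 1 < k * (d - r)" using that by auto
    then show ?thesis using less_mult_imp_div_less[of "l - d - 1" k "d - r"] by auto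
  qed
  have mono: "(i - d - 1) div (d - r) + 1 \<le> (j - d - 1) div (d - r) + 1"
    using ij by (auto intro!: div_le_mono)
  consider "i \<le> d" "j \<le> d" | "i \<le> d" "d + 1 \<le> j" "j < d + 1 + k * (d - r)"
    | "i \<le> d" "d + 1 + k * (d - r) \<le> j" | "d + 1 \<le> i" "j < d + 1 + k * (d - r)"
    | "d + 1 \<le> i" "i < d + 1 + k * (d - r)" "d + 1 + k * (d - r) \<le> j"
    | "d + 1 + k * (d - r) \<le> i" "d + 1 + k * (d - r) \<le> j"
    using ij by linarith
  then show "knots k \<tau> d r ! i \<le> knots k \<tau> d r ! j"
  proof cases
    case 2
    then show ?thesis using inner[of j] tau_bounds
      by (fastforce simp: knots_nth_left knots_nth_inner intro: less_imp_le)
  next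
    case 4
    then show ?thesis using ij inner[of j] inner[of i] mono tau_le
      by (auto simp: knots_nth_inner)
  next
    case 5
    then show ?thesis using ij inner[of i] tau_bounds
      by (fastforce simp: knots_nth_right knots_nth_inner length_knots intro: less_imp_le)
  qed (use ij in \<open>auto simp: knots_nth_left knots_nth_right length_knots\<close>)
qed

text \<open>The left end point counts as breakpoint 0: the truncated powers based there are the
  monomials on [0, 1], so polynomials require no separate treatment.\<close>

definition brk :: "nat \<Rightarrow> real" where
  "brk i = (if i = 0 then 0 else \<tau> i)"

lemma brk_bounds: "i \<le> k \<Longrightarrow> 0 \<le> brk i" "i \<le> k \<Longrightarrow> brk i < 1"
  using tau_bounds by (auto simp: brk_def intro: less_imp_le)

lemma brk_less: "i < j \<Longrightarrow> j \<le> k \<Longrightarrow> brk i < brk j"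
  using tau_bounds tau_less[of i j] by (auto simp: brk_def)

text \<open>At an inner breakpoint a truncated power is of class C^r exactly when its exponent
  exceeds \<open>r\<close>. The \<open>d - r\<close> exponents left up to \<open>d\<close> are as
  many as the copies of that knot.\<close>

definition tpow_index :: "nat \<Rightarrow> nat \<Rightarrow> (nat \<times> nat) set" where
  "tpow_index d r = Sigma {..k} (\<lambda>i. if i = 0 then {..d} else {r<..d})"

definition tpow_family :: "nat \<times> nat \<Rightarrow> real \<Rightarrow> real" where
  "tpow_family = (\<lambda>(i, j). tpow j (brk i))"

definition spl :: "nat \<Rightarrow> nat \<Rightarrow> (real \<Rightarrow> real) set" where
  "spl d r = span (tpow_family ` tpow_index d r)"

lemma finite_tpow_index: "finite (tpow_index d r)"
  by (auto simp: tpow_index_def)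

lemma card_tpow_index: "card (tpow_index d r) = d + 1 + k * (d - r)"
proof -
  have "card (tpow_index d r) = (\<Sum>i\<in>{..k}. card (if i = 0 then {..d} else {r<..d}))"
    unfolding tpow_index_def by (subst card_SigmaI) auto
  also have "{..k} = insert 0 {1..k}" by auto
  also have "(\<Sum>i\<in>insert 0 {1..k}. card (if i = 0 then {..d} else {r<..d})) = d + 1 + (\<Sum>i\<in>{1..k}. d - r)"
    by (subst sum.insert) auto
  finally show ?thesis by simp
qed

text \<open>Independence is obtained from left to right. Just to the right of a breakpoint the later
  truncated powers are zero and the earlier ones have zero coefficients by induction, which leaves a
  polynomial that vanishes on an interval.\<close>

lemma tpow_family_basis: "is_basis_family tpow_family (tpow_index d r) (spl d r)"
proof (rule is_basis_familyI[OF finite_tpow_index])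
  show "spl d r = range (\<lambda>c. \<Sum>i\<in>tpow_index d r. c i *\<^sub>R tpow_family i)"
    unfolding spl_def by (rule span_family[OF finite_tpow_index])
  fix c :: "nat \<times> nat \<Rightarrow> real" and ij
  assume c: "(\<Sum>ij\<in>tpow_index d r. c ij *\<^sub>R tpow_family ij) = 0" and ij: "ij \<in> tpow_index d r"
  define c' where "c' i j = (if (i, j) \<in> tpow_index d r then c (i, j) else 0)" for i j
  have sum0: "(\<Sum>i\<le>k. \<Sum>j\<le>d. c' i j * tpow j (brk i) x) = 0" for x
  proof -
    have "0 = (\<Sum>ij\<in>tpow_index d r. c ij *\<^sub>R tpow_family ij) x" by (simp add: c)
    also have "\<dots> = (\<Sum>(i, j)\<in>tpow_index d r. c' i j * tpow j (brk i) x)"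
      unfolding fun_sum_scaleR_apply by (rule sum.cong) (auto simp: c'_def tpow_family_def)
    also have "\<dots> = (\<Sum>(i, j)\<in>{..k} \<times> {..d}. c' i j * tpow j (brk i) x)"
      by (rule sum.mono_neutral_left) (auto simp: tpow_index_def c'_def split: if_splits)
    finally show ?thesis by (simp add: sum.cartesian_product)
  qed
  have "\<forall>j\<le>d. c' i j = 0" if "i \<le> k" for i
    using that
  proof (induction i rule: less_induct)
    case (less i)
    \<comment> \<open>The distance from \<open>brk i\<close> to the next breakpoint, or to 1 after
      the last one.\<close>
    define \<delta> where "\<delta> = (if i = k then 1 else brk (Suc i)) - brk i"
    have "\<delta> > 0" using less.prems brk_less[of i "Suc i"] brk_bounds[of i] by (auto simp: \<delta>_def)
    have le1: "brk i + \<delta> \<le> 1" using less.prems brk_bounds[of "Suc i"] by (auto simp: \<delta>_def)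
    have ge: "brk i + \<delta> \<le> brk l" if "i < l" "l \<le> k" for l
      using that brk_less[of "Suc i" l] by (cases "l = Suc i") (auto simp: \<delta>_def)
    have "(\<Sum>j\<le>d. c' i j * y ^ j) = 0" if y: "0 < y" "y < \<delta>" for y
    proof -
      have "0 = (\<Sum>l\<le>k. \<Sum>j\<le>d. c' l j * tpow j (brk l) (brk i + y))" by (simp add: sum0)
      also have "\<dots> = (\<Sum>l\<in>{i}. \<Sum>j\<le>d. c' l j * tpow j (brk l) (brk i + y))"
      proof (rule sum.mono_neutral_right)
        show "\<forall>l\<in>{..k} - {i}. (\<Sum>j\<le>d. c' l j * tpow j (brk l) (brk i + y)) = 0"
        proof
          fix l assume l: "l \<in> {..k} - {i}"
          show "(\<Sum>j\<le>d. c' l j * tpow j (brk l) (brk i + y)) = 0"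
          proof (cases "l < i")
            case True
            then show ?thesis using less.IH[of l] l by simp
          next
            case False
            then have "brk i + y < brk l" using ge[of l] l y by auto
            then show ?thesis by (simp add: tpow_def)
          qed
        qed
      qed (use less.prems in auto)
      also have "\<dots> = (\<Sum>j\<le>d. c' i j * y ^ j)" using y le1 by (simp add: tpow_def)
      finally show ?thesis by simp
    qed
    then show ?case using polynomial_zero_on_interval[OF \<open>\<delta> > 0\<close>, of "c' i" d] by blast
  qed
  then show "c ij = 0" using ij by (cases ij) (force simp: tpow_index_def c'_def split: if_splits)
qed

lemma tpow_in_spline_space:
  assumes "r \<le> d" "(i, j) \<in> tpow_index d r"
  shows "tpow j (brk i) \<in> spline_space k \<tau> d r"
proof -
  let ?t = "knots k \<tau> d r"
  have i: "i \<le> k" "j \<le> d" "i \<noteq> 0 \<Longrightarrow> r < j" using assms(2) by (auto simp: tpow_index_def split: if_splits)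
  \<comment> \<open>\<open>s\<close> is the position of the first copy of \<open>brk i\<close> in
    the knot vector and \<open>\<mu>\<close> is its multiplicity; at 0 this is the multiplicity
    \<open>d + 1\<close> of an end knot.\<close>
  define s where "s = (if i = 0 then 0 else d + 1 + (i - 1) * (d - r))"
  define \<mu> where "\<mu> = (if i = 0 then d + 1 else d - r)"
  have km: "d + 1 + (i - 1) * (d - r) + (d - r) \<le> d + 1 + k * (d - r)" if "i \<noteq> 0"
  proof -
    have "(i - 1) * (d - r) + (d - r) = i * (d - r)" using that by (cases i) auto
    also have "\<dots> \<le> k * (d - r)" using i by simp
    finally show ?thesis by simp
  qed
  have c: "?t ! l = brk i" if "s \<le> l" "l < s + \<mu>" for l
  proof (cases "i = 0")
    case True
    then show ?thesis using that by (simp add: s_def \<mu>_def brk_def knots_nth_left)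
  next
    case False
    then have l: "d + 1 \<le> l" "(i - 1) * (d - r) \<le> l - d - 1" "l - d - 1 < (i - 1) * (d - r) + (d - r)"
        "l < d + 1 + k * (d - r)"
    proof -
      have "d + 1 + (i - 1) * (d - r) \<le> l" "l < d + 1 + (i - 1) * (d - r) + (d - r)"
        using that False by (simp_all add: s_def \<mu>_def)
      then show "d + 1 \<le> l" "(i - 1) * (d - r) \<le> l - d - 1" "l - d - 1 < (i - 1) * (d - r) + (d - r)"
          "l < d + 1 + k * (d - r)"
        using km[OF False] by linarith+
    qed
    have "(l - d - 1) div (d - r) = i - 1"
      by (rule div_nat_eqI) (use l in \<open>auto simp: algebra_simps\<close>)
    then show ?thesis using knots_nth_inner[OF l(1,4)] False by (simp add: brk_def)
  qed
  have s: "s + \<mu> \<le> length ?t" using km by (auto simp: s_def \<mu>_def length_knots)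
  have right: "?t ! (length ?t - 1 - l) = 1" if "l \<le> d" for l
    using that by (intro knots_nth_right) (auto simp: length_knots)
  \<comment> \<open>The Taylor coefficient of order \<open>d - j\<close> carries the power
    \<open>j\<close>. At an inner breakpoint \<open>r < j\<close> says precisely that this order is
    below the multiplicity \<open>d - r\<close>.\<close>
  have e: "d - j < \<mu>" "d - j \<le> d" "d - (d - j) = j" using i by (auto simp: \<mu>_def)
  have n: "length ?t - d - 1 = Suc (d + k * (d - r))" by (simp add: length_knots)
  obtain a where a: "real (d choose (d - j)) * (-1) ^ j * tpow j (brk i) x =
      (\<Sum>i<length ?t - d - 1. a i * bspline ?t d i x)" for x
  proof -
    have len: "2 * d + 2 \<le> length ?t" by (simp add: length_knots)
    show thesis
      using tpow_bspline_sum[OF sorted_knots knots_nth_left right len c s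
          brk_bounds(1)[OF i(1)] brk_bounds(2)[OF i(1)] e(1,2)]
      unfolding e(3) by (rule that)
  qed
  define b where "b = real (d choose (d - j)) * (-1) ^ j"
  have "b \<noteq> 0" by (simp add: b_def)
  have "tpow j (brk i) = (\<Sum>i\<in>{..d + k * (d - r)}. (a i / b) *\<^sub>R N k \<tau> d r i)"
  proof
    fix x
    have "b * tpow j (brk i) x = (\<Sum>i\<le>d + k * (d - r). a i * N k \<tau> d r i x)"
      using a[of x] unfolding n lessThan_Suc_atMost b_def N_def .
    then have "tpow j (brk i) x = (\<Sum>i\<le>d + k * (d - r). a i * N k \<tau> d r i x) / b"
      using \<open>b \<noteq> 0\<close> by (simp add: field_simps)
    then show "tpow j (brk i) x = (\<Sum>i\<in>{..d + k * (d - r)}. (a i / b) *\<^sub>R N k \<tau> d r i) x"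
      unfolding fun_sum_scaleR_apply by (simp add: sum_divide_distrib)
  qed
  then show ?thesis unfolding spline_space_def by (auto intro!: span_sum span_scale intro: span_base)
qed

theorem N_basis:
  assumes "r \<le> d"
  shows "is_basis_family (N k \<tau> d r) {..d + k * (d - r)} (spl d r)"
proof (rule is_basis_family_exchange[OF tpow_family_basis _ finite_tpow_index])
  show "tpow_family ` tpow_index d r \<subseteq> span (N k \<tau> d r ` {..d + k * (d - r)})"
    using tpow_in_spline_space[OF assms] by (auto simp: tpow_family_def spline_space_def)
qed (simp_all add: card_tpow_index)

lemma spline_space_eq_spl: "r \<le> d \<Longrightarrow> spline_space k \<tau> d r = spl d r"
  using N_basis[of r d] by (simp add: spline_space_def is_basis_family_def)

lemma dim_spline_space: "r \<le> d \<Longrightarrow> dim (spline_space k \<tau> d r) = Suc (d + k * (d - r))"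
  using is_basis_family_dim[OF N_basis] spline_space_eq_spl by simp

lemma N_in_spl: "r \<le> d \<Longrightarrow> i \<le> d + k * (d - r) \<Longrightarrow> N k \<tau> d r i \<in> spl d r"
  using N_basis[of r d] span_base[of "N k \<tau> d r i" "N k \<tau> d r ` {..d + k * (d - r)}"]
  by (auto simp: is_basis_family_def)

end

subsection \<open>One-sided derivatives\<close>

lemma D1_eqI:
  "(f has_vector_derivative f') (at x within {0..1}) \<Longrightarrow> 0 \<le> x \<Longrightarrow> x \<le> 1 \<Longrightarrow> D1 f x = f'"
  unfolding D1_def using vector_derivative_within_cbox[of 0 1 x f f'] by (simp add: cbox_interval)

lemma D1_cong:
  assumes "\<And>y. 0 \<le> y \<Longrightarrow> y \<le> 1 \<Longrightarrow> f y = g y" "0 \<le> x" "x \<le> 1"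
  shows "D1 f x = D1 g x"
proof -
  have "(f has_vector_derivative a) (at x within {0..1}) \<longleftrightarrow> (g has_vector_derivative a) (at x within {0..1})" for a
    using assms by (auto intro: has_vector_derivative_transform[rotated 2])
  then show ?thesis by (simp add: D1_def vector_derivative_def)
qed

text \<open>Relative to [0, 1] the interval from 0 to \<open>T\<close> is a neighbourhood of
  \<open>x\<close>, also for \<open>x = 0\<close>. B-splines are polynomial only up to the first
  breakpoint, so derivatives at 0 have to be computed from local information.\<close>

lemma D1_eq_local:
  assumes "\<And>y. 0 \<le> y \<Longrightarrow> y < T \<Longrightarrow> f y = g y" "(g has_real_derivative g') (at x)" "0 \<le> x" "x < T" "T \<le> 1"
  shows "D1 f x = g'"
proof (rule D1_eqI)
  have "(g has_vector_derivative g') (at x within {0..1})"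
    using assms(2) by (simp add: has_real_derivative_iff_has_vector_derivative has_vector_derivative_at_within)
  moreover have "\<forall>y\<in>{0..1}. dist y x < T - x \<longrightarrow> g y = f y"
    using assms(1) by (auto simp: dist_real_def)
  ultimately show "(f has_vector_derivative g') (at x within {0..1})"
    using assms(3-5) has_vector_derivative_transform_within[of g g' x "{0..1}" "T - x" f] by auto
qed (use assms in auto)

lemma poly_jet_at_0:
  assumes "\<forall>y\<in>{0..<T}. f y = poly P y" "0 < T" "T \<le> 1"
  shows "f 0 = coeff P 0" "D1 f 0 = coeff P 1" "D1 (D1 f) 0 = 2 * coeff P 2"
proof -
  have 1: "D1 f y = poly (pderiv P) y" if "0 \<le> y" "y < T" for y
    by (rule D1_eq_local[of T f "poly P", OF _ poly_DERIV]) (use assms that in auto)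
  have 2: "D1 (D1 f) y = poly (pderiv (pderiv P)) y" if "0 \<le> y" "y < T" for y
    by (rule D1_eq_local[of T "D1 f" "poly (pderiv P)", OF _ poly_DERIV]) (use 1 assms(3) that in auto)
  show "f 0 = coeff P 0" using assms by (simp add: poly_0_coeff_0)
  show "D1 f 0 = coeff P 1" using 1[of 0] assms(2) by (simp add: poly_0_coeff_0 coeff_pderiv)
  show "D1 (D1 f) 0 = 2 * coeff P 2"
    using 2[of 0] assms(2) by (simp add: poly_0_coeff_0 coeff_pderiv numeral_2_eq_2)
qed

text \<open>For an inner \<open>c\<close> the exponent \<open>Suc j\<close> must be at least 2,
  since the first truncated power has a kink at \<open>c\<close>. For \<open>c = 0\<close> there is
  no kink inside [0, 1].\<close>

lemma tpow_has_derivative: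
  assumes "0 \<le> c" "c < 1" "c = 0 \<or> 1 \<le> j" "0 \<le> x" "x \<le> 1"
  shows "(tpow (Suc j) c has_vector_derivative real (Suc j) * tpow j c x) (at x within {0..1})"
proof -
  have poly: "((\<lambda>x. (x - c) ^ Suc j) has_vector_derivative real (Suc j) * (x - c) ^ j) (at x within S)" for S
  proof -
    have "((\<lambda>x. x - c) has_real_derivative 1) (at x within S)" by (auto intro!: derivative_eq_intros)
    from DERIV_power[OF this, of "Suc j"] show ?thesis
      by (simp add: has_real_derivative_iff_has_vector_derivative)
  qed
  show ?thesis
  proof (cases "c = 0")
    case True
    show ?thesis
      by (rule has_vector_derivative_transform[of x _ _ "\<lambda>x. (x - c) ^ Suc j"])
        (use poly[of "{0..1}"] assms(4,5) True in \<open>auto simp: tpow_def\<close>)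
  next
    case False
    then have c: "0 < c" "1 \<le> j" using assms by auto
    have cl: "closure {0..<c} = {0..c}" using c by simp
    have main: "((\<lambda>x. if x \<in> {c..1} then (x - c) ^ Suc j else 0) has_vector_derivative
        (if x \<in> {c..1} then real (Suc j) * (x - c) ^ j else 0)) (at x within {0..1})"
    \<comment> \<open>The two pieces meet only at \<open>c\<close>, where values and derivatives of
      both are zero because \<open>1 <= j\<close>.\<close>
    proof (rule has_vector_derivative_If_within_closures[where S = "{c..1}" and T = "{0..<c}"
          and f' = "\<lambda>x. real (Suc j) * (x - c) ^ j" and g' = "\<lambda>_. 0"])
      show "((\<lambda>x. (x - c) ^ Suc j) has_vector_derivative real (Suc j) * (x - c) ^ j)
          (at x within {c..1} \<union> (closure {c..1} \<inter> closure {0..<c}))"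
        by (rule poly)
    qed (use assms c cl in auto)
    have e: "(if x \<in> {c..1} then real (Suc j) * (x - c) ^ j else 0) = real (Suc j) * tpow j c x"
      "(\<lambda>x. if x \<in> {c..1} then (x - c) ^ Suc j else 0) = tpow (Suc j) c"
      by (auto simp: tpow_def fun_eq_iff)
    show ?thesis using main unfolding e .
  qed
qed

subsection \<open>Closure properties of the spline spaces\<close>

context breakpoints
begin

lemma subspace_spl: "subspace (spl d r)"
  by (simp add: spl_def)

lemma tpow_in_spl: "(i, j) \<in> tpow_index d r \<Longrightarrow> tpow j (brk i) \<in> spl d r"
  unfolding spl_def by (rule span_base) (force simp: tpow_family_def)

lemma spl_mono: "d \<le> d' \<Longrightarrow> r' \<le> r \<Longrightarrow> spl d r \<subseteq> spl d' r'"
  unfolding spl_def by (rule span_mono, rule image_mono) (auto simp: tpow_index_def split: if_splits)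

lemma spl_induct [consumes 1, case_names zero add scale tpow]:
  assumes "f \<in> spl d r"
    and "P (\<lambda>x. 0)"
    and "\<And>f g. P f \<Longrightarrow> P g \<Longrightarrow> P (\<lambda>x. f x + g x)"
    and "\<And>c f. P f \<Longrightarrow> P (\<lambda>x. c * f x)"
    and "\<And>i j. (i, j) \<in> tpow_index d r \<Longrightarrow> P (tpow j (brk i))"
  shows "P f"
proof -
  have "subspace {f. P f}"
    using assms(2-4) by (auto simp: subspace_def zero_fun_def plus_fun_def scaleR_fun_def)
  then show ?thesis
    using assms(1,5) unfolding spl_def
    by (intro span_induct[of f _ P]) (auto simp: tpow_family_def)
qed

lemma spl_add: "f \<in> spl d r \<Longrightarrow> g \<in> spl d r \<Longrightarrow> (\<lambda>x. f x + g x) \<in> spl d r"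
  using subspace_add[OF subspace_spl, of f d r g] by (simp add: plus_fun_def)

lemma spl_scale: "f \<in> spl d r \<Longrightarrow> (\<lambda>x. c * f x) \<in> spl d r"
  using subspace_scale[OF subspace_spl, of f d r c] by (simp add: scaleR_fun_def)

lemma spl_0: "(\<lambda>x. 0) \<in> spl d r"
  using subspace_0[OF subspace_spl, of d r] by (simp add: zero_fun_def)

lemma spl_zero_outside: "f \<in> spl d r \<Longrightarrow> \<not> (0 \<le> x \<and> x \<le> 1) \<Longrightarrow> f x = 0"
proof (induction rule: spl_induct)
  case (tpow i j)
  then show ?case using brk_bounds(1)[of i] by (auto simp: tpow_def tpow_index_def)
qed auto

text \<open>Writing \<open>x\<close> as \<open>(x - c) + c\<close> turns a truncated power into two
  with the same base point and no smaller exponents, so the smoothness is kept and the degree grows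
  by one.\<close>

lemma spl_mult_x: "f \<in> spl d r \<Longrightarrow> (\<lambda>x. x * f x) \<in> spl (Suc d) r"
proof (induction rule: spl_induct)
  case (tpow i j)
  have "(\<lambda>x. x * tpow j (brk i) x) = (\<lambda>x. tpow (Suc j) (brk i) x + brk i * tpow j (brk i) x)"
    by (auto simp: tpow_def algebra_simps)
  moreover have "(i, Suc j) \<in> tpow_index (Suc d) r" "(i, j) \<in> tpow_index (Suc d) r"
    using tpow by (auto simp: tpow_index_def split: if_splits)
  ultimately show ?case by (simp add: spl_add spl_scale tpow_in_spl)
next
  case (add f g)
  then show ?case using spl_add by (force simp: distrib_left)
next
  case (scale c f)
  then show ?case using spl_scale[of "\<lambda>x. x * f x" _ _ c] by (simp add: ac_simps)
qed (simp add: spl_0)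

lemma spl_mult_poly: "f \<in> spl d r \<Longrightarrow> degree q \<le> e \<Longrightarrow> (\<lambda>x. poly q x * f x) \<in> spl (d + e) r"
proof (induction e arbitrary: q)
  case 0
  then obtain a where "q = [:a:]" by (auto elim: degree_eq_zeroE)
  then show ?case using 0 by (simp add: spl_scale)
next
  case (Suc e)
  obtain a q' where q: "q = pCons a q'" by (cases q)
  then have "degree q' \<le> e" using Suc.prems by (cases "q' = 0") auto
  then have "(\<lambda>x. poly q' x * f x) \<in> spl (d + e) r" using Suc by simp
  then have "(\<lambda>x. x * (poly q' x * f x)) \<in> spl (d + Suc e) r" using spl_mult_x by force
  moreover have "(\<lambda>x. a * f x) \<in> spl (d + Suc e) r"
    using Suc.prems spl_scale spl_mono[of d "d + Suc e" r r] by auto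
  ultimately have "(\<lambda>x. a * f x + x * (poly q' x * f x)) \<in> spl (d + Suc e) r" by (intro spl_add)
  then show ?case by (simp add: q algebra_simps)
qed

text \<open>Outside [0, 1] the function \<open>D1 f\<close> is unspecified, so \<open>D1 f\<close>
  itself cannot be claimed to be a spline; the witness \<open>f'\<close> is a spline that represents
  it on [0, 1].\<close>

lemma spl_has_derivative:
  assumes "f \<in> spl d r" "1 \<le> r"
  shows "\<exists>f'\<in>spl (d - 1) (r - 1). \<forall>x. 0 \<le> x \<and> x \<le> 1 \<longrightarrow> (f has_vector_derivative f' x) (at x within {0..1})"
  using assms(1)
proof (induction rule: spl_induct)
  case zero
  show ?case by (intro bexI[of _ "\<lambda>x. 0"]) (auto simp: spl_0)
next
  case (add f g)
  then obtain f' g' where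
    "f' \<in> spl (d - 1) (r - 1)" "g' \<in> spl (d - 1) (r - 1)"
    "\<forall>x. 0 \<le> x \<and> x \<le> 1 \<longrightarrow> (f has_vector_derivative f' x) (at x within {0..1})"
    "\<forall>x. 0 \<le> x \<and> x \<le> 1 \<longrightarrow> (g has_vector_derivative g' x) (at x within {0..1})" by blast
  then show ?case
    by (intro bexI[of _ "\<lambda>x. f' x + g' x"]) (auto intro!: spl_add has_vector_derivative_add)
next
  case (scale c f)
  then obtain f' where "f' \<in> spl (d - 1) (r - 1)"
    "\<forall>x. 0 \<le> x \<and> x \<le> 1 \<longrightarrow> (f has_vector_derivative f' x) (at x within {0..1})" by blast
  then show ?case
    by (intro bexI[of _ "\<lambda>x. c * f' x"]) (auto intro!: spl_scale has_vector_derivative_mult_right)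
next
  case (tpow i j)
  have ik: "i \<le> k" using tpow by (auto simp: tpow_index_def)
  show ?case
  proof (cases j)
    case 0
    then have "i = 0" using tpow by (auto simp: tpow_index_def split: if_splits)
    have "(tpow j (brk i) has_vector_derivative 0) (at x within {0..1})" if "0 \<le> x" "x \<le> 1" for x
      by (rule has_vector_derivative_transform[of x _ _ "\<lambda>x. 1"])
        (use that 0 \<open>i = 0\<close> in \<open>auto simp: tpow_def brk_def\<close>)
    then show ?thesis by (intro bexI[of _ "\<lambda>x. 0"]) (auto simp: spl_0)
  next
    case (Suc j')
    have "(i, j') \<in> tpow_index (d - 1) (r - 1)" "brk i = 0 \<or> 1 \<le> j'"
      using tpow Suc assms(2) by (auto simp: tpow_index_def brk_def split: if_splits)
    then show ?thesis using brk_bounds[OF ik] Suc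
      by (intro bexI[of _ "\<lambda>x. real (Suc j') * tpow j' (brk i) x"])
        (auto intro!: spl_scale tpow_in_spl tpow_has_derivative simp del: of_nat_Suc)
  qed
qed

lemma spl_D1:
  assumes "f \<in> spl d r" "1 \<le> r"
  obtains f' where "f' \<in> spl (d - 1) (r - 1)"
    "\<And>x. 0 \<le> x \<Longrightarrow> x \<le> 1 \<Longrightarrow> (f has_vector_derivative f' x) (at x within {0..1})"
    "\<And>x. 0 \<le> x \<Longrightarrow> x \<le> 1 \<Longrightarrow> D1 f x = f' x"
  using spl_has_derivative[OF assms] D1_eqI by metis

lemma spl_D1_D1:
  assumes "f \<in> spl d r" "2 \<le> r"
  obtains f' f'' where "f' \<in> spl (d - 1) (r - 1)" "f'' \<in> spl (d - 2) (r - 2)"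
    "\<And>x. 0 \<le> x \<Longrightarrow> x \<le> 1 \<Longrightarrow> (f has_vector_derivative f' x) (at x within {0..1})"
    "\<And>x. 0 \<le> x \<Longrightarrow> x \<le> 1 \<Longrightarrow> (f' has_vector_derivative f'' x) (at x within {0..1})"
    "\<And>x. 0 \<le> x \<Longrightarrow> x \<le> 1 \<Longrightarrow> D1 f x = f' x"
    "\<And>x. 0 \<le> x \<Longrightarrow> x \<le> 1 \<Longrightarrow> D1 (D1 f) x = f'' x"
proof -
  obtain f' where f': "f' \<in> spl (d - 1) (r - 1)"
    "\<And>x. 0 \<le> x \<Longrightarrow> x \<le> 1 \<Longrightarrow> (f has_vector_derivative f' x) (at x within {0..1})"
    "\<And>x. 0 \<le> x \<Longrightarrow> x \<le> 1 \<Longrightarrow> D1 f x = f' x"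
    using spl_D1[OF assms(1)] assms(2) by auto
  have r1: "1 \<le> r - 1" using assms(2) by simp
  obtain f'' where f'': "f'' \<in> spl (d - 1 - 1) (r - 1 - 1)"
    "\<And>x. 0 \<le> x \<Longrightarrow> x \<le> 1 \<Longrightarrow> (f' has_vector_derivative f'' x) (at x within {0..1})"
    "\<And>x. 0 \<le> x \<Longrightarrow> x \<le> 1 \<Longrightarrow> D1 f' x = f'' x"
    using spl_D1[OF f'(1) r1] by blast
  have "D1 (D1 f) x = f'' x" if "0 \<le> x" "x \<le> 1" for x
    using D1_cong[of "D1 f" f' x] f'(3) f''(3) that by simp
  then show ?thesis using that[of f' f''] f' f'' by (simp add: numeral_2_eq_2)
qed

text \<open>An inner truncated power has an exponent larger than \<open>r\<close>, hence at least 1,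
  and is then a power of the continuous function \<open>max 0 (x - c)\<close>.\<close>

lemma spl_continuous: "f \<in> spl d r \<Longrightarrow> continuous_on {0..1} f"
proof (induction rule: spl_induct)
  case (tpow i j)
  show ?case
  proof (cases "j = 0")
    case True
    then have "i = 0" using tpow by (auto simp: tpow_index_def split: if_splits)
    then have "continuous_on {0..1} (tpow j (brk i)) = continuous_on {0..1} (\<lambda>x::real. 1::real)"
      using True by (intro continuous_on_cong) (auto simp: tpow_def brk_def)
    then show ?thesis by simp
  next
    case False
    then have "continuous_on {0..1} (tpow j (brk i)) = continuous_on {0..1} (\<lambda>x. (max 0 (x - brk i)) ^ j)"
      by (intro continuous_on_cong) (auto simp: tpow_def max_def)
    then show ?thesis by (simp add: continuous_intros)
  qed
qed (auto intro!: continuous_intros)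

end

subsection \<open>The functions \<open>M\<^sub>0\<close>, \<open>M\<^sub>1\<close>, \<open>M\<^sub>2\<close>\<close>

text \<open>On the first nonempty knot interval the B-splines in question are Bernstein polynomials:
  \<open>b + 1\<close> of the knots of B-spline \<open>i\<close> of degree \<open>q\<close> are
  copies of \<open>T\<close> and \<open>q - b + 1\<close> are copies of 0. The two terms of the
  recursion have parameters \<open>b - 1\<close> and \<open>b\<close>, and Pascal's rule adds them.
  The bound \<open>b <= 2\<close> corresponds to the three copies of \<open>T\<close>.\<close>

lemma bspline_bernstein:
  assumes "sorted t" "\<And>j. j \<le> d \<Longrightarrow> t ! j = 0" "\<And>j. d < j \<Longrightarrow> j \<le> d + 3 \<Longrightarrow> t ! j = T"
    and "T \<le> last t" "0 \<le> x" "x < T" "i + q = d + b" "b \<le> 2"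
  shows "bspline t q i x = real (q choose b) * (x / T) ^ b * (1 - x / T) ^ (q - b)"
  using assms(7,8)
proof (induction q arbitrary: i b)
  case 0
  then show ?case using assms(2)[of d] assms(3)[of "d + b"] assms(3)[of "d + 1"] assms(4-6)
    by (cases "b = 0") (auto simp: bspline.simps)
next
  case (Suc q)
  have T: "T > 0" using assms(5,6) by linarith
  have second: "(t ! (i + q + 2) - x) / (t ! (i + q + 2) - t ! (i + 1)) * bspline t q (i + 1) x
      = real (q choose b) * (x / T) ^ b * (1 - x / T) ^ (Suc q - b)"
  proof (cases "q < b")
    case False
    then have "i + 1 \<le> d" "i + q + 2 = d + b + 1" "Suc q - b = Suc (q - b)" using Suc.prems by auto
    moreover have "(T - x) / T = 1 - x / T" using T by (simp add: diff_divide_distrib)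
    ultimately show ?thesis
      using Suc.IH[of "i + 1" b] Suc.prems assms(2)[of "i + 1"] assms(3)[of "d + b + 1"] by simp
  qed (use Suc.IH[of "i + 1" b] Suc.prems in \<open>simp add: binomial_eq_0\<close>)
  show ?case
  proof (cases b)
    case 0
    then have "t ! (i + q + 1) = 0" "t ! i = 0" using Suc.prems assms(2) by auto
    then show ?thesis using second 0 unfolding bspline.simps by simp
  next
    case (Suc b')
    have first: "(x - t ! i) / (t ! (i + q + 1) - t ! i) * bspline t q i x
      = real (q choose b') * (x / T) ^ b * (1 - x / T) ^ (Suc q - b)"
    proof (cases "q < b'")
      case False
      then have "i \<le> d" "i + q + 1 = d + b" using Suc Suc.prems by auto
      then show ?thesis
        using Suc.IH[of i b'] Suc Suc.prems assms(2)[of i] assms(3)[of "d + b"] by simp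
    qed (use Suc.IH[of i b'] Suc Suc.prems in \<open>simp add: binomial_eq_0\<close>)
    show ?thesis unfolding bspline.simps first second
      by (simp add: Suc distrib_right add_divide_distrib)
  qed
qed

context breakpoints
begin

lemma tau1_bounds: "0 < tau1 k \<tau>" "tau1 k \<tau> \<le> 1"
  using tau_bounds by (auto simp: tau1_def intro: less_imp_le)

text \<open>The first breakpoint has multiplicity \<open>d - r >= 3\<close>, or
  \<open>d + 1 >= 3\<close> if it is the right end point, which supplies the three copies required
  above.\<close>

lemma N_bernstein:
  assumes "2 \<le> d" "r + 3 \<le> d" "b \<le> 2" "0 \<le> x" "x < tau1 k \<tau>"
  shows "N k \<tau> d r b x = real (d choose b) * (x / tau1 k \<tau>) ^ b * (1 - x / tau1 k \<tau>) ^ (d - b)"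
  unfolding N_def
proof (rule bspline_bernstein[OF sorted_knots])
  show "knots k \<tau> d r ! j = 0" if "j \<le> d" for j by (rule knots_nth_left[OF that])
  show "knots k \<tau> d r ! j = tau1 k \<tau>" if j: "d < j" "j \<le> d + 3" for j
  proof (cases "k = 0")
    case True
    then show ?thesis using knots_nth_right[of d r j] j assms by (simp add: tau1_def)
  next
    case False
    then have "1 * (d - r) \<le> k * (d - r)" by (intro mult_le_mono1) simp
    then have "j < d + 1 + k * (d - r)" using j assms by linarith
    then show ?thesis using knots_nth_inner[of d j r] j assms False by (simp add: tau1_def)
  qed
  have "last (knots k \<tau> d r) = 1" by (simp add: knots_def)
  then show "tau1 k \<tau> \<le> last (knots k \<tau> d r)" using tau1_bounds by simp
qed (use assms in auto)

text \<open>Near 0 the three functions agree with 1, u and u^2/2 up to terms of order three. The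
  factor 2 in \<open>M1\<close> cancels the quadratic term of the first Bernstein polynomial, and
  the prefactors of \<open>M1\<close> and \<open>M2\<close> normalize the first and second
  derivative.\<close>

lemma M_jets:
  assumes "2 \<le> d" "r + 3 \<le> d"
  shows "M0 k \<tau> d r 0 = 1" "D1 (M0 k \<tau> d r) 0 = 0" "D1 (D1 (M0 k \<tau> d r)) 0 = 0"
    and "M1 k \<tau> d r 0 = 0" "D1 (M1 k \<tau> d r) 0 = 1" "D1 (D1 (M1 k \<tau> d r)) 0 = 0"
    and "M2 k \<tau> d r 0 = 0" "D1 (M2 k \<tau> d r) 0 = 0" "D1 (D1 (M2 k \<tau> d r)) 0 = 1"
proof -
  define T where "T = tau1 k \<tau>"
  have T: "0 < T" "T \<le> 1" using tau1_bounds by (auto simp: T_def)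
  define B where "B b = smult (real (d choose b) / T ^ b) (monom 1 b * [:1, - 1 / T:] ^ (d - b))" for b
  have B: "poly (B b) x = N k \<tau> d r b x" if "b \<le> 2" "0 \<le> x" "x < T" for b x
    using N_bernstein[OF assms that(1,2)] that(3)
    by (simp add: B_def T_def poly_monom power_divide poly_power)
  have co: "coeff (B b) e = real (d choose b) / T ^ b *
      (if e < b then 0 else real ((d - b) choose (e - b)) * (- 1 / T) ^ (e - b))" if "e \<le> 2" for b e
    using that assms(1) by (auto simp: B_def coeff_monom_mult coeff_linear_poly_power)
  have C2: "real (d choose 2) = real d * (real d - 1) / 2"
    using assms(1) by (simp add: choose_two real_of_nat_div of_nat_diff)
  have C1: "real (d - 1) = real d - 1" using assms by simp
  note coeffs = co[of 0] co[of 1] co[of 2] C2 C1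
  have d: "real d \<noteq> 0" "real d - 1 \<noteq> 0" using assms by auto
  have 0: "\<forall>x\<in>{0..<T}. M0 k \<tau> d r x = poly (B 0 + B 1 + B 2) x"
    by (simp add: M0_def B)
  have 1: "\<forall>x\<in>{0..<T}. M1 k \<tau> d r x = poly (smult (T / real d) (B 1 + smult 2 (B 2))) x"
    by (simp add: M1_def B T_def)
  have 2: "\<forall>x\<in>{0..<T}. M2 k \<tau> d r x = poly (smult (T\<^sup>2 / (real d * (real d - 1))) (B 2)) x"
    by (simp add: M2_def B T_def)
  note jet0 = poly_jet_at_0[of T "M0 k \<tau> d r", OF 0 T] and jet1 = poly_jet_at_0[of T "M1 k \<tau> d r", OF 1 T] and jet2 = poly_jet_at_0[of T "M2 k \<tau> d r", OF 2 T]
  show "M0 k \<tau> d r 0 = 1" "D1 (M0 k \<tau> d r) 0 = 0" "D1 (D1 (M0 k \<tau> d r)) 0 = 0"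
    unfolding jet0 using T d by (simp_all add: coeffs choose_one field_simps power2_eq_square del: One_nat_def)
  show "M1 k \<tau> d r 0 = 0" "D1 (M1 k \<tau> d r) 0 = 1" "D1 (D1 (M1 k \<tau> d r)) 0 = 0"
    unfolding jet1 using T d by (simp_all add: coeffs choose_one field_simps power2_eq_square del: One_nat_def)
  show "M2 k \<tau> d r 0 = 0" "D1 (M2 k \<tau> d r) 0 = 0" "D1 (D1 (M2 k \<tau> d r)) 0 = 1"
    unfolding jet2 using T d by (simp_all add: coeffs choose_one field_simps power2_eq_square del: One_nat_def)
qed

lemma M_in_spl:
  assumes "r + 3 \<le> d"
  shows "M0 k \<tau> d r \<in> spl d r" "M1 k \<tau> d r \<in> spl d r" "M2 k \<tau> d r \<in> spl d r"
proof -
  have n: "N k \<tau> d r i \<in> spl d r" if "i \<le> 2" for i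
    using that assms by (intro N_in_spl) auto
  show "M0 k \<tau> d r \<in> spl d r"
    unfolding M0_def[abs_def] by (intro spl_add n) auto
  show "M1 k \<tau> d r \<in> spl d r"
    unfolding M1_def[abs_def] by (intro spl_scale spl_add n) auto
  show "M2 k \<tau> d r \<in> spl d r"
    unfolding M2_def[abs_def] by (intro spl_scale n) auto
qed

end

subsection \<open>Functions on the unit square\<close>

definition C1sq :: "(real \<times> real \<Rightarrow> real) \<Rightarrow> bool" where
  "C1sq h \<longleftrightarrow> continuous_on unit_sq (Du h) \<and> continuous_on unit_sq (Dv h) \<and>
    (\<forall>z\<in>unit_sq. (h has_derivative (\<lambda>w. Du h z * fst w + Dv h z * snd w)) (at z within unit_sq))"

text \<open>Symmetry of the mixed derivatives is carried along in the definition. It is visible for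
  products f(u) g(v) and passes to linear combinations, hence to tensor product splines.\<close>

definition C2sq :: "(real \<times> real \<Rightarrow> real) \<Rightarrow> bool" where
  "C2sq h \<longleftrightarrow> C1sq h \<and> C1sq (Du h) \<and> C1sq (Dv h) \<and> (\<forall>z\<in>unit_sq. Dv (Du h) z = Du (Dv h) z)"

lemma slice_derivatives:
  assumes "(h has_derivative (\<lambda>w. a * fst w + b * snd w)) (at (u, v) within unit_sq)" "(u, v) \<in> unit_sq"
  shows "((\<lambda>s. h (s, v)) has_real_derivative a) (at u within {0..1})"
    and "((\<lambda>t. h (u, t)) has_real_derivative b) (at v within {0..1})"
proof -
  have 1: "((\<lambda>s. (s, v)) has_derivative (\<lambda>s. (s, 0))) (at u within {0..1})"
    and 2: "((\<lambda>t. (u, t)) has_derivative (\<lambda>t. (0, t))) (at v within {0..1})"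
    by (auto intro!: derivative_eq_intros)
  have h1: "(h has_derivative (\<lambda>w. a * fst w + b * snd w)) (at (u, v) within (\<lambda>s. (s, v)) ` {0..1})"
    and h2: "(h has_derivative (\<lambda>w. a * fst w + b * snd w)) (at (u, v) within (\<lambda>t. (u, t)) ` {0..1})"
    using assms(2) by (auto intro!: has_derivative_subset[OF assms(1)])
  show "((\<lambda>s. h (s, v)) has_real_derivative a) (at u within {0..1})"
    using has_derivative_in_compose[OF 1 h1] by (simp add: has_field_derivative_def)
  show "((\<lambda>t. h (u, t)) has_real_derivative b) (at v within {0..1})"
    using has_derivative_in_compose[OF 2 h2] by (simp add: has_field_derivative_def)
qed

lemma Du_Dv_eqI:
  assumes "(h has_derivative (\<lambda>w. a * fst w + b * snd w)) (at z within unit_sq)" "z \<in> unit_sq"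
  shows "Du h z = a" "Dv h z = b"
proof -
  obtain u v where z: "z = (u, v)" by (cases z)
  show "Du h z = a" "Dv h z = b"
    using slice_derivatives[of h a b u v] assms D1_eqI
    by (auto simp: z Du_def Dv_def has_real_derivative_iff_has_vector_derivative)
qed

lemma C1sqI:
  assumes "\<And>z. z \<in> unit_sq \<Longrightarrow> (h has_derivative (\<lambda>w. a z * fst w + b z * snd w)) (at z within unit_sq)"
    and "continuous_on unit_sq a" "continuous_on unit_sq b"
  shows "C1sq h" "\<And>z. z \<in> unit_sq \<Longrightarrow> Du h z = a z" "\<And>z. z \<in> unit_sq \<Longrightarrow> Dv h z = b z"
proof -
  show eq: "Du h z = a z" "Dv h z = b z" if "z \<in> unit_sq" for z
    using Du_Dv_eqI[OF assms(1)[OF that] that] by auto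
  have "continuous_on unit_sq (Du h)" "continuous_on unit_sq (Dv h)"
    using assms(2,3) eq continuous_on_cong[of unit_sq unit_sq] by metis+
  then show "C1sq h" using assms(1) eq by (simp add: C1sq_def)
qed

lemma Du_cong: "(\<And>z. z \<in> unit_sq \<Longrightarrow> f z = g z) \<Longrightarrow> z \<in> unit_sq \<Longrightarrow> Du f z = Du g z"
  by (cases z) (auto simp: Du_def intro!: D1_cong)

lemma Dv_cong: "(\<And>z. z \<in> unit_sq \<Longrightarrow> f z = g z) \<Longrightarrow> z \<in> unit_sq \<Longrightarrow> Dv f z = Dv g z"
  by (cases z) (auto simp: Dv_def intro!: D1_cong)

lemma C1sq_derivative:
  "C1sq h \<Longrightarrow> z \<in> unit_sq \<Longrightarrow> (h has_derivative (\<lambda>w. Du h z * fst w + Dv h z * snd w)) (at z within unit_sq)"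
  unfolding C1sq_def by blast

lemma C1sq_continuous: "C1sq h \<Longrightarrow> continuous_on unit_sq h"
  unfolding C1sq_def continuous_on_eq_continuous_within using has_derivative_continuous by blast

lemma C1sq_cong:
  assumes "\<And>z. z \<in> unit_sq \<Longrightarrow> f z = g z" "C1sq g"
  shows "C1sq f"
proof (rule C1sqI(1))
  show "(f has_derivative (\<lambda>w. Du g z * fst w + Dv g z * snd w)) (at z within unit_sq)" if "z \<in> unit_sq" for z
    using has_derivative_transform[OF that assms(1) C1sq_derivative[OF assms(2) that]] .
qed (use assms(2) in \<open>auto simp: C1sq_def\<close>)

lemma C1sq_const: "C1sq (\<lambda>z. c)" "z \<in> unit_sq \<Longrightarrow> Du (\<lambda>z. c) z = 0" "z \<in> unit_sq \<Longrightarrow> Dv (\<lambda>z. c) z = 0"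
  using C1sqI[of "\<lambda>z. c" "\<lambda>z. 0" "\<lambda>z. 0"] by auto

lemma C1sq_add:
  assumes f: "C1sq f" and g: "C1sq g"
  shows "C1sq (\<lambda>z. f z + g z)"
    and "z \<in> unit_sq \<Longrightarrow> Du (\<lambda>z. f z + g z) z = Du f z + Du g z"
    and "z \<in> unit_sq \<Longrightarrow> Dv (\<lambda>z. f z + g z) z = Dv f z + Dv g z"
proof -
  have 1: "((\<lambda>z. f z + g z) has_derivative (\<lambda>w. (Du f z + Du g z) * fst w + (Dv f z + Dv g z) * snd w))
      (at z within unit_sq)" if "z \<in> unit_sq" for z
    by (rule has_derivative_eq_rhs[OF has_derivative_add[OF C1sq_derivative[OF f that] C1sq_derivative[OF g that]]])
      (auto simp: algebra_simps)
  have 2: "continuous_on unit_sq (\<lambda>z. Du f z + Du g z)" "continuous_on unit_sq (\<lambda>z. Dv f z + Dv g z)"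
    using f g by (auto simp: C1sq_def intro: continuous_intros)
  show "C1sq (\<lambda>z. f z + g z)" "z \<in> unit_sq \<Longrightarrow> Du (\<lambda>z. f z + g z) z = Du f z + Du g z"
    "z \<in> unit_sq \<Longrightarrow> Dv (\<lambda>z. f z + g z) z = Dv f z + Dv g z"
    using C1sqI[OF 1 2] by auto
qed

lemma C1sq_mult:
  assumes f: "C1sq f" and g: "C1sq g"
  shows "C1sq (\<lambda>z. f z * g z)"
    and "z \<in> unit_sq \<Longrightarrow> Du (\<lambda>z. f z * g z) z = Du f z * g z + f z * Du g z"
    and "z \<in> unit_sq \<Longrightarrow> Dv (\<lambda>z. f z * g z) z = Dv f z * g z + f z * Dv g z"
proof -
  have 1: "((\<lambda>z. f z * g z) has_derivative
      (\<lambda>w. (Du f z * g z + f z * Du g z) * fst w + (Dv f z * g z + f z * Dv g z) * snd w))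
      (at z within unit_sq)" if "z \<in> unit_sq" for z
    by (rule has_derivative_eq_rhs[OF has_derivative_mult[OF C1sq_derivative[OF f that] C1sq_derivative[OF g that]]])
      (auto simp: algebra_simps)
  have 2: "continuous_on unit_sq (\<lambda>z. Du f z * g z + f z * Du g z)"
      "continuous_on unit_sq (\<lambda>z. Dv f z * g z + f z * Dv g z)"
    using f g C1sq_continuous[OF f] C1sq_continuous[OF g] by (auto simp: C1sq_def intro!: continuous_intros)
  show "C1sq (\<lambda>z. f z * g z)" "z \<in> unit_sq \<Longrightarrow> Du (\<lambda>z. f z * g z) z = Du f z * g z + f z * Du g z"
    "z \<in> unit_sq \<Longrightarrow> Dv (\<lambda>z. f z * g z) z = Dv f z * g z + f z * Dv g z"
    using C1sqI[OF 1 2] by auto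
qed

lemma C1sq_divide:
  assumes f: "C1sq f" and g: "C1sq g" and nz: "\<And>z. z \<in> unit_sq \<Longrightarrow> g z \<noteq> 0"
  shows "C1sq (\<lambda>z. f z / g z)"
proof (rule C1sqI(1))
  show "((\<lambda>z. f z / g z) has_derivative
      (\<lambda>w. (Du f z * g z - f z * Du g z) / (g z * g z) * fst w + (Dv f z * g z - f z * Dv g z) / (g z * g z) * snd w))
      (at z within unit_sq)" if "z \<in> unit_sq" for z
    by (rule has_derivative_eq_rhs[OF has_derivative_divide'[OF C1sq_derivative[OF f that] C1sq_derivative[OF g that] nz[OF that]]])
      (auto simp: algebra_simps add_divide_distrib diff_divide_distrib)
qed (use f g nz C1sq_continuous[OF f] C1sq_continuous[OF g] in \<open>auto simp: C1sq_def intro!: continuous_intros\<close>)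

lemma C1sq_diff:
  assumes "C1sq f" "C1sq g"
  shows "C1sq (\<lambda>z. f z - g z)"
  using C1sq_add(1)[OF assms(1) C1sq_mult(1)[OF C1sq_const(1)[of "-1"] assms(2)]] by simp

lemma C2sq_cong:
  assumes eq: "\<And>z. z \<in> unit_sq \<Longrightarrow> f z = g z" and g: "C2sq g"
  shows "C2sq f"
proof -
  have u: "Du f z = Du g z" and v: "Dv f z = Dv g z" if "z \<in> unit_sq" for z
    using Du_cong[OF eq] Dv_cong[OF eq] that by auto
  have "Dv (Du f) z = Dv (Du g) z" "Du (Dv f) z = Du (Dv g) z" if "z \<in> unit_sq" for z
    using Dv_cong[OF u] Du_cong[OF v] that by auto
  then show ?thesis using g C1sq_cong[OF eq] C1sq_cong[OF u] C1sq_cong[OF v] by (auto simp: C2sq_def)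
qed

lemma C2sqI:
  assumes f: "C1sq f" and eq: "\<And>z. z \<in> unit_sq \<Longrightarrow> Du f z = a z" "\<And>z. z \<in> unit_sq \<Longrightarrow> Dv f z = b z"
    and "C1sq a" "C1sq b" "\<And>z. z \<in> unit_sq \<Longrightarrow> Dv a z = Du b z"
  shows "C2sq f"
  using assms C1sq_cong[OF eq(1)] C1sq_cong[OF eq(2)] Dv_cong[OF eq(1)] Du_cong[OF eq(2)]
  by (auto simp: C2sq_def)

lemma C2sq_zero: "C2sq (\<lambda>z. 0)"
  by (rule C2sqI[of _ "\<lambda>z. 0" "\<lambda>z. 0"]) (simp_all add: C1sq_const)

lemma C2sq_add:
  assumes "C2sq f" "C2sq g"
  shows "C2sq (\<lambda>z. f z + g z)"
proof -
  have c: "C1sq f" "C1sq g" "C1sq (Du f)" "C1sq (Du g)" "C1sq (Dv f)" "C1sq (Dv g)"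
    using assms by (auto simp: C2sq_def)
  show ?thesis
    by (rule C2sqI[of _ "\<lambda>z. Du f z + Du g z" "\<lambda>z. Dv f z + Dv g z"])
      (use assms in \<open>auto simp: c C1sq_add C2sq_def\<close>)
qed

lemma C2sq_scale:
  assumes "C2sq f"
  shows "C2sq (\<lambda>z. c * f z)"
proof -
  have c: "C1sq f" "C1sq (Du f)" "C1sq (Dv f)" using assms by (auto simp: C2sq_def)
  show ?thesis
    by (rule C2sqI[of _ "\<lambda>z. c * Du f z" "\<lambda>z. c * Dv f z"])
      (use assms in \<open>auto simp: c C1sq_mult C1sq_const C2sq_def\<close>)
qed

context breakpoints
begin

lemma tensor_C1sq:
  assumes f: "f \<in> spl d r" and g: "g \<in> spl d' r'" and r: "1 \<le> r" "1 \<le> r'"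
  shows "C1sq (\<lambda>(u, v). f u * g v)"
    and "z \<in> unit_sq \<Longrightarrow> Du (\<lambda>(u, v). f u * g v) z = D1 f (fst z) * g (snd z)"
    and "z \<in> unit_sq \<Longrightarrow> Dv (\<lambda>(u, v). f u * g v) z = f (fst z) * D1 g (snd z)"
proof -
  obtain f' where f': "f' \<in> spl (d - 1) (r - 1)"
    "\<And>x. 0 \<le> x \<Longrightarrow> x \<le> 1 \<Longrightarrow> (f has_vector_derivative f' x) (at x within {0..1})"
    "\<And>x. 0 \<le> x \<Longrightarrow> x \<le> 1 \<Longrightarrow> D1 f x = f' x"
    using spl_D1[OF f r(1)] by blast
  obtain g' where g': "g' \<in> spl (d' - 1) (r' - 1)"
    "\<And>x. 0 \<le> x \<Longrightarrow> x \<le> 1 \<Longrightarrow> (g has_vector_derivative g' x) (at x within {0..1})"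
    "\<And>x. 0 \<le> x \<Longrightarrow> x \<le> 1 \<Longrightarrow> D1 g x = g' x"
    using spl_D1[OF g r(2)] by blast
  have 1: "((\<lambda>(u, v). f u * g v) has_derivative (\<lambda>w. (f' (fst z) * g (snd z)) * fst w + (f (fst z) * g' (snd z)) * snd w))
      (at z within unit_sq)" if z: "z \<in> unit_sq" for z
  proof -
    have "((\<lambda>z. f (fst z)) has_derivative (\<lambda>w. fst w *\<^sub>R f' (fst z))) (at z within unit_sq)"
      by (rule has_derivative_in_compose[OF has_derivative_fst[OF has_derivative_ident]],
          rule has_derivative_subset[of _ _ _ "{0..1}"])
        (use z f'(2)[of "fst z"] in \<open>auto simp: has_vector_derivative_def\<close>)
    moreover have "((\<lambda>z. g (snd z)) has_derivative (\<lambda>w. snd w *\<^sub>R g' (snd z))) (at z within unit_sq)"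
      by (rule has_derivative_in_compose[OF has_derivative_snd[OF has_derivative_ident]],
          rule has_derivative_subset[of _ _ _ "{0..1}"])
        (use z g'(2)[of "snd z"] in \<open>auto simp: has_vector_derivative_def\<close>)
    ultimately have "((\<lambda>z. f (fst z) * g (snd z)) has_derivative
        (\<lambda>w. f (fst z) * (snd w *\<^sub>R g' (snd z)) + fst w *\<^sub>R f' (fst z) * g (snd z))) (at z within unit_sq)"
      by (rule has_derivative_mult)
    then show ?thesis
      unfolding case_prod_unfold by (rule has_derivative_eq_rhs) (auto simp: algebra_simps)
  qed
  have cont: "continuous_on unit_sq (\<lambda>z. a (fst z) * b (snd z))"
    if "a \<in> spl e s" "b \<in> spl e' s'" for a b e s e' s'
    by (intro continuous_on_mult continuous_on_compose2[OF spl_continuous[OF that(1)]]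
        continuous_on_compose2[OF spl_continuous[OF that(2)]]) (auto intro!: continuous_intros)
  show "C1sq (\<lambda>(u, v). f u * g v)" "z \<in> unit_sq \<Longrightarrow> Du (\<lambda>(u, v). f u * g v) z = D1 f (fst z) * g (snd z)"
    "z \<in> unit_sq \<Longrightarrow> Dv (\<lambda>(u, v). f u * g v) z = f (fst z) * D1 g (snd z)"
    using C1sqI[OF 1 cont[OF f'(1) g] cont[OF f g'(1)]] f'(3) g'(3) by auto
qed

lemma tensor_C2sq:
  assumes f: "f \<in> spl d r" and g: "g \<in> spl d' r'" and r: "2 \<le> r" "2 \<le> r'"
  shows "C2sq (\<lambda>(u, v). f u * g v)"
proof -
  have r1: "1 \<le> r" "1 \<le> r'" "1 \<le> r - 1" "1 \<le> r' - 1" using r by auto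
  obtain f' where f': "f' \<in> spl (d - 1) (r - 1)"
    "\<And>x. 0 \<le> x \<Longrightarrow> x \<le> 1 \<Longrightarrow> (f has_vector_derivative f' x) (at x within {0..1})"
    "\<And>x. 0 \<le> x \<Longrightarrow> x \<le> 1 \<Longrightarrow> D1 f x = f' x"
    using spl_D1[OF f r1(1)] by blast
  obtain g' where g': "g' \<in> spl (d' - 1) (r' - 1)"
    "\<And>x. 0 \<le> x \<Longrightarrow> x \<le> 1 \<Longrightarrow> (g has_vector_derivative g' x) (at x within {0..1})"
    "\<And>x. 0 \<le> x \<Longrightarrow> x \<le> 1 \<Longrightarrow> D1 g x = g' x"
    using spl_D1[OF g r1(2)] by blast
  show ?thesis
    by (rule C2sqI[of _ "\<lambda>(u, v). f' u * g v" "\<lambda>(u, v). f u * g' v"])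
      (use f'(3) g'(3) in \<open>auto simp: tensor_C1sq[OF f g r1(1,2)] tensor_C1sq[OF f'(1) g r1(3,2)]
          tensor_C1sq[OF f g'(1) r1(1,4)]\<close>)
qed

lemma spline_space2_C2sq:
  assumes "h \<in> spline_space2 k \<tau> d r" "2 \<le> r" "r \<le> d"
  shows "C2sq h"
proof -
  have "subspace {h. C2sq h}"
    using C2sq_add C2sq_scale C2sq_zero
    by (auto simp: subspace_def zero_fun_def plus_fun_def scaleR_fun_def case_prod_unfold)
  moreover have "N2 k \<tau> d r i j \<in> {h. C2sq h}" if "i \<le> d + k * (d - r)" "j \<le> d + k * (d - r)" for i j
    using tensor_C2sq[OF N_in_spl N_in_spl, of r d i r d j] assms(2,3) that by (simp add: N2_def)
  ultimately have "spline_space2 k \<tau> d r \<subseteq> {h. C2sq h}"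
    unfolding spline_space2_def by (intro span_minimal) auto
  then show ?thesis using assms(1) by blast
qed

end

subsection \<open>Gradients on a patch\<close>

text \<open>The partial derivatives of \<open>h \<circ> G\<^sup>-\<^sup>1\<close>, pulled back to the unit square.\<close>

definition gradx :: "(real \<times> real \<Rightarrow> real \<times> real) \<Rightarrow> (real \<times> real \<Rightarrow> real) \<Rightarrow> real \<times> real \<Rightarrow> real" where
  "gradx G h z = (Du h z * Dv (\<lambda>z. snd (G z)) z - Dv h z * Du (\<lambda>z. snd (G z)) z) /
     (Du (\<lambda>z. fst (G z)) z * Dv (\<lambda>z. snd (G z)) z - Dv (\<lambda>z. fst (G z)) z * Du (\<lambda>z. snd (G z)) z)"

definition grady :: "(real \<times> real \<Rightarrow> real \<times> real) \<Rightarrow> (real \<times> real \<Rightarrow> real) \<Rightarrow> real \<times> real \<Rightarrow> real" where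
  "grady G h z = (Dv h z * Du (\<lambda>z. fst (G z)) z - Du h z * Dv (\<lambda>z. fst (G z)) z) /
     (Du (\<lambda>z. fst (G z)) z * Dv (\<lambda>z. snd (G z)) z - Dv (\<lambda>z. fst (G z)) z * Du (\<lambda>z. snd (G z)) z)"

locale C2_patch =
  fixes G :: "real \<times> real \<Rightarrow> real \<times> real"
  assumes C2_fst: "C2sq (\<lambda>z. fst (G z))" and C2_snd: "C2sq (\<lambda>z. snd (G z))"
    and regular: "z \<in> unit_sq \<Longrightarrow>
      Du (\<lambda>z. fst (G z)) z * Dv (\<lambda>z. snd (G z)) z - Dv (\<lambda>z. fst (G z)) z * Du (\<lambda>z. snd (G z)) z \<noteq> 0"
    and inj: "inj_on G unit_sq"
begin

abbreviation "X \<equiv> \<lambda>z. fst (G z)"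
abbreviation "Y \<equiv> \<lambda>z. snd (G z)"

lemma C1_parts: "C1sq X" "C1sq Y" "C1sq (Du X)" "C1sq (Du Y)" "C1sq (Dv X)" "C1sq (Dv Y)"
  using C2_fst C2_snd by (auto simp: C2sq_def)

text \<open>\<open>gradx\<close> and \<open>grady\<close> are the solution of this linear system by
  Cramer's rule, so the identities are algebraic.\<close>

lemma chain_rule:
  assumes "z \<in> unit_sq"
  shows "gradx G h z * Du X z + grady G h z * Du Y z = Du h z"
    and "gradx G h z * Dv X z + grady G h z * Dv Y z = Dv h z"
proof -
  let ?J = "Du X z * Dv Y z - Dv X z * Du Y z"
  have "gradx G h z * Du X z + grady G h z * Du Y z = Du h z * ?J / ?J"
    "gradx G h z * Dv X z + grady G h z * Dv Y z = Dv h z * ?J / ?J"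
    unfolding gradx_def grady_def times_divide_eq_left add_divide_distrib[symmetric]
    by (rule arg_cong[of _ _ "\<lambda>x. x / ?J"], simp add: algebra_simps)+
  then show "gradx G h z * Du X z + grady G h z * Du Y z = Du h z"
    "gradx G h z * Dv X z + grady G h z * Dv Y z = Dv h z"
    using regular[OF assms] by auto
qed

lemma C1sq_grad:
  assumes "C2sq h"
  shows "C1sq (gradx G h)" "C1sq (grady G h)"
proof -
  have h: "C1sq (Du h)" "C1sq (Dv h)" using assms by (auto simp: C2sq_def)
  show "C1sq (gradx G h)" unfolding gradx_def[abs_def]
    by (intro C1sq_divide C1sq_diff C1sq_mult(1) C1_parts h regular)
  show "C1sq (grady G h)" unfolding grady_def[abs_def]
    by (intro C1sq_divide C1sq_diff C1sq_mult(1) C1_parts h regular)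
qed

lemma continuous_grad:
  assumes "C1sq h"
  shows "continuous_on unit_sq (gradx G h)" "continuous_on unit_sq (grady G h)"
  using assms C1_parts(1,2) regular unfolding gradx_def[abs_def] grady_def[abs_def] C1sq_def
  by (auto intro!: continuous_intros)

lemma continuous_G: "continuous_on unit_sq G"
  using continuous_on_Pair[OF C1sq_continuous[OF C1_parts(1)] C1sq_continuous[OF C1_parts(2)]] by simp

lemma compact_image: "compact (G ` unit_sq)"
  using compact_continuous_image[OF continuous_G] by (simp add: compact_Times)

lemma closed_image: "closed (G ` unit_sq)"
  using compact_image by (rule compact_imp_closed)

lemma inverse_continuous: "continuous_on (G ` unit_sq) (the_inv_into unit_sq G)"
  by (rule continuous_on_inv_into[OF continuous_G _ inj]) (simp add: compact_Times)

lemma pushforward_continuous: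
  assumes "continuous_on unit_sq h" "\<And>z. z \<in> unit_sq \<Longrightarrow> \<phi> (G z) = h z"
  shows "continuous_on (G ` unit_sq) \<phi>"
proof -
  have "continuous_on (G ` unit_sq) (\<lambda>x. h (the_inv_into unit_sq G x))"
    by (rule continuous_on_compose2[OF assms(1) inverse_continuous])
      (simp add: the_inv_into_onto[OF inj])
  then show ?thesis
    using assms(2) by (subst continuous_on_cong[OF refl]) (auto simp: the_inv_into_f_f[OF inj])
qed

text \<open>The inverse of \<open>G\<close> is continuous by compactness, and the derivative of
  \<open>G\<close> is invertible; hence the inverse is differentiable within the image of the
  square, at boundary points too, and the chain rule applies.\<close>

lemma pushforward_derivative:
  assumes h: "C1sq h" and \<phi>: "\<And>z. z \<in> unit_sq \<Longrightarrow> \<phi> (G z) = h z" and z: "z \<in> unit_sq"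
  shows "(\<phi> has_derivative (\<lambda>w. gradx G h z * fst w + grady G h z * snd w)) (at (G z) within G ` unit_sq)"
proof -
  let ?J = "Du X z * Dv Y z - Dv X z * Du Y z"
  let ?H = "the_inv_into unit_sq G"
  let ?G' = "\<lambda>w. (Du X z * fst w + Dv X z * snd w, Du Y z * fst w + Dv Y z * snd w)"
  \<comment> \<open>The inverse of the Jacobian matrix, as adjugate divided by determinant.\<close>
  let ?H' = "\<lambda>w. ((Dv Y z * fst w - Dv X z * snd w) / ?J, (Du X z * snd w - Du Y z * fst w) / ?J)"
  have J: "?J \<noteq> 0" using regular[OF z] .
  have inv: "?H (G x) = x" if "x \<in> unit_sq" for x by (rule the_inv_into_f_f[OF inj that])
  have "(G has_derivative ?G') (at z within unit_sq)"
    using has_derivative_Pair[OF C1sq_derivative[OF C1_parts(1) z] C1sq_derivative[OF C1_parts(2) z]] by simp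
  moreover have "continuous (at (G z) within G ` unit_sq) ?H"
    using inverse_continuous z by (auto simp: continuous_on_eq_continuous_within)
  moreover have "linear ?H'"
    by (rule linearI) (auto simp: algebra_simps add_divide_distrib diff_divide_distrib)
  moreover have "?H' \<circ> ?G' = id"
  proof
    fix w :: "real \<times> real"
    have e: "Dv Y z * (Du X z * fst w + Dv X z * snd w) - Dv X z * (Du Y z * fst w + Dv Y z * snd w) = ?J * fst w"
      "Du X z * (Du Y z * fst w + Dv Y z * snd w) - Du Y z * (Du X z * fst w + Dv X z * snd w) = ?J * snd w"
      by (simp_all add: algebra_simps)
    show "(?H' \<circ> ?G') w = id w"
      unfolding o_apply fst_conv snd_conv e nonzero_mult_div_cancel_left[OF J] by simp
  qed
  ultimately have "(?H has_derivative ?H') (at (G z) within G ` unit_sq)"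
    by (rule has_derivative_inverse_within[OF _ _ z]) (rule inv)
  moreover have "?H ` G ` unit_sq = unit_sq" by (rule the_inv_into_onto[OF inj])
  then have "(h has_derivative (\<lambda>w. Du h z * fst w + Dv h z * snd w)) (at (?H (G z)) within ?H ` G ` unit_sq)"
    using C1sq_derivative[OF h z] inv[OF z] by simp
  ultimately have "((\<lambda>x. h (?H x)) has_derivative (\<lambda>w. Du h z * fst (?H' w) + Dv h z * snd (?H' w)))
      (at (G z) within G ` unit_sq)"
    by (rule has_derivative_in_compose)
  then have d: "(\<phi> has_derivative (\<lambda>w. Du h z * fst (?H' w) + Dv h z * snd (?H' w))) (at (G z) within G ` unit_sq)"
    by (rule has_derivative_transform[rotated 2]) (use z \<phi> inv in auto)
  have e: "Du h z * fst (?H' w) + Dv h z * snd (?H' w) = gradx G h z * fst w + grady G h z * snd w" for w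
    by (simp add: gradx_def grady_def add_divide_distrib[symmetric] algebra_simps)
  show ?thesis by (rule has_derivative_eq_rhs[OF d ext[OF e]])
qed

text \<open>Differentiating the first chain rule identity in v and the second in u gives equal mixed
  derivatives. After cancellation the difference of the two mixed second derivatives, times the
  Jacobian determinant, is zero.\<close>

lemma hessian_symmetric:
  assumes h: "C2sq h" and z: "z \<in> unit_sq"
  shows "grady G (gradx G h) z = gradx G (grady G h) z"
proof -
  let ?p = "gradx G h" and ?q = "grady G h"
  note C = C1_parts C1sq_grad[OF h]
  have "Dv (\<lambda>z. ?p z * Du X z + ?q z * Du Y z) z = Dv (Du h) z"
    by (rule Dv_cong[OF chain_rule(1) z])
  moreover have "Du (\<lambda>z. ?p z * Dv X z + ?q z * Dv Y z) z = Du (Dv h) z"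
    by (rule Du_cong[OF chain_rule(2) z])
  moreover have "Dv (Du h) z = Du (Dv h) z" "Dv (Du X) z = Du (Dv X) z" "Dv (Du Y) z = Du (Dv Y) z"
    using h C2_fst C2_snd z by (auto simp: C2sq_def)
  ultimately have "Dv ?p z * Du X z + Dv ?q z * Du Y z = Du ?p z * Dv X z + Du ?q z * Dv Y z"
    using z by (simp add: C1sq_add C1sq_mult C)
  then have "(gradx G ?p z * Dv X z + grady G ?p z * Dv Y z) * Du X z +
      (gradx G ?q z * Dv X z + grady G ?q z * Dv Y z) * Du Y z =
      (gradx G ?p z * Du X z + grady G ?p z * Du Y z) * Dv X z +
      (gradx G ?q z * Du X z + grady G ?q z * Du Y z) * Dv Y z"
    by (simp add: chain_rule[OF z])
  then have "(grady G ?p z - gradx G ?q z) * (Du X z * Dv Y z - Dv X z * Du Y z) = 0"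
    by (simp add: algebra_simps)
  then show ?thesis using regular[OF z] by simp
qed

end

subsection \<open>Gluing two patches\<close>

lemma C2_up_to_boundaryI:
  fixes A :: "(real \<times> real) set"
  assumes "\<And>x. x \<in> A \<Longrightarrow> (f has_derivative (\<lambda>w. fx x * fst w + fy x * snd w)) (at x within A)"
    and "\<And>x. x \<in> A \<Longrightarrow> (fx has_derivative (\<lambda>w. fxx x * fst w + fxy x * snd w)) (at x within A)"
    and "\<And>x. x \<in> A \<Longrightarrow> (fy has_derivative (\<lambda>w. fyx x * fst w + fyy x * snd w)) (at x within A)"
    and "continuous_on A fxx" "continuous_on A fxy" "continuous_on A fyx" "continuous_on A fyy"
  shows "C2_up_to_boundary A f"
proof -
  define e1 e2 :: "(real \<times> real) \<Rightarrow>\<^sub>L real" where "e1 = Blinfun fst" and "e2 = Blinfun snd"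
  have e: "blinfun_apply e1 = fst" "blinfun_apply e2 = snd"
    by (simp_all add: e1_def e2_def bounded_linear_Blinfun_apply bounded_linear_fst bounded_linear_snd)
  \<comment> \<open>\<open>lift a b\<close> is the rank one map that sends \<open>w\<close> to
    \<open>a w\<close> times \<open>b\<close>. With these as constant basis elements, continuity of
    the second derivative is continuity of its four scalar coefficients.\<close>
  define lift :: "((real \<times> real) \<Rightarrow>\<^sub>L real) \<Rightarrow> ((real \<times> real) \<Rightarrow>\<^sub>L real) \<Rightarrow> ((real \<times> real) \<Rightarrow>\<^sub>L ((real \<times> real) \<Rightarrow>\<^sub>L real))"
    where "lift a b = Blinfun (\<lambda>w. blinfun_apply a w *\<^sub>R b)" for a b
  have lift: "blinfun_apply (lift a b) w = blinfun_apply a w *\<^sub>R b" for a b w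
    unfolding lift_def
    by (subst bounded_linear_Blinfun_apply) (auto intro!: bounded_linear_scaleR_left[THEN bounded_linear_compose] blinfun.bounded_linear_right)
  define D where "D x = fx x *\<^sub>R e1 + fy x *\<^sub>R e2" for x
  define DD where "DD x = fxx x *\<^sub>R lift e1 e1 + fxy x *\<^sub>R lift e2 e1 + fyx x *\<^sub>R lift e1 e2 + fyy x *\<^sub>R lift e2 e2" for x
  have cont: "continuous_on A f" "continuous_on A fx" "continuous_on A fy"
    unfolding continuous_on_eq_continuous_within using assms(1-3) has_derivative_continuous by blast+
  have "continuous_on A D" "continuous_on A DD"
    unfolding D_def DD_def using cont assms(4-7) by (auto intro!: continuous_intros)
  moreover have "(f has_derivative blinfun_apply (D x)) (at x)" if "x \<in> interior A" for x
  proof -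
    have "(f has_derivative (\<lambda>w. fx x * fst w + fy x * snd w)) (at x)"
      using assms(1)[of x] that interior_subset at_within_interior[OF that] by auto
    then show ?thesis
      by (rule has_derivative_eq_rhs) (auto simp: D_def blinfun.add_left blinfun.scaleR_left e)
  qed
  moreover have "(D has_derivative blinfun_apply (DD x)) (at x)" if x: "x \<in> interior A" for x
  proof -
    have "(fx has_derivative (\<lambda>w. fxx x * fst w + fxy x * snd w)) (at x)"
      "(fy has_derivative (\<lambda>w. fyx x * fst w + fyy x * snd w)) (at x)"
      using assms(2,3)[of x] x interior_subset at_within_interior[OF x] by auto
    then have "(D has_derivative (\<lambda>w. (fxx x * fst w + fxy x * snd w) *\<^sub>R e1 + (fyx x * fst w + fyy x * snd w) *\<^sub>R e2)) (at x)"
      unfolding D_def by (intro has_derivative_add has_derivative_scaleR_left)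
    then show ?thesis
      by (rule has_derivative_eq_rhs)
        (auto simp: DD_def blinfun.add_left blinfun.scaleR_left lift e scaleR_left_distrib)
  qed
  ultimately show ?thesis unfolding C2_up_to_boundary_def using cont(1) by blast
qed

lemma determined_by_cong:
  "(\<And>S z. z \<in> unit_sq \<Longrightarrow> h S z = h' S z) \<Longrightarrow> determined_by F h \<phi> \<longleftrightarrow> determined_by F h' \<phi>"
  by (simp add: determined_by_def)

lemma determined_by_linear_combination:
  assumes "\<And>i. i \<in> I \<Longrightarrow> determined_by F (h i) (\<phi> i)"
  shows "determined_by F (\<lambda>S z. \<Sum>i\<in>I. c i * h i S z) (\<Sum>i\<in>I. c i *\<^sub>R \<phi> i)"
proof -
  have "\<phi> i x = 0" if "i \<in> I" "x \<notin> Omega F" for i x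
  proof -
    have "\<phi> i x = zero_ext (Omega F) (\<phi> i) x" using assms[OF that(1)] by (simp add: determined_by_def)
    then show ?thesis using that(2) by (simp add: zero_ext_def)
  qed
  then have "zero_ext (Omega F) (\<Sum>i\<in>I. c i *\<^sub>R \<phi> i) = (\<Sum>i\<in>I. c i *\<^sub>R \<phi> i)"
    by (auto simp: zero_ext_def fun_eq_iff fun_sum_scaleR_apply intro!: sum.neutral[symmetric])
  moreover have "(\<Sum>i\<in>I. c i *\<^sub>R \<phi> i) (F S z) = (\<Sum>i\<in>I. c i * h i S z)" if "z \<in> unit_sq" for S z
    unfolding fun_sum_scaleR_apply using assms that by (intro sum.cong) (auto simp: determined_by_def)
  ultimately show ?thesis unfolding determined_by_def by blast
qed

locale glued_patches =
  fixes F :: "patch \<Rightarrow> real \<times> real \<Rightarrow> real \<times> real"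
  assumes patch: "C2_patch (F S)"
    and edge: "v \<in> {0..1} \<Longrightarrow> F Lft (0, v) = F Rgt (0, v)"
    and overlap: "F Lft ` unit_sq \<inter> F Rgt ` unit_sq = (\<lambda>v. F Lft (0, v)) ` {0..1}"
begin

text \<open>The overlap is given only as a set of points; injectivity of both patches shows that a
  common point has the same edge parameter in each of them.\<close>

lemma overlap_on_edge:
  assumes "z \<in> unit_sq" "z' \<in> unit_sq" "F Lft z = F Rgt z'"
  obtains v where "v \<in> {0..1}" "z = (0, v)" "z' = (0, v)"
proof -
  have "F Lft z \<in> (\<lambda>v. F Lft (0, v)) ` {0..1}" using assms overlap by blast
  then obtain v where v: "v \<in> {0..1}" "F Lft z = F Lft (0, v)" by blast
  then have "z = (0, v)" "z' = (0, v)"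
    using assms edge[OF v(1)] inj_onD[OF C2_patch.inj[OF patch], of Lft z "(0, v)"]
      inj_onD[OF C2_patch.inj[OF patch], of Rgt z' "(0, v)"] by auto
  then show thesis using that v by blast
qed

lemma determined_by_ex1:
  assumes "\<And>v. v \<in> {0..1} \<Longrightarrow> h Lft (0, v) = h Rgt (0, v)"
  shows "\<exists>!\<phi>. determined_by F h \<phi>"
proof (rule ex_ex1I)
  define \<phi> where "\<phi> x = (if x \<in> F Lft ` unit_sq then h Lft (the_inv_into unit_sq (F Lft) x)
    else if x \<in> F Rgt ` unit_sq then h Rgt (the_inv_into unit_sq (F Rgt) x) else 0)" for x
  have inv: "the_inv_into unit_sq (F S) (F S z) = z" if "z \<in> unit_sq" for S z
    by (rule the_inv_into_f_f[OF C2_patch.inj[OF patch] that])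
  have L: "\<phi> (F Lft z) = h Lft z" if "z \<in> unit_sq" for z
    using that inv by (simp add: \<phi>_def)
  have R: "\<phi> (F Rgt z) = h Rgt z" if z: "z \<in> unit_sq" for z
  proof (cases "F Rgt z \<in> F Lft ` unit_sq")
    case True
    then obtain z' where z': "z' \<in> unit_sq" "F Lft z' = F Rgt z" by force
    then obtain v where "v \<in> {0..1}" "z' = (0, v)" "z = (0, v)" using overlap_on_edge z by metis
    then show ?thesis using L[OF z'(1)] z' assms by simp
  next
    case False
    then show ?thesis using inv[OF z] z by (simp add: \<phi>_def)
  qed
  have "\<forall>S. \<forall>z\<in>unit_sq. \<phi> (F S z) = h S z"
  proof
    fix S show "\<forall>z\<in>unit_sq. \<phi> (F S z) = h S z" using L R by (cases S) auto
  qed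
  moreover have "zero_ext (Omega F) \<phi> = \<phi>" by (auto simp: zero_ext_def Omega_def \<phi>_def)
  ultimately show "\<exists>\<phi>. determined_by F h \<phi>" unfolding determined_by_def by blast
next
  fix \<phi> \<psi> assume \<phi>: "determined_by F h \<phi>" and \<psi>: "determined_by F h \<psi>"
  show "\<phi> = \<psi>"
  proof
    fix x
    show "\<phi> x = \<psi> x"
    proof (cases "x \<in> Omega F")
      case True
      then obtain S z where "z \<in> unit_sq" "x = F S z" by (auto simp: Omega_def)
      then show ?thesis using \<phi> \<psi> by (auto simp: determined_by_def)
    next
      case False
      then have "\<phi> x = zero_ext (Omega F) \<phi> x" "\<psi> x = zero_ext (Omega F) \<psi> x"
        using \<phi> \<psi> by (simp_all add: determined_by_def)
      then show ?thesis using False by (simp add: zero_ext_def)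
    qed
  qed
qed

lemma determined_by_continuous:
  assumes "determined_by F h \<phi>" "\<And>S. continuous_on unit_sq (h S)"
  shows "continuous_on (Omega F) \<phi>"
  unfolding Omega_def
  by (intro continuous_on_closed_Un C2_patch.closed_image[OF patch]
      C2_patch.pushforward_continuous[OF patch assms(2)])
    (use assms(1) in \<open>auto simp: determined_by_def\<close>)

text \<open>The filter at \<open>x\<close> within a union is the supremum of the filters within its
  parts, so it suffices that both patches give the same linear map as derivative; this is where the
  common functions \<open>\<phi>x\<close> and \<open>\<phi>y\<close> are used.\<close>

lemma determined_by_derivative:
  assumes \<phi>: "determined_by F h \<phi>" and h: "\<And>S. C1sq (h S)"
    and \<phi>x: "determined_by F (\<lambda>S. gradx (F S) (h S)) \<phi>x" and \<phi>y: "determined_by F (\<lambda>S. grady (F S) (h S)) \<phi>y"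
  shows "(\<phi> has_derivative (\<lambda>w. \<phi>x x * fst w + \<phi>y x * snd w)) (at x within Omega F)"
proof -
  have lin: "bounded_linear (\<lambda>w::real \<times> real. a * fst w + b * snd w)" for a b
    by (intro bounded_linear_add bounded_linear_const_mult bounded_linear_fst bounded_linear_snd)
  have 1: "(\<phi> has_derivative (\<lambda>w. \<phi>x x * fst w + \<phi>y x * snd w)) (at x within F S ` unit_sq)" for S
  proof (cases "x \<in> F S ` unit_sq")
    case True
    then obtain z where z: "z \<in> unit_sq" "x = F S z" by blast
    have "\<phi>x x = gradx (F S) (h S) z" "\<phi>y x = grady (F S) (h S) z"
      using \<phi>x \<phi>y z by (auto simp: determined_by_def)
    moreover have "\<phi> (F S z) = h S z" if "z \<in> unit_sq" for z
      using \<phi> that unfolding determined_by_def by blast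
    ultimately show ?thesis
      using C2_patch.pushforward_derivative[OF patch h _ z(1), of \<phi> S] z(2) by simp
  next
    case False
    \<comment> \<open>The patch image is closed, so its filter at a point outside is trivial and
      every bounded linear map is a derivative there.\<close>
    then have "at x within F S ` unit_sq = bot"
      using not_in_closure_trivial_limitI[of x "F S ` unit_sq"] C2_patch.closed_image[OF patch, of S]
      by (simp add: trivial_limit_def closure_closed)
    then show ?thesis unfolding has_derivative_at_within using lin by simp
  qed
  show ?thesis
    using 1[of Lft] 1[of Rgt] lin unfolding Omega_def unfolding has_derivative_at_within unfolding at_within_union
    by (auto intro: filterlim_sup)
qed

text \<open>Agreement on the edge makes each partial derivative a well-defined function on the
  union. The gradient components are then themselves determined by C^1 functions on the patches, so
  the first order gluing is applied to them again.\<close>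

lemma determined_by_C2:
  assumes \<phi>: "determined_by F h \<phi>" and h: "\<And>S. C2sq (h S)"
    and grad: "\<And>v D. v \<in> {0..1} \<Longrightarrow> D \<in> {gradx, grady} \<Longrightarrow> D (F Lft) (h Lft) (0, v) = D (F Rgt) (h Rgt) (0, v)"
    and hess: "\<And>v D D'. v \<in> {0..1} \<Longrightarrow> D \<in> {gradx, grady} \<Longrightarrow> D' \<in> {gradx, grady} \<Longrightarrow>
      D' (F Lft) (D (F Lft) (h Lft)) (0, v) = D' (F Rgt) (D (F Rgt) (h Rgt)) (0, v)"
  shows "C2_up_to_boundary (Omega F) \<phi>"
proof -
  have 1: "\<exists>\<psi>. determined_by F (\<lambda>S. D (F S) (h S)) \<psi>" if "D \<in> {gradx, grady}" for D
    using determined_by_ex1[of "\<lambda>S. D (F S) (h S)"] grad[OF _ that] by blast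
  have 2: "\<exists>\<psi>. determined_by F (\<lambda>S. D' (F S) (D (F S) (h S))) \<psi>"
    if "D \<in> {gradx, grady}" "D' \<in> {gradx, grady}" for D D'
    using determined_by_ex1[of "\<lambda>S. D' (F S) (D (F S) (h S))"] hess[OF _ that] by blast
  obtain fx where fx: "determined_by F (\<lambda>S. gradx (F S) (h S)) fx" using 1[of gradx] by auto
  obtain fy where fy: "determined_by F (\<lambda>S. grady (F S) (h S)) fy" using 1[of grady] by auto
  obtain fxx where fxx: "determined_by F (\<lambda>S. gradx (F S) (gradx (F S) (h S))) fxx" using 2[of gradx gradx] by auto
  obtain fxy where fxy: "determined_by F (\<lambda>S. grady (F S) (gradx (F S) (h S))) fxy" using 2[of gradx grady] by auto
  obtain fyx where fyx: "determined_by F (\<lambda>S. gradx (F S) (grady (F S) (h S))) fyx" using 2[of grady gradx] by auto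
  obtain fyy where fyy: "determined_by F (\<lambda>S. grady (F S) (grady (F S) (h S))) fyy" using 2[of grady grady] by auto
  have h1: "C1sq (h S)" "C1sq (gradx (F S) (h S))" "C1sq (grady (F S) (h S))" for S
    using h C2_patch.C1sq_grad[OF patch h] by (auto simp: C2sq_def)
  show ?thesis
    by (rule C2_up_to_boundaryI[of _ _ fx fy fxx fxy fyx fyy])
      (auto intro!: determined_by_derivative[OF \<phi> h1(1) fx fy] determined_by_derivative[OF fx h1(2) fxx fxy]
        determined_by_derivative[OF fy h1(3) fyx fyy] determined_by_continuous[OF fxx] determined_by_continuous[OF fxy]
        determined_by_continuous[OF fyx] determined_by_continuous[OF fyy] C2_patch.continuous_grad[OF patch] h1)
qed

end

subsection \<open>First and second order data along the common edge\<close>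

text \<open>The vectors \<open>(x S, y S)\<close> are the derivatives of the two patches across the edge. The first order
  condition says that they have the form \<open>a\<^sub>S \<xi> + b\<^sub>S t\<close> with a common vector \<open>\<xi>\<close> and the
  edge tangent \<open>t\<close>; a gradient is determined by its products with \<open>\<xi>\<close> and \<open>t\<close>.\<close>

lemma edge_gradient_eq:
  fixes a b x y p q :: "patch \<Rightarrow> real"
  assumes a0: "a Lft \<noteq> 0" "a Rgt \<noteq> 0"
    and x: "\<And>S. x S = a S * \<xi>1 + b S * t1" and y: "\<And>S. y S = a S * \<xi>2 + b S * t2"
    and det: "\<xi>1 * t2 - \<xi>2 * t1 \<noteq> 0"
    and u: "\<And>S. p S * x S + q S * y S = a S * g1 + b S * g0'"
    and v: "\<And>S. p S * t1 + q S * t2 = g0'"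
  shows "p Lft = p Rgt" "q Lft = q Rgt"
proof -
  \<comment> \<open>Subtracting \<open>b S\<close> times the tangential equation leaves a multiple
    of \<open>a S\<close>; the resulting value \<open>g1\<close> does not depend on the
    patch.\<close>
  have 1: "p S * \<xi>1 + q S * \<xi>2 = g1" for S
  proof -
    have "a S * (p S * \<xi>1 + q S * \<xi>2 - g1) = 0"
      using u[of S] v[of S] x[of S] y[of S] by algebra
    then show ?thesis using a0 by (cases S) auto
  qed
  have "p S * (\<xi>1 * t2 - \<xi>2 * t1) = g1 * t2 - g0' * \<xi>2" for S
    unfolding 1[of S, symmetric] v[of S, symmetric] by (simp add: algebra_simps)
  moreover have "q S * (\<xi>1 * t2 - \<xi>2 * t1) = g0' * \<xi>1 - g1 * t1" for S
    unfolding 1[of S, symmetric] v[of S, symmetric] by (simp add: algebra_simps)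
  ultimately show "p Lft = p Rgt" "q Lft = q Rgt" using det by (metis mult_right_cancel)+
qed

text \<open>The Hessians agree on \<open>t\<close>, since the gradients agree along the edge. By symmetry it remains to
  compare the values at \<open>(\<xi>, \<xi>)\<close>, which is what the second order condition provides.\<close>

lemma edge_hessian_eq:
  fixes a b x y A hxx hxy hyy :: "patch \<Rightarrow> real"
  assumes a0: "a Lft \<noteq> 0" "a Rgt \<noteq> 0"
    and x: "\<And>S. x S = a S * \<xi>1 + b S * t1" and y: "\<And>S. y S = a S * \<xi>2 + b S * t2"
    and det: "\<xi>1 * t2 - \<xi>2 * t1 \<noteq> 0"
    and pv: "\<And>S. hxx S * t1 + hxy S * t2 = pv" and qv: "\<And>S. hxy S * t1 + hyy S * t2 = qv"
    and uu: "\<And>S. (hxx S * x S + hxy S * y S) * x S + (hxy S * x S + hyy S * y S) * y S + A S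
      = (b S)\<^sup>2 * g0'' + 2 * a S * b S * g1' + (a S)\<^sup>2 * g2"
    and uv: "pv * x Lft + qv * y Lft + B = da * g1 + a Lft * g1' + db * g0' + b Lft * g0''"
    and vv: "pv * t1 + qv * t2 + C = g0''"
    and \<beta>: "\<beta> = a Lft * b Rgt - a Rgt * b Lft"
    and G2: "a Lft * ((a Lft)\<^sup>2 * A Rgt - ((a Rgt)\<^sup>2 * A Lft + 2 * a Rgt * \<beta> * B + \<beta>\<^sup>2 * C))
      + 2 * da * a Rgt * \<beta> * (a Lft * g1 + b Lft * g0') + 2 * (a Lft * db - da * b Lft) * a Rgt * \<beta> * g0' = 0"
  shows "hxx Lft = hxx Rgt" "hxy Lft = hxy Rgt" "hyy Lft = hyy Rgt"
proof -
  \<comment> \<open>Since \<open>g1\<close> is the gradient applied to \<open>\<xi>\<close>, the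
    product rule identifies \<open>m\<close> with the gradient applied to the derivative of
    \<open>\<xi>\<close> along the edge. \<open>E S\<close> is the Hessian at \<open>\<xi>\<close>
    twice.\<close>
  define m where "m = g1' - (pv * \<xi>1 + qv * \<xi>2)"
  define E where "E S = hxx S * \<xi>1\<^sup>2 + 2 * hxy S * \<xi>1 * \<xi>2 + hyy S * \<xi>2\<^sup>2" for S
  \<comment> \<open>\<open>B\<close> is the gradient applied to the derivative of
    \<open>a \<xi> + b t\<close> along the edge, so the product rule isolates
    \<open>m\<close>.\<close>
  have 1: "a Lft * m = B - da * g1 - db * g0' - b Lft * C"
    using uv vv x[of Lft] y[of Lft] unfolding m_def by algebra
  \<comment> \<open>The Hessian is expanded at \<open>a \<xi> + b t\<close>. Its values at
    \<open>(\<xi>, t)\<close> and \<open>(t, t)\<close> are \<open>g1' - m\<close> and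
    \<open>g0'' - C\<close>, so \<open>E S\<close> is the only unknown.\<close>
  have 2: "(a S)\<^sup>2 * E S = (a S)\<^sup>2 * g2 + 2 * a S * b S * m + (b S)\<^sup>2 * C - A S" for S
    using uu[of S] vv x[of S] y[of S] pv[of S] qv[of S] unfolding m_def E_def by algebra
  \<comment> \<open>Substituting \<open>B\<close> makes the derivatives \<open>da\<close> and
    \<open>db\<close> cancel against the two correction terms of \<open>G2\<close>; a factor
    \<open>a Lft\<close> remains and is divided out next.\<close>
  have "a Lft * ((a Lft)\<^sup>2 * A Rgt - (a Rgt)\<^sup>2 * A Lft - 2 * a Rgt * \<beta> * (a Lft * m + b Lft * C) - \<beta>\<^sup>2 * C) = 0"
    using 1 G2 by algebra
  then have 3: "(a Lft)\<^sup>2 * A Rgt - (a Rgt)\<^sup>2 * A Lft = 2 * a Rgt * \<beta> * (a Lft * m + b Lft * C) + \<beta>\<^sup>2 * C"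
    using a0(1) by simp
  have "(a Lft * a Rgt)\<^sup>2 * (E Rgt - E Lft) = 0"
    using 2[of Lft] 2[of Rgt] 3 \<beta> by algebra
  then have E: "E Lft = E Rgt" using a0 by simp
  have d1: "(hxx Lft - hxx Rgt) * t1 + (hxy Lft - hxy Rgt) * t2 = 0"
    using pv[of Lft] pv[of Rgt] by (simp add: left_diff_distrib)
  have d2: "(hxy Lft - hxy Rgt) * t1 + (hyy Lft - hyy Rgt) * t2 = 0"
    using qv[of Lft] qv[of Rgt] by (simp add: left_diff_distrib)
  have e: "(hxx Lft - hxx Rgt) * \<xi>1\<^sup>2 + 2 * (hxy Lft - hxy Rgt) * \<xi>1 * \<xi>2 + (hyy Lft - hyy Rgt) * \<xi>2\<^sup>2 = 0"
    using E unfolding E_def by algebra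
  \<comment> \<open>A symmetric matrix that annihilates \<open>t\<close> is a multiple of the square
    of the covector orthogonal to \<open>t\<close>; its value at \<open>(\<xi>, \<xi>)\<close> is
    that multiple times the squared determinant.\<close>
  have "(hxx Lft - hxx Rgt) * (\<xi>1 * t2 - \<xi>2 * t1)\<^sup>2 = 0"
    using d1 d2 e by algebra
  moreover have "(hxy Lft - hxy Rgt) * (\<xi>1 * t2 - \<xi>2 * t1)\<^sup>2 = 0"
    using d1 d2 e by algebra
  moreover have "(hyy Lft - hyy Rgt) * (\<xi>1 * t2 - \<xi>2 * t1)\<^sup>2 = 0"
    using d1 d2 e by algebra
  ultimately show "hxx Lft = hxx Rgt" "hxy Lft = hxy Rgt" "hyy Lft = hyy Rgt" using det by auto
qed

text \<open>The second order condition on the parameterization is an identity of vectors. Pairing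
  both components with the gradient \<open>(p, q)\<close> gives the scalar relation that
  \<open>edge_hessian_eq\<close> expects.\<close>

lemma G2_functional:
  fixes p q :: real
  assumes "c * (c\<^sup>2 * x1 - (c'\<^sup>2 * x2 + 2 * c' * b * x3 + b\<^sup>2 * x4)) + \<eta> * x5 + \<theta> * x6 = 0"
    and "c * (c\<^sup>2 * y1 - (c'\<^sup>2 * y2 + 2 * c' * b * y3 + b\<^sup>2 * y4)) + \<eta> * y5 + \<theta> * y6 = 0"
    and "p * x5 + q * y5 = s" "p * x6 + q * y6 = t"
  shows "c * (c\<^sup>2 * (p * x1 + q * y1) - (c'\<^sup>2 * (p * x2 + q * y2) + 2 * c' * b * (p * x3 + q * y3)
    + b\<^sup>2 * (p * x4 + q * y4))) + \<eta> * s + \<theta> * t = 0"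
  using assms by algebra

lemma Du_Pair:
  assumes "C1sq f" "C1sq g" "z \<in> unit_sq"
  shows "Du (\<lambda>z. (f z, g z)) z = (Du f z, Du g z)" "Dv (\<lambda>z. (f z, g z)) z = (Dv f z, Dv g z)"
proof -
  obtain u v where z: "z = (u, v)" by (cases z)
  have f: "((\<lambda>s. f (s, v)) has_real_derivative Du f z) (at u within {0..1})"
      "((\<lambda>t. f (u, t)) has_real_derivative Dv f z) (at v within {0..1})"
    using slice_derivatives[OF C1sq_derivative[OF assms(1), of "(u, v)"]] assms(3) z by auto
  have g: "((\<lambda>s. g (s, v)) has_real_derivative Du g z) (at u within {0..1})"
      "((\<lambda>t. g (u, t)) has_real_derivative Dv g z) (at v within {0..1})"
    using slice_derivatives[OF C1sq_derivative[OF assms(2), of "(u, v)"]] assms(3) z by auto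
  show "Du (\<lambda>z. (f z, g z)) z = (Du f z, Du g z)"
    using D1_eqI[OF has_vector_derivative_Pair[OF f(1)[unfolded has_real_derivative_iff_has_vector_derivative]
          g(1)[unfolded has_real_derivative_iff_has_vector_derivative]]] assms(3) by (simp add: z Du_def)
  show "Dv (\<lambda>z. (f z, g z)) z = (Dv f z, Dv g z)"
    using D1_eqI[OF has_vector_derivative_Pair[OF f(2)[unfolded has_real_derivative_iff_has_vector_derivative]
          g(2)[unfolded has_real_derivative_iff_has_vector_derivative]]] assms(3) by (simp add: z Dv_def)
qed

context C2_patch
begin

lemma vector_derivatives:
  assumes z: "z \<in> unit_sq"
  shows "Du G z = (Du X z, Du Y z)" "Dv G z = (Dv X z, Dv Y z)"
    and "Du (Du G) z = (Du (Du X) z, Du (Du Y) z)" "Dv (Du G) z = (Dv (Du X) z, Dv (Du Y) z)"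
    and "Dv (Dv G) z = (Dv (Dv X) z, Dv (Dv Y) z)"
proof -
  have G: "G = (\<lambda>z. (X z, Y z))" by simp
  have u: "Du G z = (Du X z, Du Y z)" and v: "Dv G z = (Dv X z, Dv Y z)" if "z \<in> unit_sq" for z
    using Du_Pair[OF C1_parts(1,2) that] by (subst G; simp)+
  show "Du G z = (Du X z, Du Y z)" "Dv G z = (Dv X z, Dv Y z)" using u[OF z] v[OF z] .
  show "Du (Du G) z = (Du (Du X) z, Du (Du Y) z)"
    using Du_cong[OF u z] Du_Pair[OF C1_parts(3,4) z] by simp
  show "Dv (Du G) z = (Dv (Du X) z, Dv (Du Y) z)"
    using Dv_cong[OF u z] Du_Pair[OF C1_parts(3,4) z] by simp
  show "Dv (Dv G) z = (Dv (Dv X) z, Dv (Dv Y) z)"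
    using Dv_cong[OF v z] Du_Pair[OF C1_parts(5,6) z] by simp
qed

text \<open>The chain rule holds on the whole closed square and can therefore be differentiated once
  more, with one-sided derivatives on the boundary.\<close>

lemma chain_rule_second_order:
  assumes h: "C2sq h" and z: "z \<in> unit_sq"
  defines "p \<equiv> gradx G h" and "q \<equiv> grady G h"
  shows "Du p z * Du X z + p z * Du (Du X) z + Du q z * Du Y z + q z * Du (Du Y) z = Du (Du h) z"
    and "Dv p z * Du X z + p z * Dv (Du X) z + Dv q z * Du Y z + q z * Dv (Du Y) z = Dv (Du h) z"
    and "Dv p z * Dv X z + p z * Dv (Dv X) z + Dv q z * Dv Y z + q z * Dv (Dv Y) z = Dv (Dv h) z"
proof -
  note C = C1_parts C1sq_grad[OF h]
  have "Du (\<lambda>z. p z * Du X z + q z * Du Y z) z = Du (Du h) z"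
    unfolding p_def q_def by (rule Du_cong[OF chain_rule(1) z])
  then show "Du p z * Du X z + p z * Du (Du X) z + Du q z * Du Y z + q z * Du (Du Y) z = Du (Du h) z"
    using z unfolding p_def q_def by (simp add: C1sq_add C1sq_mult C)
  have "Dv (\<lambda>z. p z * Du X z + q z * Du Y z) z = Dv (Du h) z"
    unfolding p_def q_def by (rule Dv_cong[OF chain_rule(1) z])
  then show "Dv p z * Du X z + p z * Dv (Du X) z + Dv q z * Du Y z + q z * Dv (Du Y) z = Dv (Du h) z"
    using z unfolding p_def q_def by (simp add: C1sq_add C1sq_mult C)
  have "Dv (\<lambda>z. p z * Dv X z + q z * Dv Y z) z = Dv (Dv h) z"
    unfolding p_def q_def by (rule Dv_cong[OF chain_rule(2) z])
  then show "Dv p z * Dv X z + p z * Dv (Dv X) z + Dv q z * Dv Y z + q z * Dv (Dv Y) z = Dv (Dv h) z"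
    using z unfolding p_def q_def by (simp add: C1sq_add C1sq_mult C)
qed

end

text \<open>A derivative along the edge uses values on the edge alone; in this way agreement of the
  gradients on the edge passes to their tangential derivatives.\<close>

lemma Dv_edge_cong:
  assumes "\<And>v. v \<in> {0..1} \<Longrightarrow> f (u, v) = g (u, v)" "v \<in> {0..1}"
  shows "Dv f (u, v) = Dv g (u, v)"
  using assms by (auto simp: Dv_def intro: D1_cong)

context glued_patches
begin

theorem G2_imp_C2:
  assumes G2: "bilinear_like_G2 F \<alpha> \<beta>"
    and \<phi>: "determined_by F h \<phi>" and h: "\<And>S. C2sq (h S)"
    and u: "\<And>S v. v \<in> {0..1} \<Longrightarrow> Du (h S) (0, v) = poly (\<alpha> S) v * g1 v + poly (\<beta> S) v * g0' v"
    and v: "\<And>S v. v \<in> {0..1} \<Longrightarrow> Dv (h S) (0, v) = g0' v"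
    and uu: "\<And>S v. v \<in> {0..1} \<Longrightarrow> Du (Du (h S)) (0, v) =
      (poly (\<beta> S) v)\<^sup>2 * g0'' v + 2 * poly (\<alpha> S) v * poly (\<beta> S) v * g1' v + (poly (\<alpha> S) v)\<^sup>2 * g2 v"
    and uv: "\<And>S v. v \<in> {0..1} \<Longrightarrow> Dv (Du (h S)) (0, v) = poly (pderiv (\<alpha> S)) v * g1 v +
      poly (\<alpha> S) v * g1' v + poly (pderiv (\<beta> S)) v * g0' v + poly (\<beta> S) v * g0'' v"
    and vv: "\<And>S v. v \<in> {0..1} \<Longrightarrow> Dv (Dv (h S)) (0, v) = g0'' v"
  shows "C2_up_to_boundary (Omega F) \<phi>"
proof -
  let ?X = "\<lambda>S z. fst (F S z)" and ?Y = "\<lambda>S z. snd (F S z)"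
  define p q where "p S = gradx (F S) (h S)" and "q S = grady (F S) (h S)" for S
  have C1: "C1sq (h S)" for S using h by (auto simp: C2sq_def)
  have C1g: "C1sq (p S)" "C1sq (q S)" for S
    using C2_patch.C1sq_grad[OF patch h] by (auto simp: p_def q_def)
  have sq: "(0, w) \<in> unit_sq" if "w \<in> {0..1}" for w :: real using that by auto
  have \<alpha>0: "poly (\<alpha> Lft) w \<noteq> 0" "poly (\<alpha> Rgt) w \<noteq> 0" if "w \<in> {0..1}" for w
    using G2 that unfolding bilinear_like_G2_def by force+
  have t: "Dv (?X S) (0, w) = Dv (?X Lft) (0, w)" "Dv (?Y S) (0, w) = Dv (?Y Lft) (0, w)"
    if w: "w \<in> {0..1}" for S w
    by (cases S; simp; intro Dv_edge_cong; use edge w in simp)+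
  have b: "poly (beta_poly \<alpha> \<beta>) w = poly (\<alpha> Lft) w * poly (\<beta> Rgt) w - poly (\<alpha> Rgt) w * poly (\<beta> Lft) w" for w
    by (simp add: beta_poly_def)
  \<comment> \<open>The transversal vector is obtained by solving the decomposition for the left
    patch; the first order condition then yields the same decomposition for the right patch.\<close>
  define \<xi>1 \<xi>2 where "\<xi>1 w = (Du (?X Lft) (0, w) - poly (\<beta> Lft) w * Dv (?X Lft) (0, w)) / poly (\<alpha> Lft) w"
    and "\<xi>2 w = (Du (?Y Lft) (0, w) - poly (\<beta> Lft) w * Dv (?Y Lft) (0, w)) / poly (\<alpha> Lft) w" for w
  have \<xi>: "Du (?X S) (0, w) = poly (\<alpha> S) w * \<xi>1 w + poly (\<beta> S) w * Dv (?X Lft) (0, w)"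
    "Du (?Y S) (0, w) = poly (\<alpha> S) w * \<xi>2 w + poly (\<beta> S) w * Dv (?Y Lft) (0, w)" if w: "w \<in> {0..1}" for S w
  proof -
    have L: "poly (\<alpha> Lft) w * \<xi>1 w = Du (?X Lft) (0, w) - poly (\<beta> Lft) w * Dv (?X Lft) (0, w)"
      "poly (\<alpha> Lft) w * \<xi>2 w = Du (?Y Lft) (0, w) - poly (\<beta> Lft) w * Dv (?Y Lft) (0, w)"
      using \<alpha>0[OF w] by (simp_all add: \<xi>1_def \<xi>2_def)
    have "poly (\<alpha> Rgt) w *\<^sub>R Du (F Lft) (0, w) - poly (\<alpha> Lft) w *\<^sub>R Du (F Rgt) (0, w)
          + poly (beta_poly \<alpha> \<beta>) w *\<^sub>R Dv (F Lft) (0, w) = 0"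
      using G2 w unfolding bilinear_like_G2_def by blast
    then have R: "poly (\<alpha> Rgt) w * Du (?X Lft) (0, w) - poly (\<alpha> Lft) w * Du (?X Rgt) (0, w)
          + poly (beta_poly \<alpha> \<beta>) w * Dv (?X Lft) (0, w) = 0"
      "poly (\<alpha> Rgt) w * Du (?Y Lft) (0, w) - poly (\<alpha> Lft) w * Du (?Y Rgt) (0, w)
          + poly (beta_poly \<alpha> \<beta>) w * Dv (?Y Lft) (0, w) = 0"
      by (simp_all add: C2_patch.vector_derivatives[OF patch sq[OF w]] zero_prod_def)
    have "poly (\<alpha> Lft) w * (Du (?X Rgt) (0, w) - (poly (\<alpha> Rgt) w * \<xi>1 w + poly (\<beta> Rgt) w * Dv (?X Lft) (0, w))) = 0"
      using L(1) R(1) b[of w] by algebra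
    moreover have "poly (\<alpha> Lft) w * (Du (?Y Rgt) (0, w) - (poly (\<alpha> Rgt) w * \<xi>2 w + poly (\<beta> Rgt) w * Dv (?Y Lft) (0, w))) = 0"
      using L(2) R(2) b[of w] by algebra
    ultimately show "Du (?X S) (0, w) = poly (\<alpha> S) w * \<xi>1 w + poly (\<beta> S) w * Dv (?X Lft) (0, w)"
      "Du (?Y S) (0, w) = poly (\<alpha> S) w * \<xi>2 w + poly (\<beta> S) w * Dv (?Y Lft) (0, w)"
      using L \<alpha>0[OF w] by (cases S; simp)+
  qed
  have det: "\<xi>1 w * Dv (?Y Lft) (0, w) - \<xi>2 w * Dv (?X Lft) (0, w) \<noteq> 0" if w: "w \<in> {0..1}" for w
  proof
    assume "\<xi>1 w * Dv (?Y Lft) (0, w) - \<xi>2 w * Dv (?X Lft) (0, w) = 0"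
    \<comment> \<open>On the edge the Jacobian determinant of the left patch is alpha^L times the
      determinant of \<open>\<xi>\<close> and the tangent.\<close>
    then have "Du (?X Lft) (0, w) * Dv (?Y Lft) (0, w) - Dv (?X Lft) (0, w) * Du (?Y Lft) (0, w) = 0"
      using \<xi>[OF w, of Lft] by algebra
    then show False using C2_patch.regular[OF patch sq[OF w], of Lft] by simp
  qed
  have grad: "p Lft (0, w) = p Rgt (0, w)" "q Lft (0, w) = q Rgt (0, w)" if w: "w \<in> {0..1}" for w
  proof -
    have 1: "p S (0, w) * Du (?X S) (0, w) + q S (0, w) * Du (?Y S) (0, w) = poly (\<alpha> S) w * g1 w + poly (\<beta> S) w * g0' w" for S
      using C2_patch.chain_rule(1)[OF patch sq[OF w], of S "h S"] u[OF w] by (simp add: p_def q_def)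
    have 2: "p S (0, w) * Dv (?X Lft) (0, w) + q S (0, w) * Dv (?Y Lft) (0, w) = g0' w" for S
      using C2_patch.chain_rule(2)[OF patch sq[OF w], of S "h S"] v[OF w] t[OF w, of S] by (simp add: p_def q_def)
    show "p Lft (0, w) = p Rgt (0, w)" "q Lft (0, w) = q Rgt (0, w)"
      using edge_gradient_eq[where a = "\<lambda>S. poly (\<alpha> S) w" and b = "\<lambda>S. poly (\<beta> S) w" and x = "\<lambda>S. Du (?X S) (0, w)"
          and y = "\<lambda>S. Du (?Y S) (0, w)" and p = "\<lambda>S. p S (0, w)" and q = "\<lambda>S. q S (0, w)",
          OF \<alpha>0[OF w] \<xi>[OF w] det[OF w] 1 2] by auto
  qed
  have hess: "gradx (F Lft) (p Lft) (0, w) = gradx (F Rgt) (p Rgt) (0, w)"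
    "grady (F Lft) (p Lft) (0, w) = grady (F Rgt) (p Rgt) (0, w)"
    "grady (F Lft) (q Lft) (0, w) = grady (F Rgt) (q Rgt) (0, w)" if w: "w \<in> {0..1}" for w
  proof -
    let ?z = "(0::real, w)"
    let ?pv = "Dv (p Lft) ?z" and ?qv = "Dv (q Lft) ?z"
    have gp: "p S ?z = p Lft ?z" "q S ?z = q Lft ?z" for S using grad[OF w] by (cases S; simp)+
    have dp: "Dv (p S) ?z = ?pv" "Dv (q S) ?z = ?qv" for S
      by (cases S; simp; intro Dv_edge_cong; use grad w in simp)+
    have sym: "gradx (F S) (q S) ?z = grady (F S) (p S) ?z" for S
      using C2_patch.hessian_symmetric[OF patch h sq[OF w], of S S] by (simp add: p_def q_def)
    note chain = C2_patch.chain_rule[OF patch sq[OF w]]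
    note chain2 = C2_patch.chain_rule_second_order[OF patch h sq[OF w]]
    \<comment> \<open>\<open>A\<close>, \<open>B\<close> and \<open>C\<close> collect the parts of
      the second derivatives of the pullback that contain only the gradient of
      \<open>\<phi>\<close>: it is paired with the uu, uv and vv derivatives of the
      parameterization.\<close>
    define A where "A S = p Lft ?z * Du (Du (?X S)) ?z + q Lft ?z * Du (Du (?Y S)) ?z" for S
    define B where "B = p Lft ?z * Dv (Du (?X Lft)) ?z + q Lft ?z * Dv (Du (?Y Lft)) ?z"
    define C where "C = p Lft ?z * Dv (Dv (?X Lft)) ?z + q Lft ?z * Dv (Dv (?Y Lft)) ?z"
    have 1: "gradx (F S) (p S) ?z * Dv (?X Lft) ?z + grady (F S) (p S) ?z * Dv (?Y Lft) ?z = ?pv" for S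
      using chain(2)[of S "p S"] t[OF w, of S] dp[of S] by simp
    have 2: "grady (F S) (p S) ?z * Dv (?X Lft) ?z + grady (F S) (q S) ?z * Dv (?Y Lft) ?z = ?qv" for S
      using chain(2)[of S "q S"] t[OF w, of S] dp[of S] sym[of S] by simp
    have 3: "(gradx (F S) (p S) ?z * Du (?X S) ?z + grady (F S) (p S) ?z * Du (?Y S) ?z) * Du (?X S) ?z +
        (grady (F S) (p S) ?z * Du (?X S) ?z + grady (F S) (q S) ?z * Du (?Y S) ?z) * Du (?Y S) ?z + A S
      = (poly (\<beta> S) w)\<^sup>2 * g0'' w + 2 * poly (\<alpha> S) w * poly (\<beta> S) w * g1' w + (poly (\<alpha> S) w)\<^sup>2 * g2 w" for S
      using chain(1)[of S "p S"] chain(1)[of S "q S"] chain2(1)[of S S, folded p_def q_def] uu[OF w, of S] gp[of S] sym[of S]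
      unfolding A_def by (simp add: add_ac)
    have 4: "?pv * Du (?X Lft) ?z + ?qv * Du (?Y Lft) ?z + B = poly (pderiv (\<alpha> Lft)) w * g1 w +
        poly (\<alpha> Lft) w * g1' w + poly (pderiv (\<beta> Lft)) w * g0' w + poly (\<beta> Lft) w * g0'' w"
      using chain2(2)[of Lft Lft, folded p_def q_def] uv[OF w, of Lft] unfolding B_def by (simp add: add_ac)
    have 5: "?pv * Dv (?X Lft) ?z + ?qv * Dv (?Y Lft) ?z + C = g0'' w"
      using chain2(3)[of Lft Lft, folded p_def q_def] vv[OF w, of Lft] unfolding C_def by (simp add: add_ac)
    have 6: "p Lft ?z * Du (?X Lft) ?z + q Lft ?z * Du (?Y Lft) ?z = poly (\<alpha> Lft) w * g1 w + poly (\<beta> Lft) w * g0' w"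
      "p Lft ?z * Dv (?X Lft) ?z + q Lft ?z * Dv (?Y Lft) ?z = g0' w"
      using chain[of Lft "h Lft"] u[OF w, of Lft] v[OF w, of Lft] by (simp_all add: p_def q_def)
    have "poly (\<alpha> Lft) w *\<^sub>R Z_fun F \<alpha> \<beta> w + poly (eta_poly \<alpha> \<beta>) w *\<^sub>R Du (F Lft) (0, w)
          + poly (theta_poly \<alpha> \<beta>) w *\<^sub>R Dv (F Lft) (0, w) = 0"
      using G2 w unfolding bilinear_like_G2_def by blast
    moreover have "D1 (D1 (\<lambda>v. F Lft (0, v))) w = Dv (Dv (F Lft)) ?z" by (simp add: Dv_def)
    ultimately have 7: "poly (\<alpha> Lft) w * ((poly (\<alpha> Lft) w)\<^sup>2 * Du (Du (?X Rgt)) ?z - ((poly (\<alpha> Rgt) w)\<^sup>2 * Du (Du (?X Lft)) ?z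
          + 2 * poly (\<alpha> Rgt) w * poly (beta_poly \<alpha> \<beta>) w * Dv (Du (?X Lft)) ?z + (poly (beta_poly \<alpha> \<beta>) w)\<^sup>2 * Dv (Dv (?X Lft)) ?z))
        + poly (eta_poly \<alpha> \<beta>) w * Du (?X Lft) ?z + poly (theta_poly \<alpha> \<beta>) w * Dv (?X Lft) ?z = 0"
      "poly (\<alpha> Lft) w * ((poly (\<alpha> Lft) w)\<^sup>2 * Du (Du (?Y Rgt)) ?z - ((poly (\<alpha> Rgt) w)\<^sup>2 * Du (Du (?Y Lft)) ?z
          + 2 * poly (\<alpha> Rgt) w * poly (beta_poly \<alpha> \<beta>) w * Dv (Du (?Y Lft)) ?z + (poly (beta_poly \<alpha> \<beta>) w)\<^sup>2 * Dv (Dv (?Y Lft)) ?z))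
        + poly (eta_poly \<alpha> \<beta>) w * Du (?Y Lft) ?z + poly (theta_poly \<alpha> \<beta>) w * Dv (?Y Lft) ?z = 0"
      by (simp_all add: Z_fun_def C2_patch.vector_derivatives[OF patch sq[OF w]] zero_prod_def)
    have e: "poly (eta_poly \<alpha> \<beta>) w = 2 * poly (pderiv (\<alpha> Lft)) w * poly (\<alpha> Rgt) w * poly (beta_poly \<alpha> \<beta>) w"
      "poly (theta_poly \<alpha> \<beta>) w = 2 * (poly (\<alpha> Lft) w * poly (pderiv (\<beta> Lft)) w - poly (pderiv (\<alpha> Lft)) w * poly (\<beta> Lft) w)
        * poly (\<alpha> Rgt) w * poly (beta_poly \<alpha> \<beta>) w"
      by (simp_all add: eta_poly_def theta_poly_def)
    have 8: "poly (\<alpha> Lft) w * ((poly (\<alpha> Lft) w)\<^sup>2 * A Rgt - ((poly (\<alpha> Rgt) w)\<^sup>2 * A Lft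
          + 2 * poly (\<alpha> Rgt) w * poly (beta_poly \<alpha> \<beta>) w * B + (poly (beta_poly \<alpha> \<beta>) w)\<^sup>2 * C))
        + 2 * poly (pderiv (\<alpha> Lft)) w * poly (\<alpha> Rgt) w * poly (beta_poly \<alpha> \<beta>) w * (poly (\<alpha> Lft) w * g1 w + poly (\<beta> Lft) w * g0' w)
        + 2 * (poly (\<alpha> Lft) w * poly (pderiv (\<beta> Lft)) w - poly (pderiv (\<alpha> Lft)) w * poly (\<beta> Lft) w)
        * poly (\<alpha> Rgt) w * poly (beta_poly \<alpha> \<beta>) w * g0' w = 0"
      using G2_functional[OF 7 6] unfolding e A_def B_def C_def .
    show "gradx (F Lft) (p Lft) (0, w) = gradx (F Rgt) (p Rgt) (0, w)"
      "grady (F Lft) (p Lft) (0, w) = grady (F Rgt) (p Rgt) (0, w)"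
      "grady (F Lft) (q Lft) (0, w) = grady (F Rgt) (q Rgt) (0, w)"
      using edge_hessian_eq[where a = "\<lambda>S. poly (\<alpha> S) w" and b = "\<lambda>S. poly (\<beta> S) w" and x = "\<lambda>S. Du (?X S) ?z"
          and y = "\<lambda>S. Du (?Y S) ?z" and hxx = "\<lambda>S. gradx (F S) (p S) ?z" and hxy = "\<lambda>S. grady (F S) (p S) ?z"
          and hyy = "\<lambda>S. grady (F S) (q S) ?z" and A = A,
          OF \<alpha>0[OF w] \<xi>[OF w] det[OF w] 1 2 3 4 5 b 8] by auto
  qed
  have sym: "gradx (F S) (q S) (0, w) = grady (F S) (p S) (0, w)" if "w \<in> {0..1}" for S w
    using C2_patch.hessian_symmetric[OF patch h sq[OF that], of S S] by (simp add: p_def q_def)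
  show ?thesis
    by (rule determined_by_C2[OF \<phi> h])
      (use grad hess sym in \<open>auto simp: p_def q_def\<close>)
qed

end

subsection \<open>The isogeometric space\<close>

context breakpoints
begin

lemma spl_has_D1:
  assumes "f \<in> spl d r" "1 \<le> r" "0 \<le> x" "x \<le> 1"
  shows "(f has_vector_derivative D1 f x) (at x within {0..1})"
  using spl_D1[OF assms(1,2)] assms(3,4) by metis

lemma spl_has_D1_D1:
  assumes f: "f \<in> spl d r" "2 \<le> r" and x: "0 \<le> x" "x \<le> 1"
  shows "(D1 f has_vector_derivative D1 (D1 f) x) (at x within {0..1})"
proof (rule spl_D1_D1[OF f])
  fix f' f''
  assume "\<And>x. 0 \<le> x \<Longrightarrow> x \<le> 1 \<Longrightarrow> (f' has_vector_derivative f'' x) (at x within {0..1})"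
    and "\<And>x. 0 \<le> x \<Longrightarrow> x \<le> 1 \<Longrightarrow> D1 f x = f' x"
    and "\<And>x. 0 \<le> x \<Longrightarrow> x \<le> 1 \<Longrightarrow> D1 (D1 f) x = f'' x"
  then show ?thesis
    using x by (intro has_vector_derivative_transform[of x "{0..1}" "D1 f" f']) auto
qed

text \<open>\<open>D1\<close> rests on a choice operator and is linear only where the summands are
  differentiable, which splines with \<open>r >= 1\<close> are.\<close>

lemma D1_linear_combination:
  assumes "\<And>j. j \<in> J \<Longrightarrow> f j \<in> spl d r" "1 \<le> r" "0 \<le> x" "x \<le> 1"
  shows "D1 (\<Sum>j\<in>J. c j *\<^sub>R f j) x = (\<Sum>j\<in>J. c j * D1 (f j) x)"
proof (rule D1_eqI)
  have "((\<lambda>x. \<Sum>j\<in>J. c j * f j x) has_vector_derivative (\<Sum>j\<in>J. c j * D1 (f j) x)) (at x within {0..1})"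
    using assms by (intro has_vector_derivative_sum has_vector_derivative_mult_right spl_has_D1)
  moreover have "(\<Sum>j\<in>J. c j *\<^sub>R f j) = (\<lambda>x. \<Sum>j\<in>J. c j * f j x)"
    by (rule ext) (rule fun_sum_scaleR_apply)
  ultimately show "((\<Sum>j\<in>J. c j *\<^sub>R f j) has_vector_derivative (\<Sum>j\<in>J. c j * D1 (f j) x)) (at x within {0..1})"
    by simp
qed (use assms in auto)

lemma D1_D1_linear_combination:
  assumes f: "\<And>j. j \<in> J \<Longrightarrow> f j \<in> spl d r" and r: "2 \<le> r" and x: "0 \<le> x" "x \<le> 1"
  shows "D1 (D1 (\<Sum>j\<in>J. c j *\<^sub>R f j)) x = (\<Sum>j\<in>J. c j * D1 (D1 (f j)) x)"
proof -
  have "D1 (\<Sum>j\<in>J. c j *\<^sub>R f j) y = (\<Sum>j\<in>J. c j * D1 (f j) y)" if "0 \<le> y" "y \<le> 1" for y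
    using D1_linear_combination[OF f _ that, of J] r by simp
  then have "D1 (D1 (\<Sum>j\<in>J. c j *\<^sub>R f j)) x = D1 (\<lambda>x. \<Sum>j\<in>J. c j * D1 (f j) x) x"
    using x by (intro D1_cong)
  also have "\<dots> = (\<Sum>j\<in>J. c j * D1 (D1 (f j)) x)"
    using assms by (intro D1_eqI has_vector_derivative_sum has_vector_derivative_mult_right spl_has_D1_D1)
  finally show ?thesis .
qed

lemma tensor_jet:
  assumes f: "f \<in> spl d r" "2 \<le> r" and g: "g \<in> spl d' r'" "2 \<le> r'" and z: "z \<in> unit_sq"
  shows "Du (Du (\<lambda>(u, v). f u * g v)) z = D1 (D1 f) (fst z) * g (snd z)"
    and "Dv (Du (\<lambda>(u, v). f u * g v)) z = D1 f (fst z) * D1 g (snd z)"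
    and "Dv (Dv (\<lambda>(u, v). f u * g v)) z = f (fst z) * D1 (D1 g) (snd z)"
proof -
  have r: "1 \<le> r" "1 \<le> r'" "1 \<le> r - 1" "1 \<le> r' - 1" using f g by auto
  obtain f' where f': "f' \<in> spl (d - 1) (r - 1)"
    "\<And>x. 0 \<le> x \<Longrightarrow> x \<le> 1 \<Longrightarrow> (f has_vector_derivative f' x) (at x within {0..1})"
    "\<And>x. 0 \<le> x \<Longrightarrow> x \<le> 1 \<Longrightarrow> D1 f x = f' x" using spl_D1[OF f(1) r(1)] by blast
  obtain g' where g': "g' \<in> spl (d' - 1) (r' - 1)"
    "\<And>x. 0 \<le> x \<Longrightarrow> x \<le> 1 \<Longrightarrow> (g has_vector_derivative g' x) (at x within {0..1})"
    "\<And>x. 0 \<le> x \<Longrightarrow> x \<le> 1 \<Longrightarrow> D1 g x = g' x" using spl_D1[OF g(1) r(2)] by blast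
  have u: "Du (\<lambda>(u, v). f u * g v) z = (\<lambda>(u, v). f' u * g v) z"
    and v: "Dv (\<lambda>(u, v). f u * g v) z = (\<lambda>(u, v). f u * g' v) z" if "z \<in> unit_sq" for z
    using tensor_C1sq[OF f(1) g(1) r(1,2)] that f'(3) g'(3) by auto
  have e: "D1 f' x = D1 (D1 f) x" "D1 g' x = D1 (D1 g) x" if "0 \<le> x" "x \<le> 1" for x
    using that f'(3) g'(3) by (auto intro!: D1_cong)
  show "Du (Du (\<lambda>(u, v). f u * g v)) z = D1 (D1 f) (fst z) * g (snd z)"
    "Dv (Du (\<lambda>(u, v). f u * g v)) z = D1 f (fst z) * D1 g (snd z)"
    using Du_cong[OF u z] Dv_cong[OF u z] tensor_C1sq[OF f'(1) g(1) r(3,2)] z e f'(3) by auto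
  show "Dv (Dv (\<lambda>(u, v). f u * g v)) z = f (fst z) * D1 (D1 g) (snd z)"
    using Dv_cong[OF v z] tensor_C1sq[OF f(1) g'(1) r(1,4)] z e by auto
qed

end

section \<open>The setting of the theorem and the function belonging to a triplet\<close>

locale G2_spline_patches = breakpoints +
  fixes p r :: nat and F :: "patch \<Rightarrow> real \<times> real \<Rightarrow> real \<times> real" and \<alpha> \<beta> :: "patch \<Rightarrow> real poly"
  assumes p5: "p \<ge> 5" and r2: "2 \<le> r" and rp: "r \<le> p - 3"
    and two_patch: "two_patch_parameterization k \<tau> p r F"
    and G2: "bilinear_like_G2 F \<alpha> \<beta>"
begin

abbreviation "d \<equiv> d_alpha \<alpha>"
abbreviation "S0 \<equiv> spl p (r + 2)"
abbreviation "S1 \<equiv> spl (p - d) (r + 1)"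
abbreviation "S2 \<equiv> spl (p - 2 * d) r"

lemma degrees: "degree (\<alpha> S) \<le> d" "degree (\<beta> S) \<le> 1" "d \<le> 1"
  using G2 by (cases S; auto simp: d_alpha_def bilinear_like_G2_def)+

text \<open>These inequalities make the smoothness of each of the spline spaces at most its degree,
  as the identification with \<open>spl\<close> requires, and \<open>r + 3 <= p\<close> provides the
  knot multiplicity behind \<open>M_jets\<close>.\<close>

lemma ranges: "r + 3 \<le> p" "2 \<le> p" "r + 2 \<le> p" "r + 1 \<le> p - d" "r \<le> p - 2 * d" "r \<le> p"
  using p5 r2 rp degrees(3) by auto

lemma C2_patch_F: "C2_patch (F S)"
proof
  have s: "zero_ext unit_sq (\<lambda>z. fst (F S z)) \<in> spline_space2 k \<tau> p r"
    "zero_ext unit_sq (\<lambda>z. snd (F S z)) \<in> spline_space2 k \<tau> p r"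
    using two_patch unfolding two_patch_parameterization_def by blast+
  show X: "C2sq (\<lambda>z. fst (F S z))"
    by (rule C2sq_cong[OF _ spline_space2_C2sq[OF s(1) r2 ranges(6)]]) (simp add: zero_ext_def)
  show Y: "C2sq (\<lambda>z. snd (F S z))"
    by (rule C2sq_cong[OF _ spline_space2_C2sq[OF s(2) r2 ranges(6)]]) (simp add: zero_ext_def)
  show "inj_on (F S) unit_sq" using two_patch unfolding two_patch_parameterization_def by blast
  fix z assume z: "z \<in> unit_sq"
  have C: "C1sq (\<lambda>z. fst (F S z))" "C1sq (\<lambda>z. snd (F S z))" using X Y by (auto simp: C2sq_def)
  have "jacobian_det (F S) z \<noteq> 0" using two_patch z unfolding two_patch_parameterization_def by blast
  then show "Du (\<lambda>z. fst (F S z)) z * Dv (\<lambda>z. snd (F S z)) z - Dv (\<lambda>z. fst (F S z)) z * Du (\<lambda>z. snd (F S z)) z \<noteq> 0"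
    using Du_Pair[OF C z] by (simp add: jacobian_det_def)
qed

sublocale glued_patches F
proof (rule glued_patches.intro)
  show "C2_patch (F S)" for S by (rule C2_patch_F)
  show "v \<in> {0..1} \<Longrightarrow> F Lft (0, v) = F Rgt (0, v)" for v
    using two_patch unfolding two_patch_parameterization_def by blast
  show "F Lft ` unit_sq \<inter> F Rgt ` unit_sq = (\<lambda>v. F Lft (0, v)) ` {0..1}"
    using two_patch unfolding two_patch_parameterization_def by blast
qed

definition gmap :: "(real \<Rightarrow> real) \<Rightarrow> (real \<Rightarrow> real) \<Rightarrow> (real \<Rightarrow> real) \<Rightarrow> patch \<Rightarrow> real \<times> real \<Rightarrow> real" where
  "gmap g0 g1 g2 S = (\<lambda>(u, v). g0 v * M0 k \<tau> p r u
     + (poly (\<alpha> S) v * g1 v + poly (\<beta> S) v * D1 g0 v) * M1 k \<tau> p r u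
     + ((poly (\<beta> S) v)\<^sup>2 * D1 (D1 g0) v + 2 * poly (\<alpha> S) v * poly (\<beta> S) v * D1 g1 v
        + (poly (\<alpha> S) v)\<^sup>2 * g2 v) * M2 k \<tau> p r u)"

text \<open>Here the degrees and smoothness orders of the triplet balance: differentiation lowers
  both by one, multiplication by alpha or beta adds at most \<open>d\<close> or 1 to the degree.
  Thus beta g0', beta^2 g0'', alpha g1, alpha beta g1' and alpha^2 g2 all have degree at most
  \<open>p\<close> and smoothness at least \<open>r\<close>.\<close>

lemma gmap_coefficients:
  assumes g: "g0 \<in> S0" "g1 \<in> S1" "g2 \<in> S2"
  shows "\<exists>c1\<in>spl p r. \<exists>c2\<in>spl p r. \<forall>v\<in>{0..1}.
    c1 v = poly (\<alpha> S) v * g1 v + poly (\<beta> S) v * D1 g0 v \<and>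
    c2 v = (poly (\<beta> S) v)\<^sup>2 * D1 (D1 g0) v + 2 * poly (\<alpha> S) v * poly (\<beta> S) v * D1 g1 v
      + (poly (\<alpha> S) v)\<^sup>2 * g2 v"
proof (rule spl_D1_D1[OF g(1)])
  fix g0' g0''
  assume g0: "g0' \<in> spl (p - 1) (r + 2 - 1)" "g0'' \<in> spl (p - 2) (r + 2 - 2)"
    "\<And>x. 0 \<le> x \<Longrightarrow> x \<le> 1 \<Longrightarrow> D1 g0 x = g0' x" "\<And>x. 0 \<le> x \<Longrightarrow> x \<le> 1 \<Longrightarrow> D1 (D1 g0) x = g0'' x"
  obtain g1' where g1: "g1' \<in> spl (p - d - 1) (r + 1 - 1)"
    "\<And>x. 0 \<le> x \<Longrightarrow> x \<le> 1 \<Longrightarrow> (g1 has_vector_derivative g1' x) (at x within {0..1})"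
    "\<And>x. 0 \<le> x \<Longrightarrow> x \<le> 1 \<Longrightarrow> D1 g1 x = g1' x" using spl_D1[OF g(2)] by (metis le_add2)
  have *: "(\<lambda>x. poly q x * f x) \<in> spl p r" if "f \<in> spl m s" "degree q \<le> e" "m + e \<le> p" "r \<le> s" for q f m s e
    using spl_mult_poly[OF that(1,2)] spl_mono[OF that(3,4)] by blast
  have deg: "degree (\<beta> S ^ 2) \<le> 2" "degree (\<alpha> S * \<beta> S) \<le> d + 1" "degree (\<alpha> S ^ 2) \<le> 2 * d"
    using degrees(1,2)[of S] degrees(3) degree_power_le[of "\<beta> S" 2] degree_power_le[of "\<alpha> S" 2] degree_mult_le[of "\<alpha> S" "\<beta> S"] by linarith+
  define c1 where "c1 v = poly (\<alpha> S) v * g1 v + poly (\<beta> S) v * g0' v" for v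
  define c2 where "c2 v = poly (\<beta> S ^ 2) v * g0'' v + 2 * (poly (\<alpha> S * \<beta> S) v * g1' v) + poly (\<alpha> S ^ 2) v * g2 v" for v
  have "c1 \<in> spl p r" unfolding c1_def[abs_def]
    by (intro spl_add *[OF g(2) degrees(1)] *[OF g0(1) degrees(2)]) (use ranges in auto)
  moreover have "c2 \<in> spl p r" unfolding c2_def[abs_def]
    by (intro spl_add spl_scale *[OF g(3) deg(3)] *[OF g1(1) deg(2)] *[OF g0(2) deg(1)]) (use ranges degrees(3) p5 in auto)
  ultimately show ?thesis
    by (intro bexI[of _ c1] bexI[of _ c2]) (use g0(3,4) g1(3) in \<open>auto simp: c1_def c2_def\<close>)
qed simp

text \<open>On the square the function is a sum of three products of a spline in u and a spline in
  v; at u = 0 the jets of \<open>M0\<close>, \<open>M1\<close> and \<open>M2\<close> select one of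
  the factors in v each time.\<close>

lemma gmap_jet:
  assumes g: "g0 \<in> S0" "g1 \<in> S1" "g2 \<in> S2"
  shows "C2sq (gmap g0 g1 g2 S)"
    and "v \<in> {0..1} \<Longrightarrow> gmap g0 g1 g2 S (0, v) = g0 v"
    and "v \<in> {0..1} \<Longrightarrow> Du (gmap g0 g1 g2 S) (0, v) = poly (\<alpha> S) v * g1 v + poly (\<beta> S) v * D1 g0 v"
    and "v \<in> {0..1} \<Longrightarrow> Dv (gmap g0 g1 g2 S) (0, v) = D1 g0 v"
    and "v \<in> {0..1} \<Longrightarrow> Du (Du (gmap g0 g1 g2 S)) (0, v) = (poly (\<beta> S) v)\<^sup>2 * D1 (D1 g0) v
      + 2 * poly (\<alpha> S) v * poly (\<beta> S) v * D1 g1 v + (poly (\<alpha> S) v)\<^sup>2 * g2 v"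
    and "v \<in> {0..1} \<Longrightarrow> Dv (Du (gmap g0 g1 g2 S)) (0, v) = poly (pderiv (\<alpha> S)) v * g1 v +
      poly (\<alpha> S) v * D1 g1 v + poly (pderiv (\<beta> S)) v * D1 g0 v + poly (\<beta> S) v * D1 (D1 g0) v"
    and "v \<in> {0..1} \<Longrightarrow> Dv (Dv (gmap g0 g1 g2 S)) (0, v) = D1 (D1 g0) v"
proof -
  from gmap_coefficients[OF g, of S] obtain c1 c2 where c: "c1 \<in> spl p r" "c2 \<in> spl p r"
    and c1: "\<And>v. 0 \<le> v \<Longrightarrow> v \<le> 1 \<Longrightarrow> c1 v = poly (\<alpha> S) v * g1 v + poly (\<beta> S) v * D1 g0 v"
    and c2: "\<And>v. 0 \<le> v \<Longrightarrow> v \<le> 1 \<Longrightarrow> c2 v = (poly (\<beta> S) v)\<^sup>2 * D1 (D1 g0) v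
      + 2 * poly (\<alpha> S) v * poly (\<beta> S) v * D1 g1 v + (poly (\<alpha> S) v)\<^sup>2 * g2 v"
    by auto
  have c0: "g0 \<in> spl p r" using g(1) spl_mono[of p p r "r + 2"] by auto
  note M = M_in_spl[OF ranges(1)]
  define h0 h1 h2 where "h0 = (\<lambda>(u, v). M0 k \<tau> p r u * g0 v)" and "h1 = (\<lambda>(u, v). M1 k \<tau> p r u * c1 v)"
    and "h2 = (\<lambda>(u, v). M2 k \<tau> p r u * c2 v)"
  let ?h = "\<lambda>z. h0 z + h1 z + h2 z"
  have eq: "gmap g0 g1 g2 S z = ?h z" if "z \<in> unit_sq" for z
    using that c1 c2 by (auto simp: gmap_def h0_def h1_def h2_def)
  have C2: "C2sq h0" "C2sq h1" "C2sq h2"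
    unfolding h0_def h1_def h2_def using tensor_C2sq[OF M(1) c0 r2 r2]
      tensor_C2sq[OF M(2) c(1) r2 r2] tensor_C2sq[OF M(3) c(2) r2 r2] by auto
  then have C1: "C1sq h0" "C1sq h1" "C1sq h2" "C1sq (Du h0)" "C1sq (Du h1)" "C1sq (Du h2)"
    "C1sq (Dv h0)" "C1sq (Dv h1)" "C1sq (Dv h2)" by (auto simp: C2sq_def)
  show "C2sq (gmap g0 g1 g2 S)" by (rule C2sq_cong[OF eq C2sq_add[OF C2sq_add[OF C2(1,2)] C2(3)]])
  have u: "Du (gmap g0 g1 g2 S) z = Du h0 z + Du h1 z + Du h2 z"
    and v: "Dv (gmap g0 g1 g2 S) z = Dv h0 z + Dv h1 z + Dv h2 z" if "z \<in> unit_sq" for z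
    using Du_cong[OF eq that] Dv_cong[OF eq that] that by (simp_all add: C1sq_add C1)
  have uu: "Du (Du (gmap g0 g1 g2 S)) z = Du (Du h0) z + Du (Du h1) z + Du (Du h2) z"
    and uv: "Dv (Du (gmap g0 g1 g2 S)) z = Dv (Du h0) z + Dv (Du h1) z + Dv (Du h2) z"
    and vv: "Dv (Dv (gmap g0 g1 g2 S)) z = Dv (Dv h0) z + Dv (Dv h1) z + Dv (Dv h2) z" if "z \<in> unit_sq" for z
    using Du_cong[OF u that] Dv_cong[OF u that] Dv_cong[OF v that] that by (simp_all add: C1sq_add C1)
  have r1: "1 \<le> r" using r2 by simp
  note jets = M_jets[OF ranges(2,1)] tensor_C1sq(2,3)[OF M(1) c0 r1 r1] tensor_C1sq(2,3)[OF M(2) c(1) r1 r1]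
    tensor_C1sq(2,3)[OF M(3) c(2) r1 r1] tensor_jet[OF M(1) r2 c0 r2] tensor_jet[OF M(2) r2 c(1) r2]
    tensor_jet[OF M(3) r2 c(2) r2]
  {
    assume w: "v \<in> {0..1}"
    then have z: "(0, v) \<in> unit_sq" by auto
    show "gmap g0 g1 g2 S (0, v) = g0 v" by (simp add: gmap_def jets(1-9))
    show "Du (gmap g0 g1 g2 S) (0, v) = poly (\<alpha> S) v * g1 v + poly (\<beta> S) v * D1 g0 v"
      using w c1[of v] unfolding u[OF z] h0_def h1_def h2_def by (simp add: jets z)
    show "Dv (gmap g0 g1 g2 S) (0, v) = D1 g0 v"
      using w unfolding v[OF z] h0_def h1_def h2_def by (simp add: jets z)
    show "Du (Du (gmap g0 g1 g2 S)) (0, v) = (poly (\<beta> S) v)\<^sup>2 * D1 (D1 g0) v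
      + 2 * poly (\<alpha> S) v * poly (\<beta> S) v * D1 g1 v + (poly (\<alpha> S) v)\<^sup>2 * g2 v"
      using w c2[of v] unfolding uu[OF z] h0_def h1_def h2_def by (simp add: jets z)
    show "Dv (Dv (gmap g0 g1 g2 S)) (0, v) = D1 (D1 g0) v"
      using w unfolding vv[OF z] h0_def h1_def h2_def by (simp add: jets z)
    \<comment> \<open>The mixed derivative on the edge equals \<open>D1 c1\<close>; the product rule
      expresses it in terms of the triplet.\<close>
    have "(c1 has_vector_derivative poly (pderiv (\<alpha> S)) v * g1 v + poly (\<alpha> S) v * D1 g1 v +
        (poly (pderiv (\<beta> S)) v * D1 g0 v + poly (\<beta> S) v * D1 (D1 g0) v)) (at v within {0..1})"
    proof (rule has_vector_derivative_transform)
      have g1': "(g1 has_real_derivative D1 g1 v) (at v within {0..1})"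
        and g0'': "(D1 g0 has_real_derivative D1 (D1 g0) v) (at v within {0..1})"
        using w spl_has_D1[OF g(2)] spl_has_D1_D1[OF g(1)]
        by (auto simp: has_real_derivative_iff_has_vector_derivative)
      have pd: "(poly q has_real_derivative poly (pderiv q) v) (at v within {0..1})" for q
        by (rule DERIV_subset[OF poly_DERIV]) simp
      show "((\<lambda>v. poly (\<alpha> S) v * g1 v + poly (\<beta> S) v * D1 g0 v) has_vector_derivative
          poly (pderiv (\<alpha> S)) v * g1 v + poly (\<alpha> S) v * D1 g1 v +
          (poly (pderiv (\<beta> S)) v * D1 g0 v + poly (\<beta> S) v * D1 (D1 g0) v)) (at v within {0..1})"
        unfolding has_real_derivative_iff_has_vector_derivative[symmetric]
        using DERIV_add[OF DERIV_mult[OF pd g1'] DERIV_mult[OF pd g0''], of "\<alpha> S" "\<beta> S"]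
        by (simp add: algebra_simps)
    qed (use w c1 in auto)
    then have "D1 c1 v = poly (pderiv (\<alpha> S)) v * g1 v + poly (\<alpha> S) v * D1 g1 v +
        (poly (pderiv (\<beta> S)) v * D1 g0 v + poly (\<beta> S) v * D1 (D1 g0) v)"
      using w by (intro D1_eqI) auto
    then show "Dv (Du (gmap g0 g1 g2 S)) (0, v) = poly (pderiv (\<alpha> S)) v * g1 v +
      poly (\<alpha> S) v * D1 g1 v + poly (pderiv (\<beta> S)) v * D1 g0 v + poly (\<beta> S) v * D1 (D1 g0) v"
      using w unfolding uv[OF z] h0_def h1_def h2_def by (simp add: jets z)
  }
qed

lemma gmap_ex1:
  assumes "g0 \<in> S0" "g1 \<in> S1" "g2 \<in> S2"
  shows "\<exists>!\<phi>. determined_by F (gmap g0 g1 g2) \<phi>"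
  by (rule determined_by_ex1) (simp add: gmap_jet(2)[OF assms])

lemma gmap_C2:
  assumes g: "g0 \<in> S0" "g1 \<in> S1" "g2 \<in> S2" and \<phi>: "determined_by F (gmap g0 g1 g2) \<phi>"
  shows "C2_up_to_boundary (Omega F) \<phi>"
  by (rule G2_imp_C2[OF G2 \<phi>, of g1 "D1 g0" "D1 (D1 g0)" "D1 g1" g2]) (simp_all add: gmap_jet[OF g])

text \<open>The value and the first two u-derivatives on the edge return g0, then alpha g1, then
  alpha^2 g2. One patch is enough, and outside [0, 1] the splines vanish anyway.\<close>

lemma gmap_zero:
  assumes g: "g0 \<in> S0" "g1 \<in> S1" "g2 \<in> S2"
    and 0: "\<And>z. z \<in> unit_sq \<Longrightarrow> gmap g0 g1 g2 S z = 0"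
  shows "g0 = 0" "g1 = 0" "g2 = 0"
proof -
  have u: "Du (gmap g0 g1 g2 S) z = 0" if "z \<in> unit_sq" for z
    using Du_cong[of "gmap g0 g1 g2 S" "\<lambda>_. 0" z, OF 0 that] C1sq_const(2)[OF that] by simp
  have uu: "Du (Du (gmap g0 g1 g2 S)) z = 0" if "z \<in> unit_sq" for z
    using Du_cong[of "Du (gmap g0 g1 g2 S)" "\<lambda>_. 0" z, OF u that] C1sq_const(2)[OF that] by simp
  have z: "(0, v) \<in> unit_sq" if "0 \<le> v" "v \<le> 1" for v :: real using that by simp
  have \<alpha>0: "poly (\<alpha> S) v \<noteq> 0" if "0 \<le> v" "v \<le> 1" for v
    using G2 that unfolding bilinear_like_G2_def by (cases S) force+
  have D10: "D1 f v = 0" if "\<And>v. 0 \<le> v \<Longrightarrow> v \<le> 1 \<Longrightarrow> f v = 0" "0 \<le> v" "v \<le> 1" for f :: "real \<Rightarrow> real" and v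
    using D1_cong[of f "\<lambda>_. 0" v] that D1_eqI[OF has_vector_derivative_const, of v "0::real"] by simp
  have e0: "g0 v = 0" if "0 \<le> v" "v \<le> 1" for v
    using gmap_jet(2)[OF g, of v S] 0[OF z[OF that]] that by simp
  have e1: "g1 v = 0" if v: "0 \<le> v" "v \<le> 1" for v
    using gmap_jet(3)[OF g, of v S] u[OF z[OF v]] v \<alpha>0[OF v] D10[OF e0 v] by simp
  have e2: "g2 v = 0" if v: "0 \<le> v" "v \<le> 1" for v
    using gmap_jet(5)[OF g, of v S] uu[OF z[OF v]] v \<alpha>0[OF v] D10[OF e1 v] D10[OF D10[OF e0] v] by simp
  have "g0 x = 0 \<and> g1 x = 0 \<and> g2 x = 0" for x
    using e0[of x] e1[of x] e2[of x] spl_zero_outside[OF g(1), of x] spl_zero_outside[OF g(2), of x]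
      spl_zero_outside[OF g(3), of x] by blast
  then show "g0 = 0" "g1 = 0" "g2 = 0" by (simp_all add: fun_eq_iff)
qed

lemma gmap_pullback:
  assumes g: "g0 \<in> S0" "g1 \<in> S1" "g2 \<in> S2" and \<phi>: "determined_by F (gmap g0 g1 g2) \<phi>"
  shows "\<exists>d :: nat \<Rightarrow> nat \<Rightarrow> real.
    pullback F \<phi> S = (\<Sum>i\<le>p + k * (p - r). \<Sum>j\<le>p + k * (p - r). d i j *\<^sub>R N2 k \<tau> p r i j) \<and>
    (\<forall>i\<ge>3. \<forall>j. d i j = 0)"
proof -
  let ?n = "p + k * (p - r)"
  from gmap_coefficients[OF g, of S] obtain c1 c2 where c: "c1 \<in> spl p r" "c2 \<in> spl p r"
    and c1: "\<And>v. 0 \<le> v \<Longrightarrow> v \<le> 1 \<Longrightarrow> c1 v = poly (\<alpha> S) v * g1 v + poly (\<beta> S) v * D1 g0 v"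
    and c2: "\<And>v. 0 \<le> v \<Longrightarrow> v \<le> 1 \<Longrightarrow> c2 v = (poly (\<beta> S) v)\<^sup>2 * D1 (D1 g0) v
      + 2 * poly (\<alpha> S) v * poly (\<beta> S) v * D1 g1 v + (poly (\<alpha> S) v)\<^sup>2 * g2 v"
    by auto
  have c0: "g0 \<in> spl p r" using g(1) spl_mono[of p p r "r + 2"] by auto
  define m1 m2 where "m1 = tau1 k \<tau> / real p" and "m2 = (tau1 k \<tau>)\<^sup>2 / (real p * (real p - 1))"
  \<comment> \<open>The coefficient functions of the first three B-splines in u, found by inserting
    the definitions of \<open>M0\<close>, \<open>M1\<close> and \<open>M2\<close> and sorting by
    \<open>N\<close>.\<close>
  define b where "b i v = (if i = 0 then g0 v else if i = 1 then g0 v + m1 * c1 v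
    else if i = 2 then g0 v + 2 * m1 * c1 v + m2 * c2 v else 0)" for i :: nat and v
  have "b i \<in> spl p r" for i
    unfolding b_def[abs_def] using c0 c by (cases "i = 0"; cases "i = 1"; cases "i = 2") (auto intro!: spl_add spl_scale spl_0)
  then have "\<exists>d. b i = (\<Sum>j\<le>?n. d j *\<^sub>R N k \<tau> p r j)" for i
    using is_basis_family_obtain[OF N_basis[OF ranges(6)] finite_atMost, of "b i"] by metis
  then obtain e where e: "\<And>i. b i = (\<Sum>j\<le>?n. e i j *\<^sub>R N k \<tau> p r j)" by metis
  define d where "d i j = (if i < 3 then e i j else 0)" for i j
  have db: "(\<Sum>j\<le>?n. d i j * N k \<tau> p r j v) = b i v" for i v
  proof (cases "i < 3")
    case True
    then show ?thesis using fun_cong[OF e[of i], of v] unfolding fun_sum_scaleR_apply by (simp add: d_def)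
  next
    case False
    then show ?thesis by (simp add: d_def b_def)
  qed
  have "pullback F \<phi> S (u, v) = (\<Sum>i\<le>?n. \<Sum>j\<le>?n. d i j *\<^sub>R N2 k \<tau> p r i j) (u, v)" for u v
  proof -
    have "(\<Sum>i\<le>?n. \<Sum>j\<le>?n. d i j *\<^sub>R N2 k \<tau> p r i j) (u, v) = (\<Sum>i\<le>?n. \<Sum>j\<le>?n. d i j * (N k \<tau> p r i u * N k \<tau> p r j v))"
      by (simp add: fun_sum_apply scaleR_fun_def N2_def)
    also have "\<dots> = (\<Sum>i\<le>?n. N k \<tau> p r i u * b i v)"
      by (intro sum.cong refl) (simp add: db[symmetric] sum_distrib_left ac_simps)
    also have "\<dots> = (\<Sum>i\<in>{0,1,2}. N k \<tau> p r i u * b i v)"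
      by (rule sum.mono_neutral_right) (use p5 in \<open>auto simp: b_def\<close>)
    also have "\<dots> = g0 v * M0 k \<tau> p r u + c1 v * M1 k \<tau> p r u + c2 v * M2 k \<tau> p r u"
      by (simp add: b_def M0_def M1_def M2_def m1_def[symmetric] m2_def[symmetric] distrib_left distrib_right ac_simps)
    also have "\<dots> = pullback F \<phi> S (u, v)"
    proof (cases "(u, v) \<in> unit_sq")
      case True
      then have "\<phi> (F S (u, v)) = gmap g0 g1 g2 S (u, v)" using \<phi> unfolding determined_by_def by blast
      then show ?thesis using True c1[of v] c2[of v] by (simp add: pullback_def zero_ext_def gmap_def)
    next
      case False
      then have "\<not> (0 \<le> u \<and> u \<le> 1) \<or> \<not> (0 \<le> v \<and> v \<le> 1)" by auto
      \<comment> \<open>The expansion in B-splines must hold on the whole plane. Outside the square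
        one of the factors of each product is a spline evaluated outside [0, 1], which is
        zero.\<close>
      then have "g0 v * M0 k \<tau> p r u + c1 v * M1 k \<tau> p r u + c2 v * M2 k \<tau> p r u = 0"
        using spl_zero_outside[OF c0, of v] spl_zero_outside[OF c(1), of v] spl_zero_outside[OF c(2), of v]
          M_in_spl[OF ranges(1), THEN spl_zero_outside, of u] by auto
      then show ?thesis using False by (auto simp: pullback_def zero_ext_def)
    qed
    finally show ?thesis by simp
  qed
  then have "pullback F \<phi> S = (\<Sum>i\<le>?n. \<Sum>j\<le>?n. d i j *\<^sub>R N2 k \<tau> p r i j)" by auto
  then show ?thesis by (intro exI[of _ d]) (simp add: d_def)
qed

section \<open>The space as the set of functions determined by triplets\<close>

lemma spline_spaces:
  "spline_space k \<tau> p (r + 2) = S0" "spline_space k \<tau> (p - d) (r + 1) = S1" "spline_space k \<tau> (p - 2 * d) r = S2"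
  using ranges by (simp_all add: spline_space_eq_spl)

lemma W22_iff:
  "\<phi> \<in> W22 k \<tau> p r F \<alpha> \<beta> \<longleftrightarrow> (\<exists>g0\<in>S0. \<exists>g1\<in>S1. \<exists>g2\<in>S2. determined_by F (gmap g0 g1 g2) \<phi>)"
proof
  assume "\<phi> \<in> W22 k \<tau> p r F \<alpha> \<beta>"
  then obtain g0 g1 g2 where g: "g0 \<in> S0" "g1 \<in> S1" "g2 \<in> S2"
    and \<phi>: "zero_ext (Omega F) \<phi> = \<phi>"
      "\<And>S u v. u \<in> {0..1} \<Longrightarrow> v \<in> {0..1} \<Longrightarrow> pullback F \<phi> S (u, v) = gmap g0 g1 g2 S (u, v)"
    unfolding W22_def V22_def V2_def V_def spline_spaces gmap_def by auto
  have "\<phi> (F S z) = gmap g0 g1 g2 S z" if "z \<in> unit_sq" for S z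
    using \<phi>(2)[of "fst z" "snd z" S] that by (auto simp: pullback_def zero_ext_def)
  then have "determined_by F (gmap g0 g1 g2) \<phi>" using \<phi>(1) by (auto simp: determined_by_def)
  then show "\<exists>g0\<in>S0. \<exists>g1\<in>S1. \<exists>g2\<in>S2. determined_by F (gmap g0 g1 g2) \<phi>" using g by blast
next
  assume "\<exists>g0\<in>S0. \<exists>g1\<in>S1. \<exists>g2\<in>S2. determined_by F (gmap g0 g1 g2) \<phi>"
  then obtain g0 g1 g2 where g: "g0 \<in> S0" "g1 \<in> S1" "g2 \<in> S2" and \<phi>: "determined_by F (gmap g0 g1 g2) \<phi>"
    by blast
  let ?n = "p + k * (p - r)"
  have "\<forall>S. \<exists>d. pullback F \<phi> S = (\<Sum>i\<le>?n. \<Sum>j\<le>?n. d i j *\<^sub>R N2 k \<tau> p r i j) \<and> (\<forall>i\<ge>3. \<forall>j. d i j = 0)"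
    by (rule allI, rule gmap_pullback[OF g \<phi>])
  from choice[OF this] obtain d where d:
    "\<forall>S. pullback F \<phi> S = (\<Sum>i\<le>?n. \<Sum>j\<le>?n. d S i j *\<^sub>R N2 k \<tau> p r i j) \<and> (\<forall>i\<ge>3. \<forall>j. d S i j = 0)" ..
  have "pullback F \<phi> S \<in> spline_space2 k \<tau> p r" for S
    unfolding d[THEN spec, THEN conjunct1] spline_space2_def by (intro span_sum span_scale span_base) force
  then have "\<phi> \<in> V k \<tau> p r F" using \<phi> by (simp add: V_def determined_by_def)
  then have "\<phi> \<in> V2 k \<tau> p r F" using gmap_C2[OF g \<phi>] by (simp add: V2_def)
  then have "\<phi> \<in> V22 k \<tau> p r F" using d unfolding V22_def by blast
  moreover have "pullback F \<phi> S (u, v) = gmap g0 g1 g2 S (u, v)" if "u \<in> {0..1}" "v \<in> {0..1}" for S u v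
    using \<phi> that by (simp add: pullback_def zero_ext_def determined_by_def)
  ultimately show "\<phi> \<in> W22 k \<tau> p r F \<alpha> \<beta>"
    unfolding W22_def spline_spaces using g by (auto simp: gmap_def)
qed

lemma gmap_linear_combination:
  assumes "\<And>i. i \<in> I \<Longrightarrow> a i \<in> S0" "\<And>i. i \<in> I \<Longrightarrow> b i \<in> S1" and z: "z \<in> unit_sq"
  shows "gmap (\<Sum>i\<in>I. c i *\<^sub>R a i) (\<Sum>i\<in>I. c i *\<^sub>R b i) (\<Sum>i\<in>I. c i *\<^sub>R e i) S z =
    (\<Sum>i\<in>I. c i * gmap (a i) (b i) (e i) S z)"
proof -
  obtain u v where uv: "z = (u, v)" "0 \<le> v" "v \<le> 1" using z by (cases z) auto
  have "D1 (\<Sum>i\<in>I. c i *\<^sub>R a i) v = (\<Sum>i\<in>I. c i * D1 (a i) v)"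
    "D1 (D1 (\<Sum>i\<in>I. c i *\<^sub>R a i)) v = (\<Sum>i\<in>I. c i * D1 (D1 (a i)) v)"
    "D1 (\<Sum>i\<in>I. c i *\<^sub>R b i) v = (\<Sum>i\<in>I. c i * D1 (b i) v)"
    using D1_linear_combination[OF assms(1) _ uv(2,3), of I] D1_D1_linear_combination[OF assms(1) _ uv(2,3), of I]
      D1_linear_combination[OF assms(2) _ uv(2,3), of I] by simp_all
  then show ?thesis
    by (simp add: gmap_def uv(1) fun_sum_scaleR_apply sum_distrib_left sum_distrib_right sum.distrib
        distrib_left distrib_right mult.assoc mult.left_commute)
qed

section \<open>The image of the B-spline bases\<close>

abbreviation "n0 \<equiv> dim (spline_space k \<tau> p (r + 2))"
abbreviation "n1 \<equiv> dim (spline_space k \<tau> (p - d) (r + 1))"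
abbreviation "n2 \<equiv> dim (spline_space k \<tau> (p - 2 * d) r)"

definition index_set :: "(nat \<times> nat) set" where
  "index_set = {0} \<times> {..<n0} \<union> {1} \<times> {..<n1} \<union> {2} \<times> {..<n2}"

text \<open>The triplets \<open>(f0 ij, f1 ij, f2 ij)\<close> form the basis of the product of the
  three spline spaces: index \<open>(i, j)\<close> has B-spline \<open>j\<close> in component
  \<open>i\<close> and zero elsewhere. With a single index set all three kinds of functions are
  treated at once.\<close>

definition f0 :: "nat \<times> nat \<Rightarrow> real \<Rightarrow> real" where
  "f0 = (\<lambda>(i, j). if i = 0 then N k \<tau> p (r + 2) j else 0)"

definition f1 :: "nat \<times> nat \<Rightarrow> real \<Rightarrow> real" where
  "f1 = (\<lambda>(i, j). if i = 1 then N k \<tau> (p - d) (r + 1) j else 0)"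

definition f2 :: "nat \<times> nat \<Rightarrow> real \<Rightarrow> real" where
  "f2 = (\<lambda>(i, j). if i = 2 then N k \<tau> (p - 2 * d) r j else 0)"

definition \<Phi> :: "nat \<times> nat \<Rightarrow> real \<times> real \<Rightarrow> real" where
  "\<Phi> = (\<lambda>(i, j). phibar k \<tau> p r F \<alpha> \<beta> i j)"

lemma N_bases:
  "is_basis_family (N k \<tau> p (r + 2)) {..<n0} S0"
  "is_basis_family (N k \<tau> (p - d) (r + 1)) {..<n1} S1"
  "is_basis_family (N k \<tau> (p - 2 * d) r) {..<n2} S2"
  using N_basis[OF ranges(3)] N_basis[OF ranges(4)] N_basis[OF ranges(5)]
    dim_spline_space[OF ranges(3)] dim_spline_space[OF ranges(4)] dim_spline_space[OF ranges(5)]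
  unfolding lessThan_Suc_atMost[symmetric] by metis+

lemma finite_index_set: "finite index_set"
  by (simp add: index_set_def)

lemma f_mem:
  assumes "ij \<in> index_set"
  shows "f0 ij \<in> S0" "f1 ij \<in> S1" "f2 ij \<in> S2"
  using assms is_basis_family_mem[OF N_bases(1)] is_basis_family_mem[OF N_bases(2)] is_basis_family_mem[OF N_bases(3)]
    subspace_0[OF subspace_spl]
  by (auto simp: index_set_def f0_def f1_def f2_def)

lemma gbar_eq_gmap:
  assumes "(i, j) \<in> index_set" "z \<in> unit_sq"
  shows "gbar k \<tau> p r \<alpha> \<beta> i j S z = gmap (f0 (i, j)) (f1 (i, j)) (f2 (i, j)) S z"
proof -
  obtain u v where z: "z = (u, v)" "0 \<le> v" "v \<le> 1" using assms(2) by (cases z) auto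
  have 1: "D1 (0 :: real \<Rightarrow> real) x = 0" if "0 \<le> x" "x \<le> 1" for x
    using D1_eqI[OF has_vector_derivative_const, of x "0::real"] that by (simp add: zero_fun_def)
  then have 2: "D1 (D1 (0 :: real \<Rightarrow> real)) v = 0"
    using D1_cong[of "D1 0" "0 :: real \<Rightarrow> real" v] z(2,3) by simp
  show ?thesis using assms(1) 1[OF z(2,3)] 2
    by (auto simp: index_set_def gbar_def gmap_def f0_def f1_def f2_def z(1))
qed

lemma gbar_ex1:
  assumes "(i, j) \<in> index_set"
  shows "\<exists>!\<phi>. determined_by F (gbar k \<tau> p r \<alpha> \<beta> i j) \<phi>"
  using gmap_ex1[OF f_mem[OF assms]]
    determined_by_cong[of "gbar k \<tau> p r \<alpha> \<beta> i j" "gmap (f0 (i, j)) (f1 (i, j)) (f2 (i, j))"]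
    gbar_eq_gmap[OF assms] by simp

lemma \<Phi>_determined:
  assumes "ij \<in> index_set"
  shows "determined_by F (gmap (f0 ij) (f1 ij) (f2 ij)) (\<Phi> ij)"
proof -
  obtain i j where ij: "ij = (i, j)" by (cases ij)
  have "determined_by F (gbar k \<tau> p r \<alpha> \<beta> i j) (\<Phi> ij)"
    using theI'[OF gbar_ex1] assms by (simp add: ij \<Phi>_def phibar_def)
  then show ?thesis
    using determined_by_cong[of "gbar k \<tau> p r \<alpha> \<beta> i j" "gmap (f0 (i, j)) (f1 (i, j)) (f2 (i, j))"]
      gbar_eq_gmap assms by (simp add: ij)
qed

lemma \<Phi>_combination:
  "determined_by F (gmap (\<Sum>ij\<in>index_set. c ij *\<^sub>R f0 ij) (\<Sum>ij\<in>index_set. c ij *\<^sub>R f1 ij)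
    (\<Sum>ij\<in>index_set. c ij *\<^sub>R f2 ij)) (\<Sum>ij\<in>index_set. c ij *\<^sub>R \<Phi> ij)"
  using determined_by_linear_combination[where I = index_set and c = c, OF \<Phi>_determined]
    determined_by_cong[OF gmap_linear_combination[where I = index_set and a = f0 and b = f1 and e = f2 and c = c, OF f_mem(1,2)]]
  by simp

lemma combination_mem:
  "(\<Sum>ij\<in>index_set. c ij *\<^sub>R f0 ij) \<in> S0" "(\<Sum>ij\<in>index_set. c ij *\<^sub>R f1 ij) \<in> S1"
  "(\<Sum>ij\<in>index_set. c ij *\<^sub>R f2 ij) \<in> S2"
  by (rule subspace_sum[OF subspace_spl], rule subspace_scale[OF subspace_spl], erule f_mem)+

text \<open>Only indices with first entry 0, 1 or 2 contribute to the respective component, so a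
  relation among the triplets splits into three univariate relations.\<close>

lemma combination_eq:
  "(\<Sum>ij\<in>index_set. c ij *\<^sub>R f0 ij) = (\<Sum>j<n0. c (0, j) *\<^sub>R N k \<tau> p (r + 2) j)"
  "(\<Sum>ij\<in>index_set. c ij *\<^sub>R f1 ij) = (\<Sum>j<n1. c (1, j) *\<^sub>R N k \<tau> (p - d) (r + 1) j)"
  "(\<Sum>ij\<in>index_set. c ij *\<^sub>R f2 ij) = (\<Sum>j<n2. c (2, j) *\<^sub>R N k \<tau> (p - 2 * d) r j)"
proof -
  have *: "(\<Sum>ij\<in>index_set. c ij *\<^sub>R f ij) = (\<Sum>j\<in>J. c (e, j) *\<^sub>R f (e, j))"
    if "Pair e ` J \<subseteq> index_set" "\<And>ij. ij \<in> index_set \<Longrightarrow> ij \<notin> Pair e ` J \<Longrightarrow> f ij = 0"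
    for f :: "nat \<times> nat \<Rightarrow> real \<Rightarrow> real" and e J
  proof -
    have "(\<Sum>ij\<in>index_set. c ij *\<^sub>R f ij) = (\<Sum>ij\<in>Pair e ` J. c ij *\<^sub>R f ij)"
      using that finite_index_set by (intro sum.mono_neutral_right) auto
    also have "\<dots> = (\<Sum>j\<in>J. c (e, j) *\<^sub>R f (e, j))"
      by (subst sum.reindex) (auto simp: inj_on_def)
    finally show ?thesis .
  qed
  show "(\<Sum>ij\<in>index_set. c ij *\<^sub>R f0 ij) = (\<Sum>j<n0. c (0, j) *\<^sub>R N k \<tau> p (r + 2) j)"
    by (subst *[of 0 "{..<n0}"]) (auto simp: index_set_def f0_def)
  show "(\<Sum>ij\<in>index_set. c ij *\<^sub>R f1 ij) = (\<Sum>j<n1. c (1, j) *\<^sub>R N k \<tau> (p - d) (r + 1) j)"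
    by (subst *[of 1 "{..<n1}"]) (auto simp: index_set_def f1_def)
  show "(\<Sum>ij\<in>index_set. c ij *\<^sub>R f2 ij) = (\<Sum>j<n2. c (2, j) *\<^sub>R N k \<tau> (p - 2 * d) r j)"
    by (subst *[of 2 "{..<n2}"]) (auto simp: index_set_def f2_def)
qed

theorem \<Phi>_basis: "is_basis_family \<Phi> index_set (W22 k \<tau> p r F \<alpha> \<beta>)"
proof (rule is_basis_familyI[OF finite_index_set])
  fix c ij assume 0: "(\<Sum>ij\<in>index_set. c ij *\<^sub>R \<Phi> ij) = 0" and ij: "ij \<in> index_set"
  have "gmap (\<Sum>ij\<in>index_set. c ij *\<^sub>R f0 ij) (\<Sum>ij\<in>index_set. c ij *\<^sub>R f1 ij)
    (\<Sum>ij\<in>index_set. c ij *\<^sub>R f2 ij) Lft z = 0" if "z \<in> unit_sq" for z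
    using \<Phi>_combination[of c] that unfolding 0 determined_by_def by force
  note zero = gmap_zero[OF combination_mem this, unfolded combination_eq]
  have "c (0, j) = 0" if "j < n0" for j
    using is_basis_family_zero[OF N_bases(1) finite_lessThan zero(1)] that by simp
  moreover have "c (1, j) = 0" if "j < n1" for j
    using is_basis_family_zero[OF N_bases(2) finite_lessThan zero(2)] that by simp
  moreover have "c (2, j) = 0" if "j < n2" for j
    using is_basis_family_zero[OF N_bases(3) finite_lessThan zero(3)] that by simp
  ultimately show "c ij = 0" using ij by (auto simp: index_set_def)
next
  show "W22 k \<tau> p r F \<alpha> \<beta> = range (\<lambda>c. \<Sum>ij\<in>index_set. c ij *\<^sub>R \<Phi> ij)"
  proof (intro set_eqI iffI)
    fix \<phi> assume "\<phi> \<in> W22 k \<tau> p r F \<alpha> \<beta>"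
    then obtain g0 g1 g2 where g: "g0 \<in> S0" "g1 \<in> S1" "g2 \<in> S2" and \<phi>: "determined_by F (gmap g0 g1 g2) \<phi>"
      unfolding W22_iff by blast
    obtain a0 where a0: "g0 = (\<Sum>j<n0. a0 j *\<^sub>R N k \<tau> p (r + 2) j)"
      using is_basis_family_obtain[OF N_bases(1) _ g(1)] by auto
    obtain a1 where a1: "g1 = (\<Sum>j<n1. a1 j *\<^sub>R N k \<tau> (p - d) (r + 1) j)"
      using is_basis_family_obtain[OF N_bases(2) _ g(2)] by auto
    obtain a2 where a2: "g2 = (\<Sum>j<n2. a2 j *\<^sub>R N k \<tau> (p - 2 * d) r j)"
      using is_basis_family_obtain[OF N_bases(3) _ g(3)] by auto
    define c where "c = (\<lambda>(i :: nat, j). if i = 0 then a0 j else if i = 1 then a1 j else a2 j)"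
    have "determined_by F (gmap g0 g1 g2) (\<Sum>ij\<in>index_set. c ij *\<^sub>R \<Phi> ij)"
      using \<Phi>_combination[of c] unfolding combination_eq by (simp add: c_def a0 a1 a2)
    then have "\<phi> = (\<Sum>ij\<in>index_set. c ij *\<^sub>R \<Phi> ij)" using gmap_ex1[OF g] \<phi> by blast
    then show "\<phi> \<in> range (\<lambda>c. \<Sum>ij\<in>index_set. c ij *\<^sub>R \<Phi> ij)" by blast
  next
    fix \<phi> assume "\<phi> \<in> range (\<lambda>c. \<Sum>ij\<in>index_set. c ij *\<^sub>R \<Phi> ij)"
    then show "\<phi> \<in> W22 k \<tau> p r F \<alpha> \<beta>"
      unfolding W22_iff using \<Phi>_combination combination_mem by blast
  qed
qed

end

theorem mainTheorem3:
  fixes p r k n0 n1 n2 :: nat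
    and \<tau> :: "nat \<Rightarrow> real"
    and F :: "patch \<Rightarrow> real \<times> real \<Rightarrow> real \<times> real"
    and \<alpha> \<beta> :: "patch \<Rightarrow> real poly"
  assumes "p \<ge> 5" and "2 \<le> r" and "r \<le> p - 3"
    and "\<forall>i\<in>{1..k}. 0 < \<tau> i \<and> \<tau> i < 1"
    and "strict_mono_on {1..k} \<tau>"
    and "two_patch_parameterization k \<tau> p r F"
    and "bilinear_like_G2 F \<alpha> \<beta>"
    and "n0 = dim (spline_space k \<tau> p (r + 2))"
    and "n1 = dim (spline_space k \<tau> (p - d_alpha \<alpha>) (r + 1))"
    and "n2 = dim (spline_space k \<tau> (p - 2 * d_alpha \<alpha>) r)"
  defines "I \<equiv> {0} \<times> {..<n0} \<union> {1} \<times> {..<n1} \<union> {2} \<times> {..<n2}"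
  shows "(\<forall>(i, j)\<in>I. \<exists>!\<phi>. determined_by F (gbar k \<tau> p r \<alpha> \<beta> i j) \<phi>) \<and>
    is_basis_family (\<lambda>(i, j). phibar k \<tau> p r F \<alpha> \<beta> i j) I (W22 k \<tau> p r F \<alpha> \<beta>)"
proof -
  interpret G2_spline_patches k \<tau> p r F \<alpha> \<beta>
    using assms by unfold_locales auto
  have I: "I = index_set" using assms by (simp add: index_set_def)
  show ?thesis
    unfolding I using gbar_ex1 \<Phi>_basis[unfolded \<Phi>_def] by blast
qed

end
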